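(* Let $d\geq 3$, $1\leq k\leq d$, let $A=I$ (the $d\times d$ identity matrix, which belongs to $\mathcal{A}_k$) and let $b\in\mathbb{R}^d$. Define $$c_*=\Big(\frac{d-k}{d}\Big)^{2/k}\Big[-\frac12+\int_1^\infty \tau\Big(\big(1+\tfrac{k}{d-k}\tau^{-d}\big)^{1/k}-1\Big)\,d\tau\Big]+\frac12|b|^2\quad\text{if }1\leq k\leq d-1,$$ $$c_*=\int_0^\infty \tau\big((1+\tau^{-d})^{1/d}-1\big)\,d\tau+\frac12|b|^2\quad\text{if }k=d.$$ Then: (i) For every $c<c_*$ there exists a unique smooth bounded domain $\Omega\subset\mathbb{R}^d$ such that problem (P) with data $(I,b,c)$ admits a strictly convex solution $u\in C^\infty(\mathbb{R}^d\setminus\Omega)$; for this $\Omega$ the strictly convex solution is unique. Moreover $\Omega$ is a ball centered at $-b$ with radius $r_0>0$ depending on $k,d,b,c$, and $u$ is radially symmetric about $-b$. (ii) For every $c\geq c_*$ and every smooth bounded domain $\Omega$, problem (P) with data $(I,b,c)$ admits no strictly convex solution.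
   Context: For $\lambda=(\lambda_1,\dots,\lambda_d)$, $\sigma_k(\lambda)=\sum_{1\le i_1<\dots<i_k\le d}\lambda_{i_1}\cdots\lambda_{i_k}$; $\lambda(M)$ denotes the vector of eigenvalues of a symmetric matrix $M$, and $\binom{d}{k}$ is the binomial coefficient. $\mathcal{A}_k$ is the set of $d\times d$ real symmetric positive definite matrices $A$ with $\sigma_k(\lambda(A))=\binom{d}{k}$. For a bounded domain $\Omega\subset\mathbb{R}^d$ with outer unit normal $\nu$ on $\partial\Omega$, and $(A,b,c)\in\mathcal{A}_k\times\mathbb{R}^d\times\mathbb{R}$, problem (P) is: $\sigma_k(\lambda(D^2u))=\binom{d}{k}$ in $\mathbb{R}^d\setminus\bar\Omega$; $u=0$ and $\partial u/\partial\nu=1$ on $\partial\Omega$; $u(x)-\big(\frac12 x\cdot Ax+b\cdot x+c\big)\to0$ as $|x|\to\infty$. A function is strictly convex if its Hessian is positive definite. *)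

theory Defs
  imports "HOL-Analysis.Analysis"
begin

definition sigma_k :: "nat \<Rightarrow> ('n::finite \<Rightarrow> real) \<Rightarrow> real" where
  "sigma_k k lam = (\<Sum>S\<in>{S::'n set. card S = k}. \<Prod>i\<in>S. lam i)"

text \<open>Eigenvalues (with multiplicity) of a square matrix: an enumeration of the roots of the
  characteristic polynomial. For symmetric real matrices such an enumeration exists and is unique
  up to permutation, so sigma_k of it is well defined.\<close>
definition eigvals :: "real^'n^'n \<Rightarrow> ('n::finite \<Rightarrow> real)" where
  "eigvals M = (SOME lam. \<forall>x::real. det (x *\<^sub>R mat 1 - M) = (\<Prod>i\<in>UNIV. (x - lam i)))"

definition pd :: "'n \<Rightarrow> (real^'n \<Rightarrow> real) \<Rightarrow> real^'n \<Rightarrow> real" where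
  "pd i f x = frechet_derivative f (at x) (axis i 1)"

fun pdl :: "'n list \<Rightarrow> (real^'n \<Rightarrow> real) \<Rightarrow> real^'n \<Rightarrow> real" where
  "pdl [] f = f"
| "pdl (i # is) f = pd i (pdl is f)"

definition smooth_on :: "(real^'n::finite) set \<Rightarrow> (real^'n \<Rightarrow> real) \<Rightarrow> bool" where
  "smooth_on U f \<longleftrightarrow> open U \<and> (\<forall>is. pdl is f differentiable_on U)"

definition grad :: "(real^'n \<Rightarrow> real) \<Rightarrow> real^'n \<Rightarrow> real^'n" where
  "grad f x = (\<chi> i. pd i f x)"

definition hess :: "(real^'n \<Rightarrow> real) \<Rightarrow> real^'n \<Rightarrow> real^'n^'n" where
  "hess f x = (\<chi> i j. pd i (pd j f) x)"

definition pos_def :: "real^'n^'n \<Rightarrow> bool" where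
  "pos_def M \<longleftrightarrow> (\<forall>v. v \<noteq> 0 \<longrightarrow> v \<bullet> (M *v v) > 0)"

definition defining_fun :: "(real^'n::finite) set \<Rightarrow> (real^'n \<Rightarrow> real) \<Rightarrow> bool" where
  "defining_fun \<Omega> \<phi> \<longleftrightarrow> smooth_on UNIV \<phi> \<and> \<Omega> = {x. \<phi> x < 0}
      \<and> (\<forall>x. \<phi> x = 0 \<longrightarrow> grad \<phi> x \<noteq> 0)"

definition smooth_bounded_domain :: "(real^'n::finite) set \<Rightarrow> bool" where
  "smooth_bounded_domain \<Omega> \<longleftrightarrow> \<Omega> \<noteq> {} \<and> open \<Omega> \<and> connected \<Omega> \<and> bounded \<Omega>
      \<and> (\<exists>\<phi>. defining_fun \<Omega> \<phi>)"

definition outer_normal :: "(real^'n::finite) set \<Rightarrow> real^'n \<Rightarrow> real^'n" where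
  "outer_normal \<Omega> x = (let \<phi> = (SOME \<phi>. defining_fun \<Omega> \<phi>) in grad \<phi> x /\<^sub>R norm (grad \<phi> x))"

text \<open>u is a (C^infinity up to the boundary) solution of (P) with data (I,b,c); u is smooth on an
  open neighbourhood of the closed set R^d \ Omega.\<close>
definition solves_P :: "nat \<Rightarrow> (real^'n::finite) set \<Rightarrow> real^'n \<Rightarrow> real \<Rightarrow> (real^'n \<Rightarrow> real) \<Rightarrow> bool" where
  "solves_P k \<Omega> b c u \<longleftrightarrow>
     (\<exists>U. - \<Omega> \<subseteq> U \<and> smooth_on U u)
   \<and> (\<forall>x. x \<notin> closure \<Omega> \<longrightarrow> sigma_k k (eigvals (hess u x)) = real (CARD('n) choose k))
   \<and> (\<forall>x\<in>frontier \<Omega>. u x = 0 \<and> grad u x \<bullet> outer_normal \<Omega> x = 1)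
   \<and> ((\<lambda>x. u x - ((1/2) * (x \<bullet> x) + b \<bullet> x + c)) \<longlongrightarrow> 0) at_infinity"

definition strictly_convex_on :: "(real^'n::finite) set \<Rightarrow> (real^'n \<Rightarrow> real) \<Rightarrow> bool" where
  "strictly_convex_on S u \<longleftrightarrow> (\<forall>x\<in>S. pos_def (hess u x))"

definition c_star :: "nat \<Rightarrow> nat \<Rightarrow> real^'n \<Rightarrow> real" where
  "c_star d k b =
    (if k \<le> d - 1 then
       ((real d - real k) / real d) powr (2 / real k) *
         (- 1/2 + integral {1..} (\<lambda>\<tau>. \<tau> * ((1 + real k / (real d - real k) * \<tau> powr (- real d)) powr (1 / real k) - 1)))
       + (1/2) * (norm b)\<^sup>2
     else
       integral {0<..} (\<lambda>\<tau>. \<tau> * ((1 + \<tau> powr (- real d)) powr (1 / real d) - 1)) + (1/2) * (norm b)\<^sup>2)"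

end

theory Submission
  imports Defs "HOL-Computational_Algebra.Polynomial"
begin

text \<open>Radial solutions about the point -b satisfy an explicit first-order equation and form a
  one-parameter family indexed by the radius R of the ball; the family ends at a critical radius at
  which the second radial derivative vanishes, and the constant c at infinity decreases strictly in R,
  with supremum c_star.

  Let u be any strictly convex solution outside a domain Om. Its extension by 0 is locally convex,
  hence convex, so u is nonnegative, and comparison along outer normals gives norm (grad u) > 1 off the
  closure of Om. At the point of contact with the smallest ball about -b containing Om, minimality of
  norm (grad u) makes the normal an eigenvector of the Hessian, whose tangential part is at least 1/r0
  because u is nonnegative on the sphere; with the equation this makes the radius r0 supercritical. If c exceeded
  the constant of r0, a radial function of slope larger than 1 at the sphere would stay below u,
  contradicting the slope of u at the contact point. This rules out c at or above c_star, and for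
  smaller c it puts Om inside the ball of the radius R with constant c. Conversely u is bounded above
  by the radial solution extended by norm (x + b) - R inside the ball: at a maximum of the difference
  inside the ball the extension has slope at most 1 while u is steeper. Hence Om contains the ball,
  and both comparisons together identify u.\<close>


subsection \<open>Elementary symmetric functions of eigenvalues\<close>

text \<open>Two obstacles shape the argument. \<open>Om\<close> is not known to be convex, so
  nonnegativity of \<open>u\<close>, on which all contact arguments rest, has to come from convexity
  of the extension. And a radial function is available only outside its own ball, whereas
  \<open>Om\<close> may be smaller than that ball; the cone \<open>norm (x + b) - R\<close> fills
  the gap because its slope 1 is both the boundary slope of the radial solution and the lower bound
  for the slope of \<open>u\<close>. At the contact point equal slopes contradict nothing. The
  parameter \<open>m\<close> of the radial family is therefore raised slightly above
  \<open>1 / r0 ^ k - 1\<close>: continuity in \<open>m\<close> keeps the constant below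
  \<open>c\<close>, and supercriticality, an open condition, keeps the radial function strictly
  convex. The critical radius comes from the radial eigenvalue, which on the sphere is a positive
  multiple of \<open>1 - (d - k) / k * m\<close>; it vanishes when \<open>d * R ^ k = d - k\<close>.
  Comparison rests on monotonicity of \<open>sigma_k\<close> on positive semidefinite matrices:
  adding a rank-one square adds a polynomial with nonnegative coefficients to the characteristic
  polynomial.\<close>

lemma linear_term_eq_0:
  fixes a b :: real
  assumes "\<And>t. a * t + b * t\<^sup>2 \<le> 0"
  shows "a = 0"
proof (rule ccontr)
  assume "a \<noteq> 0"
  \<comment> \<open>With this \<open>t\<close> the linear term is
    \<open>t\<^sup>2 * (\<bar>b\<bar> + 1)\<close>, which beats \<open>b * t\<^sup>2\<close>
    whatever the sign of \<open>b\<close>.\<close>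
  define t where "t = a / (\<bar>b\<bar> + 1)"
  have bp: "\<bar>b\<bar> + 1 > 0" by simp
  have "t * (\<bar>b\<bar> + 1) = a" and "t \<noteq> 0" using bp \<open>a \<noteq> 0\<close> by (auto simp: t_def)
  then have "a * t + b * t\<^sup>2 = t\<^sup>2 * (\<bar>b\<bar> + 1 + b)"
    by (auto simp: power2_eq_square algebra_simps)
  moreover have "\<dots> > 0"
    using \<open>t \<noteq> 0\<close> by (intro mult_pos_pos) (auto simp: abs_if)
  ultimately show False using assms[of t] by linarith
qed

section \<open>Spectral theorem for real symmetric matrices\<close>

definition diag_mat :: "('n::finite \<Rightarrow> real) \<Rightarrow> real^'n^'n" where
  "diag_mat lam = (\<chi> i j. if i = j then lam i else 0)"

lemma sym_inner_commute:
  fixes M :: "real^'n^'n"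
  assumes "transpose M = M"
  shows "x \<bullet> (M *v y) = y \<bullet> (M *v x)"
  by (metis assms dot_lmul_matrix inner_commute vector_transpose_matrix)

text \<open>A maximiser of the quadratic form on the unit sphere of an invariant subspace is an
  eigenvector. By symmetry its orthogonal complement in the subspace is again invariant, so
  induction on the dimension applies.\<close>

lemma symmetric_eigenbasis:
  fixes M :: "real^'n::finite^'n"
  assumes sym: "transpose M = M"
  shows "subspace S \<Longrightarrow> (\<And>x. x \<in> S \<Longrightarrow> M *v x \<in> S) \<Longrightarrow>
    \<exists>B. B \<subseteq> S \<and> pairwise orthogonal B \<and> (\<forall>v\<in>B. norm v = 1 \<and> (\<exists>l. M *v v = l *\<^sub>R v))
        \<and> finite B \<and> card B = dim S"
proof (induction "dim S" arbitrary: S)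
  case 0
  then show ?case by (intro exI[of _ "{}"]) auto
next
  case (Suc n)
  from Suc.hyps(2) have "\<not> S \<subseteq> {0}" by (metis dim_eq_0 nat.distinct(1))
  then obtain w where w: "w \<in> S" "w \<noteq> 0" by auto
  let ?K = "S \<inter> sphere 0 1"
  have "compact ?K"
    using closed_subspace[OF Suc.prems(1)] by (simp add: closed_Int_compact)
  moreover have "w /\<^sub>R norm w \<in> ?K"
    using w Suc.prems(1) by (simp add: subspace_scale)
  moreover have "continuous_on ?K (\<lambda>x. x \<bullet> (M *v x))"
    by (intro continuous_intros)
  ultimately obtain v where v: "v \<in> ?K" and vmax: "\<And>x. x \<in> ?K \<Longrightarrow> x \<bullet> (M *v x) \<le> v \<bullet> (M *v v)"
    using continuous_attains_sup[of ?K "\<lambda>x. x \<bullet> (M *v x)"] by blast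
  define l where "l = v \<bullet> (M *v v)"
  have nv: "norm v = 1" and vS: "v \<in> S" using v by auto
  then have vv: "v \<bullet> v = 1" by (simp add: norm_eq_1)
  have le: "x \<bullet> (M *v x) \<le> l * (x \<bullet> x)" if "x \<in> S" for x
  proof (cases "x = 0")
    case False
    then have "x /\<^sub>R norm x \<in> ?K" using that Suc.prems(1) by (simp add: subspace_scale)
    from vmax[OF this] have "(x \<bullet> (M *v x)) / (norm x)\<^sup>2 \<le> l"
      by (simp add: l_def matrix_vector_mult_scaleR power2_eq_square field_simps)
    then show ?thesis using False by (simp add: power2_norm_eq_inner[symmetric] field_simps)
  qed simp
  have MvS: "M *v v - l *\<^sub>R v \<in> S"
    using Suc.prems vS by (simp add: subspace_diff subspace_scale)
  have "w \<bullet> (M *v v - l *\<^sub>R v) = 0" if "w \<in> S" for w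
  proof -
    \<comment> \<open>First variation: \<open>le\<close> at \<open>v + t *\<^sub>R w\<close> is a
      quadratic in \<open>t\<close> that is never positive and has no constant term, so its linear
      coefficient vanishes. Choosing \<open>w\<close> as the residual itself gives the eigenvalue
      equation.\<close>
    have "2 * (w \<bullet> (M *v v - l *\<^sub>R v)) * t + (w \<bullet> (M *v w) - l * (w \<bullet> w)) * t\<^sup>2 \<le> 0" for t
    proof -
      have "v + t *\<^sub>R w \<in> S" using that vS Suc.prems(1) by (simp add: subspace_add subspace_scale)
      from le[OF this] show ?thesis
        using sym_inner_commute[OF sym, of v w]
        by (simp add: matrix_vector_right_distrib matrix_vector_mult_scaleR inner_simps vv
            l_def[symmetric] power2_eq_square algebra_simps inner_commute)
    qed
    from linear_term_eq_0[OF this] show ?thesis by simp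
  qed
  from this[OF MvS] have eig: "M *v v = l *\<^sub>R v" by simp
  define T where "T = {y \<in> S. \<forall>x\<in>span {v}. orthogonal x y}"
  have T': "T = {y \<in> S. orthogonal v y}"
    unfolding T_def by (auto intro: span_base simp: span_singleton orthogonal_def)
  have subT: "subspace T"
    unfolding T' using Suc.prems(1)
    by (auto simp: subspace_def orthogonal_def inner_simps)
  have MT: "M *v x \<in> T" if "x \<in> T" for x
    using that Suc.prems(2) sym_inner_commute[OF sym, of v x] unfolding T'
    by (auto simp: orthogonal_def eig inner_commute)
  have "span {v} \<subseteq> S" using vS Suc.prems(1) by (simp add: span_minimal)
  then have "dim T + dim (span {v}) = dim S"
    unfolding T_def using Suc.prems(1) by (intro dim_subspace_orthogonal_to_vectors) auto
  moreover have "dim (span {v}) = 1"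
    using nv by (metis card.empty card_insert_disjoint dim_span empty_iff finite.emptyI indep_card_eq_dim_span independent_insert independent_empty norm_zero One_nat_def span_empty singletonD zero_neq_one)
  ultimately have dT: "dim T + 1 = dim S" by simp
  obtain B where B: "B \<subseteq> T" "pairwise orthogonal B"
      "\<forall>v\<in>B. norm v = 1 \<and> (\<exists>l. M *v v = l *\<^sub>R v)" "finite B" "card B = dim T"
    using Suc.hyps(1)[of T] subT MT dT Suc.hyps(2) by auto
  have "v \<notin> B" using B(1) vv unfolding T' by (auto simp: orthogonal_def)
  moreover have "pairwise orthogonal (insert v B)"
    using B(1,2) unfolding T' by (auto simp: pairwise_insert orthogonal_commute)
  moreover have "insert v B \<subseteq> S" using vS B(1) T' by auto
  ultimately show ?case
    using B(3-5) nv eig dT by (intro exI[of _ "insert v B"]) auto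
qed

lemma symmetric_diagonalizable:
  fixes M :: "real^'n::finite^'n"
  assumes sym: "transpose M = M"
  obtains Q lam where "orthogonal_matrix Q" "M = transpose Q ** diag_mat lam ** Q"
proof -
  obtain B where B: "pairwise orthogonal B" "finite B" "card B = CARD('n)"
      "\<And>v. v \<in> B \<Longrightarrow> norm v = 1" "\<And>v. v \<in> B \<Longrightarrow> \<exists>l. M *v v = l *\<^sub>R v"
    using symmetric_eigenbasis[OF sym, of UNIV] by auto
  obtain f :: "'n \<Rightarrow> real^'n" where f: "bij_betw f UNIV B"
    using B(2,3) by (metis finite_class.finite_UNIV finite_same_card_bij)
  then have fB: "f i \<in> B" for i by (auto simp: bij_betw_def)
  obtain lam where lam: "\<And>i. M *v f i = lam i *\<^sub>R f i" using B(5)[OF fB] by metis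
  define Q where "Q = (\<chi> i. f i)"
  have row: "row i Q = f i" for i by (simp add: Q_def row_def vec_eq_iff)
  have Q: "orthogonal_matrix Q"
    unfolding orthogonal_matrix_orthonormal_rows row
  proof (intro conjI allI impI)
    show "norm (f i) = 1" for i using B(4) fB .
    show "orthogonal (f i) (f j)" if "i \<noteq> j" for i j
      using that B(1) fB f by (metis UNIV_I bij_betw_imp_inj_on inj_on_def pairwise_def)
  qed
  have "Q ** M = diag_mat lam ** Q"
  proof -
    have "(Q ** M) $ i $ j = (diag_mat lam ** Q) $ i $ j" for i j
    proof -
      have "(Q ** M) $ i $ j = (\<Sum>k\<in>UNIV. f i $ k * M $ k $ j)"
        by (simp add: matrix_matrix_mult_def Q_def)
      also have "\<dots> = (M *v f i) $ j"
        using sym by (simp add: matrix_vector_mult_def vec_eq_iff transpose_def mult.commute)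
      also have "\<dots> = (diag_mat lam ** Q) $ i $ j"
        by (simp add: lam matrix_matrix_mult_def Q_def diag_mat_def if_distrib if_distribR cong: if_cong)
      finally show ?thesis .
    qed
    then show ?thesis by (simp add: vec_eq_iff)
  qed
  then have "M = transpose Q ** diag_mat lam ** Q"
    using Q by (metis matrix_mul_assoc matrix_mul_lid orthogonal_matrix_def)
  with Q show ?thesis by (rule that)
qed

lemma matrix_add_rdistrib: "(A + B) ** C = A ** C + B ** C"
  by (simp add: matrix_matrix_mult_def vec_eq_iff sum.distrib distrib_right)

lemma orthogonal_conj_add:
  fixes Q :: "real^'n::finite^'n"
  assumes "orthogonal_matrix Q"
  shows "x *\<^sub>R mat 1 + transpose Q ** A ** Q = transpose Q ** (x *\<^sub>R mat 1 + A) ** Q"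
proof -
  have "transpose Q ** (x *\<^sub>R mat 1) ** Q = x *\<^sub>R mat 1"
    using assms by (simp add: matrix_scalar_ac scalar_matrix_assoc[symmetric] orthogonal_matrix_def)
  then show ?thesis by (simp add: matrix_add_ldistrib matrix_add_rdistrib)
qed

lemma det_orthogonal_conj:
  fixes Q :: "real^'n::finite^'n"
  assumes "orthogonal_matrix Q"
  shows "det (transpose Q ** A ** Q) = det A"
proof -
  have "det Q * det Q = 1"
    using det_orthogonal_matrix[OF assms] by auto
  then show ?thesis by (simp add: det_mul det_transpose) 
qed

lemma det_diag_mat: "det (diag_mat lam) = (\<Prod>i\<in>UNIV. lam i)"
  unfolding diag_mat_def by (subst det_diagonal) auto

lemma scaleR_mat_add_diag_mat: "x *\<^sub>R mat 1 + diag_mat lam = diag_mat (\<lambda>i. x + lam i)"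
  by (auto simp: diag_mat_def mat_def vec_eq_iff)

lemma det_diag_conj:
  fixes Q :: "real^'n::finite^'n"
  assumes "orthogonal_matrix Q" "M = transpose Q ** diag_mat lam ** Q"
  shows "det (x *\<^sub>R mat 1 + M) = (\<Prod>i\<in>UNIV. x + lam i)"
  using assms by (simp add: orthogonal_conj_add det_orthogonal_conj scaleR_mat_add_diag_mat det_diag_mat)

section \<open>Elementary symmetric functions as coefficients of the characteristic
  polynomial\<close>

definition cpoly :: "('n::finite \<Rightarrow> real) \<Rightarrow> real poly" where
  "cpoly lam = (\<Prod>i\<in>UNIV. [:lam i, 1:])"

lemma poly_cpoly: "poly (cpoly lam) x = (\<Prod>i\<in>UNIV. x + lam i)"
  by (simp add: cpoly_def poly_prod add.commute)

text \<open>Multiplying out, the set \<open>X\<close> records the factors that contribute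
  \<open>lam i\<close> instead of the variable. The factors are \<open>x + lam i\<close> rather than
  \<open>x - lam i\<close>, so no alternating signs appear and nonnegative \<open>lam\<close> gives
  nonnegative coefficients.\<close>

lemma coeff_cpoly:
  fixes lam :: "'n::finite \<Rightarrow> real"
  assumes "k \<le> CARD('n)"
  shows "coeff (cpoly lam) (CARD('n) - k) = sigma_k k lam"
proof -
  have "cpoly lam = (\<Prod>i\<in>UNIV. [:lam i:] + [:0, 1:])"
    by (simp add: cpoly_def)
  also have "\<dots> = (\<Sum>X\<in>Pow UNIV. (\<Prod>i\<in>X. [:lam i:]) * (\<Prod>i\<in>UNIV - X. [:0, 1:]))"
    by (rule prod_add) simp
  also have "\<dots> = (\<Sum>X\<in>UNIV. monom (\<Prod>i\<in>X. lam i) (CARD('n) - card X))"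
  proof (intro sum.cong)
    fix X :: "'n set"
    have "(\<Prod>i\<in>X. [:lam i:]) = [:\<Prod>i\<in>X. lam i:]"
      by (induction X rule: infinite_finite_induct) (auto simp: one_pCons)
    then show "(\<Prod>i\<in>X. [:lam i:]) * (\<Prod>i\<in>UNIV - X. [:0, 1:]) = monom (\<Prod>i\<in>X. lam i) (CARD('n) - card X)"
      by (simp add: card_Diff_subset monom_altdef)
  qed simp
  finally have "coeff (cpoly lam) (CARD('n) - k)
      = (\<Sum>X\<in>UNIV. if CARD('n) - card X = CARD('n) - k then (\<Prod>i\<in>X. lam i) else 0)"
    by (simp add: coeff_sum)
  also have "\<dots> = (\<Sum>X\<in>{X. card X = k}. \<Prod>i\<in>X. lam i)"
  proof -
    have "CARD('n) - card X = CARD('n) - k \<longleftrightarrow> card X = k" for X :: "'n set"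
      using assms card_mono[of "UNIV :: 'n set" X] by auto
    then show ?thesis by (simp add: sum.If_cases)
  qed
  finally show ?thesis by (simp add: sigma_k_def)
qed

text \<open>The choice inside \<open>eigvals\<close> is harmless: \<open>lam\<close> shows that a
  factorisation exists, and any two enumerations yield the same polynomial and hence the same
  coefficients. The powers of \<open>- 1\<close> translate between
  \<open>x *\<^sub>R mat 1 + M\<close> here and \<open>x *\<^sub>R mat 1 - M\<close> in the
  definition.\<close>

lemma sigma_k_eigvals:
  fixes M :: "real^'n::finite^'n" and lam :: "'n \<Rightarrow> real"
  assumes k: "k \<le> CARD('n)" and M: "\<And>x. det (x *\<^sub>R mat 1 + M) = (\<Prod>i\<in>UNIV. x + lam i)"
  shows "sigma_k k (eigvals M) = sigma_k k lam"
proof -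
  have neg: "det (- A) = (- 1) ^ CARD('n) * det A" for A :: "real^'n^'n"
  proof -
    have "- A = (\<chi> i. (- 1) *s (A $ i))" by (simp add: vec_eq_iff)
    then have "det (- A) = (\<Prod>i\<in>(UNIV :: 'n set). - 1) * det (\<chi> i. A $ i)"
      by (simp only: det_rows_mul)
    then show ?thesis by simp
  qed
  have dt: "det (x *\<^sub>R mat 1 - M) = (-1) ^ CARD('n) * det ((- x) *\<^sub>R mat 1 + M)" for x
    using neg[of "(- x) *\<^sub>R mat 1 + M"] by simp
  have "\<forall>x. det (x *\<^sub>R mat 1 - M) = (\<Prod>i\<in>UNIV. x - lam i)"
  proof
    fix x
    have "(\<Prod>i\<in>UNIV. x - lam i) = (\<Prod>i\<in>UNIV. (- 1) * (- x + lam i))" by simp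
    also have "\<dots> = (- 1) ^ CARD('n) * (\<Prod>i\<in>UNIV. - x + lam i)"
      unfolding prod.distrib by simp
    finally show "det (x *\<^sub>R mat 1 - M) = (\<Prod>i\<in>UNIV. x - lam i)" unfolding dt M by simp
  qed
  then have ev: "\<forall>x. det (x *\<^sub>R mat 1 - M) = (\<Prod>i\<in>UNIV. x - eigvals M i)"
    unfolding eigvals_def by (rule someI[of "\<lambda>l. \<forall>x. det (x *\<^sub>R mat 1 - M) = (\<Prod>i\<in>UNIV. x - l i)"])
  have "poly (cpoly (eigvals M)) x = poly (cpoly lam) x" for x
  proof -
    have "(\<Prod>i\<in>UNIV. - x - eigvals M i) = (\<Prod>i\<in>UNIV. (- 1) * (x + eigvals M i))"
      by (simp add: algebra_simps)
    also have "\<dots> = (- 1) ^ CARD('n) * (\<Prod>i\<in>UNIV. x + eigvals M i)"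
      unfolding prod.distrib by simp
    finally show ?thesis using ev[rule_format, of "- x"] unfolding dt M poly_cpoly by simp
  qed
  then have "cpoly (eigvals M) = cpoly lam" by (simp add: poly_eq_poly_eq_iff[symmetric] fun_eq_iff)
  then show ?thesis using coeff_cpoly[OF k] by metis
qed

section \<open>Rank-one updates and monotonicity of \<open>sigma_k\<close>\<close>

definition outer_prod :: "real^'n \<Rightarrow> real^'n^'n" where
  "outer_prod v = (\<chi> i j. v $ i * v $ j)"

lemma outer_prod_mult: "outer_prod v *v x = (v \<bullet> x) *\<^sub>R v"
  by (simp add: vec_eq_iff outer_prod_def matrix_vector_mult_def inner_vec_def sum_distrib_left mult_ac)

lemma outer_prod_conj:
  fixes A :: "real^'n::finite^'n"
  shows "transpose A ** outer_prod v ** A = outer_prod (transpose A *v v)"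
proof -
  have "(transpose A ** outer_prod v ** A) *v x = outer_prod (transpose A *v v) *v x" for x
  proof -
    have "v \<bullet> (A *v x) = (transpose A *v v) \<bullet> x"
      by (metis dot_lmul_matrix transpose_matrix_vector)
    then show ?thesis
      by (simp only: matrix_vector_mul_assoc[symmetric] outer_prod_mult matrix_vector_mult_scaleR)
  qed
  then show ?thesis by (simp add: matrix_eq)
qed

text \<open>A rotation moves v to a coordinate axis and makes the matrix diagonal.\<close>
lemma det_scale_add_outer_prod:
  fixes v :: "real^'n::finite"
  shows "\<exists>i::'n. \<forall>c g. det (c *\<^sub>R mat 1 + g *\<^sub>R outer_prod v) = (\<Prod>j\<in>UNIV. c + (if j = i then g * (v \<bullet> v) else 0))"
proof -
  fix i :: 'n
  define a :: "real^'n" where "a = norm v *\<^sub>R axis i 1"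
  have "norm a = norm v" by (simp add: a_def)
  then obtain f where f: "orthogonal_transformation f" "f a = v"
    by (rule orthogonal_transformation_exists)
  let ?Q = "matrix f"
  have Q: "orthogonal_matrix ?Q" and lin: "linear f"
    using f(1) orthogonal_transformation_matrix by blast+
  then have Qv: "?Q *v (norm v *\<^sub>R axis i 1) = v"
    using f(2) matrix_works[of f a] lin by (simp only: linear_matrix_vector_mul_eq a_def)
  have Qtv: "transpose ?Q *v v = norm v *\<^sub>R axis i 1"
  proof -
    have "transpose ?Q *v v = transpose ?Q *v (?Q *v (norm v *\<^sub>R axis i 1))" by (simp only: Qv)
    also have "\<dots> = (transpose ?Q ** ?Q) *v (norm v *\<^sub>R axis i 1)" by (simp only: matrix_vector_mul_assoc)
    finally show ?thesis using Q by (simp add: orthogonal_matrix)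
  qed
  have "det (c *\<^sub>R mat 1 + g *\<^sub>R outer_prod v) = (\<Prod>j\<in>UNIV. c + (if j = i then g * (v \<bullet> v) else 0))" for c g
  proof -
    have "det (c *\<^sub>R mat 1 + g *\<^sub>R outer_prod v) = det (transpose ?Q ** (c *\<^sub>R mat 1 + g *\<^sub>R outer_prod v) ** ?Q)"
      by (rule det_orthogonal_conj[OF Q, symmetric])
    also have "transpose ?Q ** (c *\<^sub>R mat 1 + g *\<^sub>R outer_prod v) ** ?Q = c *\<^sub>R mat 1 + g *\<^sub>R outer_prod (norm v *\<^sub>R axis i 1)"
      by (simp only: orthogonal_conj_add[OF Q, symmetric] matrix_scalar_ac scalar_matrix_assoc[symmetric] outer_prod_conj Qtv)
    also have "\<dots> = c *\<^sub>R mat 1 + diag_mat (\<lambda>j. if j = i then g * (v \<bullet> v) else 0)"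
    proof -
      have nv: "norm v * norm v = v \<bullet> v" by (metis power2_norm_eq_inner power2_eq_square)
      show ?thesis by (simp add: vec_eq_iff outer_prod_def diag_mat_def axis_def nv)
    qed
    finally show ?thesis by (simp add: scaleR_mat_add_diag_mat det_diag_mat)
  qed
  then show ?thesis by blast
qed

text \<open>The matrix determinant lemma. Pulling the square roots of \<open>E\<close> out on both
  sides leaves \<open>mat 1 + outer_prod z\<close>, whose determinant is
  \<open>1 + z \<bullet> z\<close>.\<close>

lemma det_diag_mat_add_outer_prod:
  fixes w :: "real^'n::finite"
  assumes pos: "\<And>i. E i > 0"
  shows "det (diag_mat E + outer_prod w) = (\<Prod>i\<in>UNIV. E i) * (1 + (\<Sum>i\<in>UNIV. (w $ i)\<^sup>2 / E i))"
proof -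
  define z where "z = (\<chi> i. w $ i / sqrt (E i))"
  let ?s = "\<lambda>i. sqrt (E i)"
  have dgl: "(diag_mat l ** A) $ i $ j = l i * A $ i $ j" "(A ** diag_mat l) $ i $ j = A $ i $ j * l j" for l A i j
    by (auto simp: diag_mat_def matrix_matrix_mult_def if_distrib if_distribR cong: if_cong)
  have "diag_mat E + outer_prod w = diag_mat ?s ** (mat 1 + outer_prod z) ** diag_mat ?s"
    using pos less_imp_le[OF pos]
    by (auto simp: vec_eq_iff dgl) (auto simp: diag_mat_def outer_prod_def mat_def z_def order_less_imp_not_eq2 algebra_simps)
  moreover have "det (mat 1 + outer_prod z) = 1 + z \<bullet> z"
  proof -
    obtain i :: 'n where "\<forall>c g. det (c *\<^sub>R mat 1 + g *\<^sub>R outer_prod z) = (\<Prod>j\<in>UNIV. c + (if j = i then g * (z \<bullet> z) else 0))"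
      using det_scale_add_outer_prod[of z] ..
    then have "det (mat 1 + outer_prod z) = (\<Prod>j\<in>UNIV. 1 + (if j = i then z \<bullet> z else 0))"
      by (elim allE[of _ 1]) (simp only: scaleR_one mult_1)
    also have "\<dots> = (\<Prod>j\<in>UNIV. if j = i then 1 + z \<bullet> z else 1)" by (intro prod.cong) auto
    also have "\<dots> = 1 + z \<bullet> z" by (subst prod.delta) auto
    finally show ?thesis .
  qed
  moreover have "z \<bullet> z = (\<Sum>i\<in>UNIV. (w $ i)\<^sup>2 / E i)"
    using less_imp_le[OF pos] by (simp add: z_def inner_vec_def power2_eq_square)
  moreover have "(\<Prod>i\<in>UNIV. E i) = (\<Prod>i\<in>UNIV. ?s i) * (\<Prod>i\<in>UNIV. ?s i)"
    using less_imp_le[OF pos] by (simp add: prod.distrib[symmetric])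
  ultimately show ?thesis by (simp add: det_mul det_diag_mat)
qed

lemma quadratic_form_diag_conj:
  fixes Q :: "real^'n::finite^'n"
  assumes "orthogonal_matrix Q" "N = transpose Q ** diag_mat lam ** Q"
  shows "(transpose Q *v axis i 1) \<bullet> (N *v (transpose Q *v axis i 1)) = lam i"
    and "norm (transpose Q *v axis i 1) = 1"
proof -
  have QQ: "Q ** transpose Q = mat 1" using assms(1) orthogonal_matrix_def by blast
  have "N *v (transpose Q *v axis i 1) = (transpose Q ** diag_mat lam ** (Q ** transpose Q)) *v axis i 1"
    by (simp only: assms(2) matrix_vector_mul_assoc matrix_mul_assoc)
  also have "\<dots> = transpose Q *v (diag_mat lam *v axis i 1)"
    by (simp add: QQ matrix_vector_mul_assoc)
  also have "diag_mat lam *v axis i 1 = lam i *\<^sub>R axis i 1"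
  proof -
    have "(diag_mat lam *v axis i 1) $ j = (\<Sum>k\<in>UNIV. (if j = k then lam j else 0) * axis i 1 $ k)" for j
      by (simp add: matrix_vector_mult_def diag_mat_def)
    also have "(\<Sum>k\<in>UNIV. (if j = k then lam j else 0) * axis i 1 $ k)
        = (\<Sum>k\<in>UNIV. if j = k then lam j * axis i 1 $ k else 0)" for j
      by (rule sum.cong) auto
    finally have "(diag_mat lam *v axis i 1) $ j = (\<Sum>k\<in>UNIV. if j = k then lam j * axis i 1 $ k else 0)" for j .
    then show ?thesis by (simp add: vec_eq_iff axis_def)
  qed
  finally have eig: "N *v (transpose Q *v axis i 1) = lam i *\<^sub>R (transpose Q *v axis i 1)"
    by (simp add: matrix_vector_mult_scaleR)
  have "(transpose Q *v axis i 1) \<bullet> (transpose Q *v axis i 1) = axis i 1 \<bullet> ((Q ** transpose Q) *v axis i 1)"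
    by (metis dot_lmul_matrix matrix_vector_mul_assoc transpose_matrix_vector)
  then have one: "(transpose Q *v axis i 1) \<bullet> (transpose Q *v axis i 1) = 1"
    by (simp add: QQ inner_axis_axis)
  then show "norm (transpose Q *v axis i 1) = 1" by (simp add: norm_eq_1)
  show "(transpose Q *v axis i 1) \<bullet> (N *v (transpose Q *v axis i 1)) = lam i"
    unfolding eig using one by simp
qed

text \<open>The polynomial of \<open>N + outer_prod v\<close> is that of \<open>N\<close> plus
  \<open>R\<close>, and every coefficient of \<open>R\<close> is nonnegative because the eigenvalues
  of \<open>N\<close> are.\<close>

lemma sigma_k_add_outer_prod_mono:
  fixes N :: "real^'n::finite^'n"
  assumes k: "k \<le> CARD('n)" and sym: "transpose N = N" and psd: "\<And>x. 0 \<le> x \<bullet> (N *v x)"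
  shows "sigma_k k (eigvals N) \<le> sigma_k k (eigvals (N + outer_prod v))"
proof -
  obtain Q lam where Q: "orthogonal_matrix Q" "N = transpose Q ** diag_mat lam ** Q"
    using symmetric_diagonalizable[OF sym] .
  have lam: "lam i \<ge> 0" for i using quadratic_form_diag_conj(1)[OF Q] psd by metis
  have "transpose (N + outer_prod v) = N + outer_prod v"
    using sym by (auto simp: vec_eq_iff transpose_def outer_prod_def)
  then obtain P mu where P: "orthogonal_matrix P" "N + outer_prod v = transpose P ** diag_mat mu ** P"
    by (rule symmetric_diagonalizable)
  define w where "w = Q *v v"
  have "v = transpose Q *v w"
    using Q(1) unfolding w_def orthogonal_matrix_def by (simp add: matrix_vector_mul_assoc)
  then have ov: "outer_prod v = transpose Q ** outer_prod w ** Q" by (simp add: outer_prod_conj)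
  \<comment> \<open>What the determinant formula leaves besides \<open>cpoly lam\<close>: each
    quotient by \<open>x + lam i\<close> cancels one factor of the product.\<close>
  define R where "R = (\<Sum>i\<in>UNIV. smult ((w $ i)\<^sup>2) (\<Prod>j\<in>UNIV - {i}. [:lam j, 1:]))"
  have "poly (cpoly mu) x = poly (cpoly lam + R) x" if "x > 0" for x
  proof -
    have E: "x + lam i > 0" for i using that lam[of i] by simp
    have "poly (cpoly mu) x = det (x *\<^sub>R mat 1 + (N + outer_prod v))"
      by (simp add: poly_cpoly det_diag_conj[OF P])
    also have "N + outer_prod v = transpose Q ** (diag_mat lam + outer_prod w) ** Q"
      by (simp add: Q(2) ov matrix_add_ldistrib matrix_add_rdistrib)
    also have "det (x *\<^sub>R mat 1 + \<dots>) = det (diag_mat (\<lambda>i. x + lam i) + outer_prod w)"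
      by (simp add: orthogonal_conj_add[OF Q(1)] det_orthogonal_conj[OF Q(1)] scaleR_mat_add_diag_mat[symmetric] add.assoc)
    also have "\<dots> = (\<Prod>i\<in>UNIV. x + lam i) * (1 + (\<Sum>i\<in>UNIV. (w $ i)\<^sup>2 / (x + lam i)))"
      by (rule det_diag_mat_add_outer_prod[OF E])
    also have "\<dots> = (\<Prod>i\<in>UNIV. x + lam i) + (\<Sum>i\<in>UNIV. (w $ i)\<^sup>2 * (\<Prod>j\<in>UNIV - {i}. x + lam j))"
    proof -
      have "(\<Prod>i\<in>UNIV. x + lam i) = (x + lam i) * (\<Prod>j\<in>UNIV - {i}. x + lam j)" for i
        by (simp add: prod.remove)
      then have "(\<Prod>i\<in>UNIV. x + lam i) * ((w $ i)\<^sup>2 / (x + lam i)) = (w $ i)\<^sup>2 * (\<Prod>j\<in>UNIV - {i}. x + lam j)" for i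
      proof -
        have aux: "e * r * (y / e) = y * r" if "e > 0" for e r y :: real using that by simp
        show ?thesis by (subst \<open>\<And>i. (\<Prod>i\<in>UNIV. x + lam i) = (x + lam i) * (\<Prod>j\<in>UNIV - {i}. x + lam j)\<close>[of i]) (rule aux[OF E])
      qed
      then show ?thesis by (simp add: distrib_left sum_distrib_left)
    qed
    also have "\<dots> = poly (cpoly lam + R) x"
      by (simp add: poly_cpoly R_def poly_sum poly_prod add.commute)
    finally show ?thesis .
  qed
  \<comment> \<open>The determinant formula divides by \<open>x + lam i\<close>, where
    \<open>lam i\<close> may be 0, so the identity is available only for positive \<open>x\<close>;
    infinitely many points suffice for equality of polynomials.\<close>
  then have "{0<..} \<subseteq> {x. poly (cpoly mu - (cpoly lam + R)) x = 0}" by auto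
  moreover have "infinite {0::real<..}" by (rule infinite_Ioi)
  ultimately have "cpoly mu = cpoly lam + R"
    using poly_roots_finite[of "cpoly mu - (cpoly lam + R)"] finite_subset by auto
  moreover have nn: "coeff (\<Prod>j\<in>A. [:lam j, 1:]) m \<ge> 0" for A m
  proof (induction A arbitrary: m rule: infinite_finite_induct)
    case (insert a A)
    then show ?case using lam by (auto simp: coeff_pCons split: nat.split)
  qed (auto simp: coeff_1)
  moreover have "coeff R m \<ge> 0" for m
    unfolding R_def coeff_sum by (intro sum_nonneg) (simp add: nn)
  ultimately have "sigma_k k lam \<le> sigma_k k mu"
    by (simp add: coeff_cpoly[OF k, symmetric])
  then show ?thesis
    using sigma_k_eigvals[OF k det_diag_conj[OF Q]] sigma_k_eigvals[OF k det_diag_conj[OF P]] by simp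
qed

text \<open>\<open>M - N\<close> is positive semidefinite, so by the spectral theorem it is a sum of
  rank-one squares. They are added one at a time, every partial sum staying symmetric and positive
  semidefinite.\<close>

lemma sigma_k_mono:
  fixes N M :: "real^'n::finite^'n"
  assumes k: "k \<le> CARD('n)" and N: "transpose N = N" and M: "transpose M = M"
    and psd: "\<And>x. 0 \<le> x \<bullet> (N *v x)" and le: "\<And>x. x \<bullet> (N *v x) \<le> x \<bullet> (M *v x)"
  shows "sigma_k k (eigvals N) \<le> sigma_k k (eigvals M)"
proof -
  have "transpose (M - N) = M - N" using M N by (simp add: transpose_def vec_eq_iff)
  then obtain Q mu where Q: "orthogonal_matrix Q" "M - N = transpose Q ** diag_mat mu ** Q"
    by (rule symmetric_diagonalizable)
  have mu: "mu i \<ge> 0" for i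
    using quadratic_form_diag_conj(1)[OF Q, of i] le[of "transpose Q *v axis i 1"]
    by (simp add: matrix_vector_mult_diff_rdistrib inner_diff_right)
  define v where "v i = sqrt (mu i) *\<^sub>R row i Q" for i
  have "M - N = (\<Sum>i\<in>UNIV. outer_prod (v i))"
  proof -
    have *: "outer_prod (v i) $ a $ b = mu i * (Q $ i $ a * Q $ i $ b)" for i a b
    proof -
      have "outer_prod (v i) $ a $ b = (sqrt (mu i) * sqrt (mu i)) * (Q $ i $ a * Q $ i $ b)"
        by (simp add: outer_prod_def v_def row_def mult_ac)
      then show ?thesis using mu[of i] by simp
    qed
    have "(transpose Q ** diag_mat mu ** Q) $ a $ b = (\<Sum>i\<in>UNIV. outer_prod (v i)) $ a $ b" for a b
    proof -
      have "(transpose Q ** diag_mat mu ** Q) $ a $ b = (\<Sum>k\<in>UNIV. (\<Sum>l\<in>UNIV. if l = k then Q $ l $ a * mu l else 0) * Q $ k $ b)"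
        by (simp add: matrix_matrix_mult_def diag_mat_def transpose_def if_distrib cong: if_cong)
      then show ?thesis by (simp add: sum_component * mult_ac)
    qed
    then show ?thesis by (simp add: Q(2) vec_eq_iff)
  qed
  moreover have "transpose (N + (\<Sum>i\<in>S. outer_prod (v i))) = N + (\<Sum>i\<in>S. outer_prod (v i)) \<and>
     (\<forall>x. 0 \<le> x \<bullet> ((N + (\<Sum>i\<in>S. outer_prod (v i))) *v x)) \<and>
     sigma_k k (eigvals N) \<le> sigma_k k (eigvals (N + (\<Sum>i\<in>S. outer_prod (v i))))" for S
  proof (induction S rule: infinite_finite_induct)
    case (insert a S)
    let ?A = "N + (\<Sum>i\<in>S. outer_prod (v i))"
    have eq: "N + (\<Sum>i\<in>insert a S. outer_prod (v i)) = ?A + outer_prod (v a)"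
      using insert by (simp add: algebra_simps)
    have "transpose (?A + outer_prod (v a)) = ?A + outer_prod (v a)"
      using insert.IH by (auto simp: vec_eq_iff transpose_def outer_prod_def)
    moreover have "0 \<le> x \<bullet> ((?A + outer_prod (v a)) *v x)" for x
    proof -
      have "0 \<le> x \<bullet> (?A *v x)" using insert.IH by blast
      moreover have "0 \<le> x \<bullet> (outer_prod (v a) *v x)" by (simp add: outer_prod_mult inner_commute)
      ultimately show ?thesis by (simp add: matrix_vector_mult_add_rdistrib[of _ _ x] inner_add_right)
    qed
    moreover have "sigma_k k (eigvals ?A) \<le> sigma_k k (eigvals (?A + outer_prod (v a)))"
      using insert.IH by (intro sigma_k_add_outer_prod_mono k) auto
    ultimately show ?case unfolding eq using insert.IH by auto
  qed (use N psd in auto)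
  ultimately have "sigma_k k (eigvals N) \<le> sigma_k k (eigvals (N + (M - N)))" by metis
  then show ?thesis by simp
qed

text \<open>The eigenvalues move from \<open>lam i\<close> to \<open>lam i + t\<close>, and each
  product of \<open>k \<ge> 1\<close> positive factors grows strictly. This strictness is what
  contradicts equality of the two operators in the comparison principle.\<close>

lemma sigma_k_shift_less:
  fixes M :: "real^'n::finite^'n"
  assumes k: "1 \<le> k" "k \<le> CARD('n)" and M: "transpose M = M" and pd: "pos_def M" and t: "t > 0"
  shows "sigma_k k (eigvals M) < sigma_k k (eigvals (M + t *\<^sub>R mat 1))"
proof -
  obtain Q lam where Q: "orthogonal_matrix Q" "M = transpose Q ** diag_mat lam ** Q"
    using symmetric_diagonalizable[OF M] .
  have lam: "lam i > 0" for i
  proof -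
    have "transpose Q *v axis i 1 \<noteq> 0" using quadratic_form_diag_conj(2)[OF Q, of i] by auto
    then show ?thesis using quadratic_form_diag_conj(1)[OF Q, of i] pd unfolding pos_def_def by metis
  qed
  have "det (x *\<^sub>R mat 1 + (M + t *\<^sub>R mat 1)) = (\<Prod>i\<in>UNIV. x + (lam i + t))" for x
  proof -
    have "x *\<^sub>R mat 1 + (M + t *\<^sub>R mat 1) = (x + t) *\<^sub>R mat 1 + M" by (simp add: algebra_simps)
    then show ?thesis by (simp only: det_diag_conj[OF Q]) (simp add: algebra_simps)
  qed
  note 1 = sigma_k_eigvals[OF k(2) this]
  have "sigma_k k lam < sigma_k k (\<lambda>i. lam i + t)"
    unfolding sigma_k_def
  proof (rule sum_strict_mono)
    obtain S :: "'n set" where "card S = k" using k(2) obtain_subset_with_card_n by blast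
    then show "{S::'n set. card S = k} \<noteq> {}" by auto
    fix S :: "'n set" assume "S \<in> {S. card S = k}"
    then have "S \<noteq> {}" using k(1) by auto
    then obtain a where "a \<in> S" by auto
    then show "prod lam S < (\<Prod>i\<in>S. lam i + t)"
    proof (rule prod_mono_strict)
      show "0 \<le> lam i \<and> lam i \<le> lam i + t" "0 < lam i + t" for i
        using lam[of i] t by auto
    qed (use t in auto)
  qed simp
  then show ?thesis using 1 sigma_k_eigvals[OF k(2) det_diag_conj[OF Q]] by simp
qed

text \<open>Hessians of radial functions have this form: one eigenvalue in the direction of
  \<open>v\<close> and \<open>c\<close> with multiplicity \<open>CARD('n) - 1\<close>. The index
  sets are split according to whether they contain the exceptional index \<open>i\<close>.\<close>

lemma sigma_k_scale_add_outer_prod: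
  fixes v :: "real^'n::finite"
  assumes k: "1 \<le> k" "k \<le> CARD('n)"
  shows "sigma_k k (eigvals (c *\<^sub>R mat 1 + g *\<^sub>R outer_prod v))
     = real ((CARD('n) - 1) choose k) * c ^ k + real ((CARD('n) - 1) choose (k - 1)) * (c + g * (v \<bullet> v)) * c ^ (k - 1)"
proof -
  \<comment> \<open>One index \<open>i\<close> serves all \<open>c\<close> at once; this is needed
    because the characteristic polynomial evaluates the formula at every
    \<open>x + c\<close>.\<close>
  obtain i :: 'n where "\<forall>c g. det (c *\<^sub>R mat 1 + g *\<^sub>R outer_prod v) = (\<Prod>j\<in>UNIV. c + (if j = i then g * (v \<bullet> v) else 0))"
    using det_scale_add_outer_prod[of v] ..
  note i = this[rule_format]
  define lam where "lam j = c + (if j = i then g * (v \<bullet> v) else 0)" for j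
  have "det (x *\<^sub>R mat 1 + (c *\<^sub>R mat 1 + g *\<^sub>R outer_prod v)) = (\<Prod>j\<in>UNIV. x + lam j)" for x
  proof -
    have "x *\<^sub>R mat 1 + (c *\<^sub>R mat 1 + g *\<^sub>R outer_prod v) = (x + c) *\<^sub>R mat 1 + g *\<^sub>R outer_prod v"
      by (simp add: algebra_simps)
    then show ?thesis by (simp only: i lam_def) (simp add: algebra_simps)
  qed
  then have "sigma_k k (eigvals (c *\<^sub>R mat 1 + g *\<^sub>R outer_prod v)) = sigma_k k lam"
    by (rule sigma_k_eigvals[OF k(2)])
  also have "\<dots> = (\<Sum>S\<in>{S. card S = k \<and> i \<notin> S} \<union> {S. card S = k \<and> i \<in> S}. prod lam S)"
    unfolding sigma_k_def by (rule sum.cong) auto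
  also have "\<dots> = (\<Sum>S\<in>{S. card S = k \<and> i \<notin> S}. prod lam S) + (\<Sum>S\<in>{S. card S = k \<and> i \<in> S}. prod lam S)"
    by (rule sum.union_disjoint) auto
  also have "(\<Sum>S\<in>{S. card S = k \<and> i \<notin> S}. prod lam S) = (\<Sum>S\<in>{S. card S = k \<and> i \<notin> S}. c ^ k)"
  proof (rule sum.cong)
    fix S assume S: "S \<in> {S. card S = k \<and> i \<notin> S}"
    then have "prod lam S = (\<Prod>j\<in>S. c)" unfolding lam_def by (intro prod.cong) auto
    then show "prod lam S = c ^ k" using S by simp
  qed simp
  also have "(\<Sum>S\<in>{S. card S = k \<and> i \<in> S}. prod lam S) = (\<Sum>S\<in>{S. card S = k \<and> i \<in> S}. (c + g * (v \<bullet> v)) * c ^ (k - 1))"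
  proof (rule sum.cong)
    fix S assume S: "S \<in> {S. card S = k \<and> i \<in> S}"
    then have "prod lam S = lam i * prod lam (S - {i})" by (intro prod.remove) auto
    also have "prod lam (S - {i}) = (\<Prod>j\<in>S - {i}. c)" unfolding lam_def by (intro prod.cong) auto
    finally show "prod lam S = (c + g * (v \<bullet> v)) * c ^ (k - 1)" using S by (simp add: lam_def card_Diff_singleton)
  qed simp
  also have "card {S::'n set. card S = k \<and> i \<notin> S} = (CARD('n) - 1) choose k"
  proof -
    have "{S::'n set. card S = k \<and> i \<notin> S} = {B. B \<subseteq> UNIV - {i} \<and> card B = k}" by auto
    then show ?thesis by (simp add: n_subsets)
  qed
  moreover have "card {S::'n set. card S = k \<and> i \<in> S} = (CARD('n) - 1) choose (k - 1)"
  proof -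
    have "bij_betw (insert i) {B. B \<subseteq> UNIV - {i} \<and> card B = k - 1} {S. card S = k \<and> i \<in> S}"
    proof (rule bij_betwI[where g = "\<lambda>S. S - {i}"])
      show "insert i \<in> {B. B \<subseteq> UNIV - {i} \<and> card B = k - 1} \<rightarrow> {S. card S = k \<and> i \<in> S}"
        using k(1) by (auto simp: subset_Diff_insert card_insert_if)
    qed (auto simp: card_Diff_singleton)
    then have "card {S. card S = k \<and> i \<in> S} = card {B. B \<subseteq> UNIV - {i} \<and> card B = k - 1}"
      by (simp add: bij_betw_same_card)
    then show ?thesis by (simp add: n_subsets)
  qed
  ultimately show ?thesis by simp
qed

subsection \<open>Calculus with iterated partial derivatives\<close>

lemma differentiable_has_derivative_grad:
  fixes f :: "real^'n::finite \<Rightarrow> real"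
  assumes "f differentiable (at x)"
  shows "(f has_derivative (\<lambda>h. grad f x \<bullet> h)) (at x)"
proof -
  have D: "(f has_derivative frechet_derivative f (at x)) (at x)"
    using assms frechet_derivative_works by blast
  then interpret bounded_linear "frechet_derivative f (at x)" by (rule has_derivative_bounded_linear)
  have "frechet_derivative f (at x) h = grad f x \<bullet> h" for h
  proof -
    have "frechet_derivative f (at x) h = frechet_derivative f (at x) (\<Sum>i\<in>UNIV. h $ i *\<^sub>R axis i 1)"
      by (subst basis_expansion[symmetric]) (simp add: scalar_mult_eq_scaleR)
    also have "\<dots> = grad f x \<bullet> h"
      by (simp add: sum scaleR grad_def pd_def inner_vec_def mult.commute)
    finally show ?thesis .
  qed
  then have "frechet_derivative f (at x) = (\<lambda>h. grad f x \<bullet> h)" by auto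
  with D show ?thesis by simp
qed

lemma has_derivative_imp_grad:
  fixes f :: "real^'n::finite \<Rightarrow> real"
  assumes "(f has_derivative (\<lambda>h. g \<bullet> h)) (at x)"
  shows "grad f x = g"
proof -
  have "frechet_derivative f (at x) = (\<lambda>h. g \<bullet> h)"
    using frechet_derivative_at[OF assms] by simp
  then show ?thesis by (simp add: vec_eq_iff grad_def pd_def inner_axis)
qed

lemma pdl_append: "pdl (is @ js) f = pdl is (pdl js f)"
  by (induction "is") auto

lemma smooth_on_open: "smooth_on U f \<Longrightarrow> open U"
  by (simp add: smooth_on_def)

lemma smooth_on_pd: "smooth_on U f \<Longrightarrow> smooth_on U (pd i f)"
  unfolding smooth_on_def by (metis pdl_append pdl.simps)

lemma smooth_on_differentiable: "smooth_on U f \<Longrightarrow> x \<in> U \<Longrightarrow> f differentiable (at x)"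
  unfolding smooth_on_def by (metis at_within_open differentiable_on_def pdl.simps(1))

lemma smooth_on_has_derivative:
  "smooth_on U f \<Longrightarrow> x \<in> U \<Longrightarrow> (f has_derivative (\<lambda>h. grad f x \<bullet> h)) (at x)"
  by (intro differentiable_has_derivative_grad smooth_on_differentiable)

lemma smooth_on_subset: "smooth_on U f \<Longrightarrow> open V \<Longrightarrow> V \<subseteq> U \<Longrightarrow> smooth_on V f"
  unfolding smooth_on_def by (meson differentiable_on_subset)

lemma smooth_on_continuous: "smooth_on U f \<Longrightarrow> continuous_on U f"
  unfolding smooth_on_def by (metis differentiable_imp_continuous_on pdl.simps(1))

lemma smooth_on_grad_continuous: "smooth_on U f \<Longrightarrow> continuous_on U (grad f)"
  unfolding grad_def by (intro continuous_on_vec_lambda smooth_on_continuous smooth_on_pd)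

lemma has_derivative_along_line:
  fixes f :: "real^'n::finite \<Rightarrow> real"
  assumes "smooth_on U f" "x + t *\<^sub>R h \<in> U"
  shows "((\<lambda>t. f (x + t *\<^sub>R h)) has_real_derivative grad f (x + t *\<^sub>R h) \<bullet> h) (at t)"
proof -
  have "((\<lambda>t. x + t *\<^sub>R h) has_derivative (\<lambda>s. s *\<^sub>R h)) (at t)"
    by (auto intro!: derivative_eq_intros)
  from diff_chain_at[OF this smooth_on_has_derivative[OF assms]]
  show ?thesis by (simp add: o_def has_field_derivative_def mult_commute_abs)
qed

lemma isCont_distD:
  fixes f :: "'a::metric_space \<Rightarrow> 'b::metric_space"
  assumes "isCont f x" "e > 0"
  shows "\<exists>d>0. \<forall>y. dist x y < d \<longrightarrow> dist (f y) (f x) < e"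
proof -
  have "eventually (\<lambda>y. dist (f y) (f x) < e) (at x)"
    using assms by (simp add: isCont_def tendsto_iff)
  then obtain d where d: "d > 0" "\<And>y. y \<noteq> x \<Longrightarrow> dist y x < d \<Longrightarrow> dist (f y) (f x) < e"
    by (auto simp: eventually_at)
  have "dist (f y) (f x) < e" if "dist x y < d" for y
    using that d(2)[of y] assms(2) by (cases "y = x") (auto simp: dist_commute)
  with d(1) show ?thesis by blast
qed

text \<open>The mean value theorem in direction \<open>i\<close> and then in direction
  \<open>j\<close> produces the mixed derivative. The left-hand side is symmetric in
  \<open>i\<close> and \<open>j\<close>, so the exchanged statement concerns the same
  number.\<close>

lemma second_difference_mean_value:
  fixes f :: "real^'n::finite \<Rightarrow> real"
  assumes f: "smooth_on U f" and r: "ball x r \<subseteq> U" and s: "0 < s" "2 * s < r"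
  shows "\<exists>y\<in>ball x r. f (x + s *\<^sub>R axis i 1 + s *\<^sub>R axis j 1) - f (x + s *\<^sub>R axis i 1) - f (x + s *\<^sub>R axis j 1) + f x
     = s\<^sup>2 * pd j (pd i f) y"
proof -
  let ?a = "axis i 1 :: real^'n" and ?b = "axis j 1 :: real^'n"
  have inb: "x + t *\<^sub>R ?a + t' *\<^sub>R ?b \<in> ball x r" if "0 \<le> t" "t \<le> s" "0 \<le> t'" "t' \<le> s" for t t'
  proof -
    have "norm (t *\<^sub>R ?a + t' *\<^sub>R ?b) \<le> norm (t *\<^sub>R ?a) + norm (t' *\<^sub>R ?b)" by (rule norm_triangle_ineq)
    also have "\<dots> < r" using that s by simp
    finally have "norm (t *\<^sub>R ?a + t' *\<^sub>R ?b) < r" .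
    moreover have "x + z \<in> ball x r" if "norm z < r" for z using that by (simp add: dist_norm)
    ultimately have "x + (t *\<^sub>R ?a + t' *\<^sub>R ?b) \<in> ball x r" by blast
    then show ?thesis by (simp add: add.assoc)
  qed
  have ga: "grad h y \<bullet> axis l 1 = pd l h y" for h :: "real^'n \<Rightarrow> real" and y l
    by (simp add: grad_def inner_axis)
  define g where "g t = f (x + s *\<^sub>R ?b + t *\<^sub>R ?a) - f (x + t *\<^sub>R ?a)" for t
  have "\<exists>z. z > 0 \<and> z < s \<and> g s - g 0 = (s - 0) * (pd i f (x + s *\<^sub>R ?b + z *\<^sub>R ?a) - pd i f (x + z *\<^sub>R ?a))"
  proof (rule MVT2)
    fix t assume t: "0 \<le> t" "t \<le> s"
    have "x + s *\<^sub>R ?b + t *\<^sub>R ?a \<in> U" "x + t *\<^sub>R ?a \<in> U"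
      using inb[of t s] inb[of t 0] t s r by (auto simp: algebra_simps)
    from has_derivative_along_line[OF f this(1)] has_derivative_along_line[OF f this(2)]
    show "(g has_real_derivative (pd i f (x + s *\<^sub>R ?b + t *\<^sub>R ?a) - pd i f (x + t *\<^sub>R ?a))) (at t)"
      unfolding g_def ga by (rule DERIV_diff)
  qed (use s in auto)
  then obtain z where z: "0 < z" "z < s" and gz: "g s - g 0 = s * (pd i f (x + s *\<^sub>R ?b + z *\<^sub>R ?a) - pd i f (x + z *\<^sub>R ?a))"
    by auto
  have "\<exists>w. w > 0 \<and> w < s \<and> pd i f (x + z *\<^sub>R ?a + s *\<^sub>R ?b) - pd i f (x + z *\<^sub>R ?a + 0 *\<^sub>R ?b) = (s - 0) * pd j (pd i f) (x + z *\<^sub>R ?a + w *\<^sub>R ?b)"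
  proof (rule MVT2)
    fix t assume t: "0 \<le> t" "t \<le> s"
    have "x + z *\<^sub>R ?a + t *\<^sub>R ?b \<in> U" using inb[of z t] t z r by auto
    from has_derivative_along_line[OF smooth_on_pd[OF f] this]
    show "((\<lambda>t. pd i f (x + z *\<^sub>R ?a + t *\<^sub>R ?b)) has_real_derivative pd j (pd i f) (x + z *\<^sub>R ?a + t *\<^sub>R ?b)) (at t)"
      unfolding ga .
  qed (use s in auto)
  then obtain w where w: "0 < w" "w < s" and gw: "pd i f (x + z *\<^sub>R ?a + s *\<^sub>R ?b) - pd i f (x + z *\<^sub>R ?a) = s * pd j (pd i f) (x + z *\<^sub>R ?a + w *\<^sub>R ?b)"
    by auto
  have "g s - g 0 = s * (s * pd j (pd i f) (x + z *\<^sub>R ?a + w *\<^sub>R ?b))"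
    using gz gw by (metis (no_types, lifting) add.commute add.left_commute add.assoc)
  moreover have "x + z *\<^sub>R ?a + w *\<^sub>R ?b \<in> ball x r" using inb[of z w] z w by auto
  ultimately show ?thesis
    unfolding g_def by (intro bexI[of _ "x + z *\<^sub>R ?a + w *\<^sub>R ?b"]) (simp_all add: power2_eq_square algebra_simps)
qed

text \<open>Schwarz's theorem. If the two mixed derivatives differed at \<open>x\<close>, continuity
  would keep their values apart on a small ball, yet the common second difference forces a value of
  one to equal a value of the other there.\<close>

lemma hess_symmetric:
  fixes f :: "real^'n::finite \<Rightarrow> real"
  assumes f: "smooth_on U f" and x: "x \<in> U"
  shows "transpose (hess f x) = hess f x"
proof -
  have "pd i (pd j f) x = pd j (pd i f) x" for i j
  proof (rule ccontr)
    let ?P = "pd i (pd j f)" and ?Q = "pd j (pd i f)"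
    assume "?P x \<noteq> ?Q x"
    define e where "e = \<bar>?P x - ?Q x\<bar> / 2"
    have e: "e > 0" using \<open>?P x \<noteq> ?Q x\<close> by (simp add: e_def)
    have c: "isCont ?P x" "isCont ?Q x"
      using smooth_on_continuous[OF smooth_on_pd[OF smooth_on_pd[OF f]]] x smooth_on_open[OF f]
      by (simp_all add: continuous_on_eq_continuous_at)
    obtain d1 where d1: "d1 > 0" "\<And>y. dist x y < d1 \<Longrightarrow> dist (?P y) (?P x) < e"
      using isCont_distD[OF c(1) e] by auto
    obtain d2 where d2: "d2 > 0" "\<And>y. dist x y < d2 \<Longrightarrow> dist (?Q y) (?Q x) < e"
      using isCont_distD[OF c(2) e] by auto
    obtain d3 where d3: "d3 > 0" "ball x d3 \<subseteq> U"
      using smooth_on_open[OF f] x open_contains_ball by blast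
    define r where "r = min d1 (min d2 d3)"
    define s where "s = r / 3"
    have r: "r > 0" "ball x r \<subseteq> U" using d1 d2 d3 by (auto simp: r_def)
    have s: "0 < s" "2 * s < r" using r by (auto simp: s_def)
    obtain y where y: "y \<in> ball x r" "f (x + s *\<^sub>R axis i 1 + s *\<^sub>R axis j 1) - f (x + s *\<^sub>R axis i 1) - f (x + s *\<^sub>R axis j 1) + f x = s\<^sup>2 * ?Q y"
      using second_difference_mean_value[OF f r(2) s] by blast
    obtain z where z: "z \<in> ball x r" "f (x + s *\<^sub>R axis j 1 + s *\<^sub>R axis i 1) - f (x + s *\<^sub>R axis j 1) - f (x + s *\<^sub>R axis i 1) + f x = s\<^sup>2 * ?P z"
      using second_difference_mean_value[OF f r(2) s] by blast
    have "s\<^sup>2 * ?Q y = s\<^sup>2 * ?P z" using y(2) z(2) by (simp add: algebra_simps)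
    then have "?Q y = ?P z" using s by simp
    moreover have "dist (?Q y) (?Q x) < e" "dist (?P z) (?P x) < e"
      using y(1) z(1) d1 d2 by (auto simp: r_def)
    ultimately show False unfolding e_def dist_real_def by (auto simp: abs_if field_simps split: if_splits)
  qed
  then show ?thesis by (simp add: transpose_def hess_def vec_eq_iff)
qed

lemma grad_has_derivative:
  fixes f :: "real^'n::finite \<Rightarrow> real"
  assumes f: "smooth_on U f" and x: "x \<in> U"
  shows "(grad f has_derivative (\<lambda>h. hess f x *v h)) (at x)"
proof -
  have "((\<lambda>y. grad f y $ j) has_derivative (\<lambda>h. (hess f x *v h) $ j)) (at x)" for j
  proof -
    have "(pd j f has_derivative (\<lambda>h. grad (pd j f) x \<bullet> h)) (at x)"
      using smooth_on_has_derivative[OF smooth_on_pd[OF f] x] .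
    moreover have "grad (pd j f) x \<bullet> h = (hess f x *v h) $ j" for h
    proof -
      \<comment> \<open>In \<open>hess\<close> the inner derivative carries the column index, so
        differentiating the gradient yields the transpose; symmetry turns it back.\<close>
      have "grad (pd j f) x \<bullet> h = (transpose (hess f x) *v h) $ j"
        by (simp add: grad_def inner_vec_def matrix_vector_mult_def transpose_def hess_def)
      then show ?thesis by (simp add: hess_symmetric[OF f x])
    qed
    ultimately show ?thesis by (simp add: grad_def)
  qed
  then show ?thesis
    by (subst has_derivative_componentwise_within) (auto simp: Basis_vec_def inner_axis)
qed

lemma grad_has_derivative_along_line:
  fixes f :: "real^'n::finite \<Rightarrow> real"
  assumes "smooth_on U f" "x + t *\<^sub>R h \<in> U"
  shows "((\<lambda>t. grad f (x + t *\<^sub>R h) \<bullet> h) has_real_derivative h \<bullet> (hess f (x + t *\<^sub>R h) *v h)) (at t)"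
proof -
  have "((\<lambda>t. x + t *\<^sub>R h) has_derivative (\<lambda>s. s *\<^sub>R h)) (at t)"
    by (auto intro!: derivative_eq_intros)
  from has_derivative_inner_left[OF diff_chain_at[OF this grad_has_derivative[OF assms]], of h]
  show ?thesis
    by (simp add: o_def has_field_derivative_def matrix_vector_mult_scaleR inner_commute mult_commute_abs)
qed

section \<open>First- and second-order conditions and the maximum principle\<close>

lemma second_derivative_local_min:
  fixes f :: "real \<Rightarrow> real"
  assumes d: "d > 0" and f: "\<And>s. \<bar>s - t\<bar> < d \<Longrightarrow> (f has_real_derivative f' s) (at s)"
    and f': "(f' has_real_derivative l) (at t)" and min: "\<And>s. \<bar>s - t\<bar> < d \<Longrightarrow> f t \<le> f s"
  shows "f' t = 0" "l \<ge> 0"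
proof -
  show 0: "f' t = 0"
    using DERIV_local_min[OF f[of t] d] min d by (simp add: abs_minus_commute)
  show "l \<ge> 0"
  proof (rule ccontr)
    assume "\<not> l \<ge> 0"
    then obtain e where e: "e > 0" "\<And>h. 0 < h \<Longrightarrow> h < e \<Longrightarrow> f' t > f' (t + h)"
      using DERIV_neg_dec_right[OF f'] by (metis not_le)
    define s where "s = min d e / 2"
    have s: "0 < s" "s < d" "s < e" using d e by (auto simp: s_def)
    have "f (t + s) < f t"
    proof (rule DERIV_neg_imp_decreasing_open[where f = f and a = t and b = "t + s"])
      fix y assume y: "t < y" "y < t + s"
      have "f' y < 0" using e(2)[of "y - t"] y s 0 by auto
      then show "\<exists>l. (f has_real_derivative l) (at y) \<and> l < 0" using f[of y] y s by auto
    next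
      show "continuous_on {t..t + s} f"
        using s by (intro continuous_at_imp_continuous_on ballI DERIV_isCont[OF f]) auto
    qed (use s in auto)
    then show False using min[of "t + s"] s by auto
  qed
qed

text \<open>\<open>G\<close> has nonnegative product with every vector of an open half space, which
  leaves only nonnegative multiples of its inner normal. The hypothesis speaks of each ray
  separately, without a common length, so it can be checked at boundary contact points.\<close>

lemma grad_halfspace:
  fixes f :: "real^'n::finite \<Rightarrow> real"
  assumes f: "(f has_derivative (\<lambda>h. G \<bullet> h)) (at x)" and nu: "nu \<noteq> 0"
    and ge: "\<And>e. e \<bullet> nu > 0 \<Longrightarrow> \<exists>d>0. \<forall>t. 0 < t \<and> t < d \<longrightarrow> f (x + t *\<^sub>R e) \<ge> f x"
  shows "\<exists>mu\<ge>0. G = mu *\<^sub>R nu"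
proof -
  have Ge: "G \<bullet> e \<ge> 0" if e: "e \<bullet> nu > 0" for e
  proof (rule ccontr)
    assume "\<not> G \<bullet> e \<ge> 0"
    have "((\<lambda>t. x + t *\<^sub>R e) has_derivative (\<lambda>s. s *\<^sub>R e)) (at 0)"
      by (auto intro!: derivative_eq_intros)
    from diff_chain_at[OF this, of f "\<lambda>h. G \<bullet> h"] f
    have "((\<lambda>t. f (x + t *\<^sub>R e)) has_real_derivative G \<bullet> e) (at 0)"
      by (simp add: o_def has_field_derivative_def mult_commute_abs)
    from DERIV_neg_dec_right[OF this] \<open>\<not> G \<bullet> e \<ge> 0\<close>
    obtain d1 where d1: "d1 > 0" "\<And>h. 0 < h \<Longrightarrow> h < d1 \<Longrightarrow> f x > f (x + h *\<^sub>R e)" by auto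
    obtain d2 where d2: "d2 > 0" "\<forall>t. 0 < t \<and> t < d2 \<longrightarrow> f (x + t *\<^sub>R e) \<ge> f x" using ge[OF e] by blast
    have "0 < min d1 d2 / 2" "min d1 d2 / 2 < d1" "min d1 d2 / 2 < d2" using d1 d2 by auto
    then show False using d1(2) d2(2) by (meson not_le)
  qed
  define mu where "mu = (G \<bullet> nu) / (nu \<bullet> nu)"
  define w where "w = G - mu *\<^sub>R nu"
  have nn: "nu \<bullet> nu > 0" using nu by simp
  have wn: "w \<bullet> nu = 0" using nn by (simp add: w_def mu_def inner_simps)
  have Gw: "G \<bullet> w = w \<bullet> w" using wn by (simp add: w_def inner_simps inner_commute)
  \<comment> \<open>The test vector is minus the part \<open>w\<close> of \<open>G\<close>
    orthogonal to \<open>nu\<close>, tilted slightly into the half space; letting \<open>e\<close>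
    shrink forces \<open>w = 0\<close>.\<close>
  have "w \<bullet> w \<le> e * (G \<bullet> nu)" if "e > 0" for e
    using Ge[of "e *\<^sub>R nu - w"] that nn wn Gw by (simp add: inner_simps)
  note small = this
  have "w = 0"
  proof (rule ccontr)
    assume "w \<noteq> 0"
    then have ww: "w \<bullet> w > 0" by simp
    have c: "\<bar>G \<bullet> nu\<bar> + 1 > 0" by simp
    let ?e = "(w \<bullet> w) / (2 * (\<bar>G \<bullet> nu\<bar> + 1))"
    have e: "?e > 0" using ww c by (intro divide_pos_pos) auto
    have "w \<bullet> w \<le> ?e * (G \<bullet> nu)" by (rule small[OF e])
    also have "\<dots> \<le> ?e * (\<bar>G \<bullet> nu\<bar> + 1)" using e by (intro mult_left_mono) auto
    also have "\<dots> = w \<bullet> w / 2" using c by (simp add: field_simps)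
    finally show False using ww by simp
  qed
  moreover have "mu \<ge> 0" using Ge[of nu] nn by (simp add: mu_def)
  ultimately show ?thesis by (auto simp: w_def)
qed

text \<open>Adding a small multiple of the squared norm keeps the maximum in the interior.\<close>
lemma perturbed_interior_max:
  fixes W :: "real^'n::finite \<Rightarrow> real"
  assumes O: "bounded S" "open S" and W: "continuous_on (closure S) W" and x0: "x0 \<in> S"
    and fr: "\<And>y. y \<in> frontier S \<Longrightarrow> W y < W x0"
  obtains e x where "e > 0" "x \<in> S" "\<And>y. y \<in> S \<Longrightarrow> W y + e * (y \<bullet> y) \<le> W x + e * (x \<bullet> x)"
proof -
  have cS: "compact (closure S)" and cF: "compact (frontier S)"
    using O by (auto simp: compact_frontier_bounded)
  obtain B where B: "\<And>y. y \<in> closure S \<Longrightarrow> y \<bullet> y \<le> B" "B \<ge> 0"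
  proof -
    obtain b where "\<And>y. y \<in> closure S \<Longrightarrow> norm y \<le> b" using cS by (meson bounded_iff compact_imp_bounded)
    then have "y \<bullet> y \<le> b\<^sup>2" if "y \<in> closure S" for y
      using that by (metis norm_ge_zero power2_norm_eq_inner power_mono)
    then show thesis using that[of "b\<^sup>2"] by auto
  qed
  obtain M where M: "M < W x0" "\<And>y. y \<in> frontier S \<Longrightarrow> W y \<le> M"
  proof (cases "frontier S = {}")
    case True
    then show thesis using that[of "W x0 - 1"] by auto
  next
    case False
    have "continuous_on (frontier S) W"
      using W by (rule continuous_on_subset) (auto simp: frontier_def)
    then obtain z where "z \<in> frontier S" "\<And>y. y \<in> frontier S \<Longrightarrow> W y \<le> W z"
      using continuous_attains_sup[OF cF False] by blast
    then show thesis using that[of "W z"] fr by auto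
  qed
  define e where "e = (W x0 - M) / (2 * (B + 1))"
  have e: "e > 0" using M B by (simp add: e_def)
  have eB: "e * B < W x0 - M"
  proof -
    have "e * (2 * (B + 1)) = W x0 - M" using B by (simp add: e_def)
    then have "2 * (e * B) + 2 * e = W x0 - M" by (simp add: algebra_simps)
    moreover have "e * B \<ge> 0" using e B(2) by simp
    ultimately show ?thesis using e by linarith
  qed
  have "continuous_on (closure S) (\<lambda>y. W y + e * (y \<bullet> y))"
    by (intro continuous_intros W)
  then obtain x where x: "x \<in> closure S" "\<And>y. y \<in> closure S \<Longrightarrow> W y + e * (y \<bullet> y) \<le> W x + e * (x \<bullet> x)"
    using continuous_attains_sup[OF cS, of "\<lambda>y. W y + e * (y \<bullet> y)"] x0 closure_subset by blast
  have "x \<in> S"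
  proof (rule ccontr)
    assume "x \<notin> S"
    then have "x \<in> frontier S" using x(1) O by (simp add: frontier_def interior_open)
    have "W x0 + e * (x0 \<bullet> x0) \<le> W x + e * (x \<bullet> x)" using x(2)[of x0] x0 closure_subset by blast
    also have "\<dots> \<le> M + e * B" using M(2)[OF \<open>x \<in> frontier S\<close>] B(1)[OF x(1)] e by (simp add: add_mono)
    also have "\<dots> < W x0" using eB by simp
    finally have "e * (x0 \<bullet> x0) < 0" by simp
    moreover have "e * (x0 \<bullet> x0) \<ge> 0" using e by simp
    ultimately show False by linarith
  qed
  with e x closure_subset show thesis by (intro that[of e x]) blast+
qed

lemma hess_le_of_local_max:
  fixes f g :: "real^'n::finite \<Rightarrow> real"
  assumes f: "smooth_on U f" and g: "smooth_on U g" and x: "x \<in> U"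
    and max: "\<And>y. y \<in> U \<Longrightarrow> f y - g y + e * (y \<bullet> y) \<le> f x - g x + e * (x \<bullet> x)"
  shows "h \<bullet> (hess f x *v h) + 2 * e * (h \<bullet> h) \<le> h \<bullet> (hess g x *v h)"
proof -
  obtain r where r: "r > 0" "ball x r \<subseteq> U" using smooth_on_open[OF f] x open_contains_ball by blast
  define d where "d = r / (norm h + 1)"
  have np: "norm h + 1 > 0" by (smt (verit) norm_ge_zero)
  have d: "d > 0" using r np by (simp add: d_def)
  have inU: "x + s *\<^sub>R h \<in> U" if "\<bar>s\<bar> < d" for s
  proof -
    have "norm (s *\<^sub>R h) \<le> \<bar>s\<bar> * (norm h + 1)" by (simp add: mult_left_mono)
    also have "\<dots> < r" using that np by (simp add: d_def field_simps)
    finally have "x + s *\<^sub>R h \<in> ball x r" by (simp add: dist_norm)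
    then show ?thesis using r by auto
  qed
  let ?W = "\<lambda>s. g (x + s *\<^sub>R h) - f (x + s *\<^sub>R h) - e * ((x + s *\<^sub>R h) \<bullet> (x + s *\<^sub>R h))"
  let ?W' = "\<lambda>s. grad g (x + s *\<^sub>R h) \<bullet> h - grad f (x + s *\<^sub>R h) \<bullet> h - e * (2 * ((x + s *\<^sub>R h) \<bullet> h))"
  have "h \<bullet> (hess g (x + 0 *\<^sub>R h) *v h) - h \<bullet> (hess f (x + 0 *\<^sub>R h) *v h) - e * (2 * (h \<bullet> h)) \<ge> 0"
  proof (rule second_derivative_local_min(2)[OF d, where t = 0])
    fix s assume s: "\<bar>s - 0\<bar> < d"
    have "((\<lambda>s. (x + s *\<^sub>R h) \<bullet> (x + s *\<^sub>R h)) has_real_derivative 2 * ((x + s *\<^sub>R h) \<bullet> h)) (at s)"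
      unfolding has_field_derivative_def
      by (auto intro!: derivative_eq_intros simp: fun_eq_iff inner_simps algebra_simps inner_commute)
    then show "(?W has_real_derivative ?W' s) (at s)"
      using s inU[of s] by (intro DERIV_diff DERIV_cmult has_derivative_along_line[OF f] has_derivative_along_line[OF g]) auto
    show "?W 0 \<le> ?W s" using max[of "x + s *\<^sub>R h"] inU[of s] s by simp
  next
    have "((\<lambda>s. (x + s *\<^sub>R h) \<bullet> h) has_real_derivative h \<bullet> h) (at 0)"
      unfolding has_field_derivative_def
      by (auto intro!: derivative_eq_intros simp: fun_eq_iff inner_simps algebra_simps inner_commute)
    then show "(?W' has_real_derivative h \<bullet> (hess g (x + 0 *\<^sub>R h) *v h) - h \<bullet> (hess f (x + 0 *\<^sub>R h) *v h) - e * (2 * (h \<bullet> h))) (at 0)"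
      using inU[of 0] d by (intro DERIV_diff DERIV_cmult grad_has_derivative_along_line[OF f] grad_has_derivative_along_line[OF g]) auto
  qed
  then show ?thesis by simp
qed

text \<open>At an interior maximum of \<open>f - g + e * |x|^2\<close> the Hessian of
  \<open>g\<close> dominates that of \<open>f\<close> plus \<open>2 * e\<close> times the identity.
  Positivity of \<open>hess f\<close> then makes \<open>sigma_k\<close> strictly larger for
  \<open>g\<close> than for \<open>f\<close>, against \<open>eq\<close>.\<close>

lemma comparison_no_interior_max:
  fixes f g :: "real^'n::finite \<Rightarrow> real"
  assumes k: "1 \<le> k" "k \<le> CARD('n)" and S: "bounded S" "open S"
    and f: "smooth_on S f" and g: "smooth_on S g" and cont: "continuous_on (closure S) (\<lambda>x. f x - g x)"
    and pos: "\<And>x. x \<in> S \<Longrightarrow> pos_def (hess f x)"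
    and eq: "\<And>x. x \<in> S \<Longrightarrow> sigma_k k (eigvals (hess f x)) = sigma_k k (eigvals (hess g x))"
    and x0: "x0 \<in> S" and fr: "\<And>y. y \<in> frontier S \<Longrightarrow> f y - g y < f x0 - g x0"
  shows False
proof -
  obtain e x where e: "e > 0" and x: "x \<in> S"
    and max: "\<And>y. y \<in> S \<Longrightarrow> f y - g y + e * (y \<bullet> y) \<le> f x - g x + e * (x \<bullet> x)"
    using perturbed_interior_max[OF S cont x0 fr] by blast
  let ?F = "hess f x" and ?G = "hess g x"
  have sym: "transpose ?F = ?F" "transpose ?G = ?G"
    using hess_symmetric[OF f x] hess_symmetric[OF g x] by auto
  have pd: "pos_def ?F" using pos[OF x] .
  then have psd: "h \<bullet> (?F *v h) \<ge> 0" for h unfolding pos_def_def by (cases "h = 0") (auto intro: less_imp_le)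
  have fe: "(?F + (2 * e) *\<^sub>R mat 1) *v h = ?F *v h + (2 * e) *\<^sub>R h" for h
    by (simp add: matrix_vector_mult_add_rdistrib scaleR_matrix_vector_assoc[symmetric])
  have "sigma_k k (eigvals ?F) < sigma_k k (eigvals (?F + (2 * e) *\<^sub>R mat 1))"
    using sigma_k_shift_less[OF k sym(1) pd] e by simp
  also have "\<dots> \<le> sigma_k k (eigvals ?G)"
  proof (rule sigma_k_mono[OF k(2)])
    show "transpose (?F + (2 * e) *\<^sub>R mat 1) = ?F + (2 * e) *\<^sub>R mat 1"
      using sym(1) by (simp add: transpose_def vec_eq_iff mat_def)
    show "0 \<le> h \<bullet> ((?F + (2 * e) *\<^sub>R mat 1) *v h)" for h
      unfolding fe using psd[of h] e by (simp add: inner_add_right)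
    show "h \<bullet> ((?F + (2 * e) *\<^sub>R mat 1) *v h) \<le> h \<bullet> (?G *v h)" for h
      unfolding fe using hess_le_of_local_max[OF f g x max, of h] by (simp add: inner_add_right)
  qed (rule sym(2))
  finally show False using eq[OF x] by simp
qed

subsection \<open>Geometry of strictly convex exterior solutions\<close>

text \<open>\<open>crossing\<close> carries the regularity of the boundary, so that no defining
  function enters the geometric arguments. \<open>pos\<close> holds up to the boundary, where the
  curvature of the contact sphere is read off.\<close>

locale exterior_solution =
  fixes Om :: "(real^'n::finite) set" and U :: "(real^'n) set" and u :: "real^'n \<Rightarrow> real"
    and nrm :: "real^'n \<Rightarrow> real^'n"
  assumes Om_ne: "Om \<noteq> {}" and Om_open: "open Om" and Om_bounded: "bounded Om"
    and U_sub: "- Om \<subseteq> U" and smooth: "smooth_on U u"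
    and pos: "x \<notin> Om \<Longrightarrow> pos_def (hess u x)"
    and u_zero: "x \<in> frontier Om \<Longrightarrow> u x = 0"
    and u_normal: "x \<in> frontier Om \<Longrightarrow> grad u x \<bullet> nrm x = 1"
    and crossing: "x \<in> frontier Om \<Longrightarrow> e \<bullet> nrm x > 0 \<Longrightarrow>
        \<exists>d>0. \<forall>t. 0 < t \<and> t < d \<longrightarrow> x + t *\<^sub>R e \<notin> Om \<and> x - t *\<^sub>R e \<in> Om"
begin

lemma frontier_not_in: "x \<in> frontier Om \<Longrightarrow> x \<notin> Om"
  using Om_open by (simp add: frontier_def interior_open)

lemma in_frontier_iff: "x \<in> frontier Om \<longleftrightarrow> x \<in> closure Om \<and> x \<notin> Om"
  using Om_open by (simp add: frontier_def interior_open)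

lemma near_outside: "ball y r \<subseteq> - closure Om \<Longrightarrow> dist y z < r \<Longrightarrow> z \<notin> Om \<and> z \<in> U"
  using closure_subset[of Om] U_sub by (metis ComplD ComplI mem_ball subsetD)

lemma normal_nonzero: "x \<in> frontier Om \<Longrightarrow> nrm x \<noteq> 0"
  using u_normal by fastforce

lemma hess_pos: "x \<notin> Om \<Longrightarrow> h \<noteq> 0 \<Longrightarrow> h \<bullet> (hess u x *v h) > 0"
  using pos by (simp add: pos_def_def)

text \<open>Near \<open>x\<close> the function increases in the direction of the normal. Going back
  from \<open>y\<close> along the normal one meets the frontier, where \<open>u\<close> vanishes.
  The way from there to \<open>y\<close> may cross \<open>Om\<close> again, but it stays in the
  neighbourhood of \<open>x\<close> on which \<open>u\<close> is smooth.\<close>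

lemma locally_nonneg_at_frontier:
  assumes x: "x \<in> frontier Om"
  shows "\<exists>r>0. \<forall>y. dist x y < r \<longrightarrow> y \<notin> Om \<longrightarrow> u y \<ge> 0"
proof -
  let ?n = "nrm x"
  have xU: "x \<in> U" using U_sub frontier_not_in[OF x] by auto
  have n: "?n \<noteq> 0" by (rule normal_nonzero[OF x])
  then have np: "norm ?n > 0" by simp
  obtain r1 where r1: "r1 > 0" "ball x r1 \<subseteq> U"
    using smooth_on_open[OF smooth] xU open_contains_ball by blast
  have "isCont (grad u) x"
    using smooth_on_grad_continuous[OF smooth] smooth_on_open[OF smooth] xU
    by (simp add: continuous_on_eq_continuous_at)
  then have "isCont (\<lambda>y. grad u y \<bullet> ?n) x" by (intro continuous_intros)
  from isCont_distD[OF this, of 1] u_normal[OF x]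
  obtain r2 where r2: "r2 > 0" "\<And>y. dist x y < r2 \<Longrightarrow> grad u y \<bullet> ?n > 0"
    by (auto simp: dist_real_def) (smt (verit))
  define r0 where "r0 = min r1 r2"
  have r0: "r0 > 0" using r1 r2 by (simp add: r0_def)
  obtain d where d: "d > 0" "\<And>t. 0 < t \<Longrightarrow> t < d \<Longrightarrow> x - t *\<^sub>R ?n \<in> Om"
    using crossing[OF x, of ?n] n by auto
  \<comment> \<open>Small enough for \<open>x - s *\<^sub>R ?n\<close> to lie in \<open>Om\<close>
    and for the whole segment to stay within \<open>r0\<close> of \<open>x\<close>.\<close>
  define s where "s = min d (r0 / norm ?n) / 2"
  have "s \<le> (r0 / norm ?n) / 2" by (simp add: s_def)
  then have s3: "s * norm ?n \<le> r0 / 2" using np by (simp add: field_simps)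
  have s: "0 < s" "s < d" "s * norm ?n \<le> r0 / 2"
    using d r0 np s3 by (auto simp: s_def)
  obtain r3 where r3: "r3 > 0" "ball (x - s *\<^sub>R ?n) r3 \<subseteq> Om"
    using Om_open d(2)[OF s(1,2)] open_contains_ball by blast
  have "u y \<ge> 0" if y: "dist x y < min r3 (r0 / 2)" "y \<notin> Om" for y
  proof -
    have "dist (x - s *\<^sub>R ?n) (y - s *\<^sub>R ?n) = dist x y" by (simp add: dist_norm)
    then have "y - s *\<^sub>R ?n \<in> Om" using y(1) r3(2) by auto
    then have "closed_segment y (y - s *\<^sub>R ?n) \<inter> Om \<noteq> {}" by auto
    moreover have "closed_segment y (y - s *\<^sub>R ?n) - Om \<noteq> {}" using y(2) by auto
    ultimately have "closed_segment y (y - s *\<^sub>R ?n) \<inter> frontier Om \<noteq> {}"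
      by (intro connected_Int_frontier) auto
    then obtain z where zf: "z \<in> frontier Om" "z \<in> closed_segment y (y - s *\<^sub>R ?n)" by blast
    then obtain w where z: "z \<in> frontier Om" "0 \<le> w" "w \<le> 1" "z = (1 - w) *\<^sub>R y + w *\<^sub>R (y - s *\<^sub>R ?n)"
      unfolding in_segment by blast
    define t where "t = w * s"
    have t: "0 \<le> t" "t \<le> s" using z(2,3) s(1) by (auto simp: t_def mult_left_le_one_le)
    have zt: "z = y - t *\<^sub>R ?n" using z(4) by (simp add: t_def algebra_simps)
    have near: "dist x (z + q *\<^sub>R ?n) < r0" if "0 \<le> q" "q \<le> t" for q
    proof -
      have "z + q *\<^sub>R ?n = y - (t - q) *\<^sub>R ?n" by (simp add: zt algebra_simps)
      then have "dist x (z + q *\<^sub>R ?n) \<le> dist x y + dist y (y - (t - q) *\<^sub>R ?n)" by (metis dist_triangle)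
      also have "dist y (y - (t - q) *\<^sub>R ?n) = (t - q) * norm ?n" using that by (simp add: dist_norm)
      also have "\<dots> \<le> s * norm ?n" using that t by (intro mult_right_mono) auto
      finally show ?thesis using s(3) y(1) by simp
    qed
    have "u (z + 0 *\<^sub>R ?n) \<le> u (z + t *\<^sub>R ?n)"
    proof (rule DERIV_nonneg_imp_nondecreasing[where f = "\<lambda>q. u (z + q *\<^sub>R ?n)"])
      fix q assume q: "0 \<le> q" "q \<le> t"
      have "z + q *\<^sub>R ?n \<in> U" using near[OF q] r1 by (auto simp: r0_def)
      from has_derivative_along_line[OF smooth this] r2(2)[of "z + q *\<^sub>R ?n"] near[OF q]
      show "\<exists>l. ((\<lambda>q. u (z + q *\<^sub>R ?n)) has_real_derivative l) (at q) \<and> 0 \<le> l"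
        by (intro exI[of _ "grad u (z + q *\<^sub>R ?n) \<bullet> ?n"]) (auto simp: r0_def)
    qed (use t in auto)
    then show ?thesis using u_zero[OF z(1)] by (simp add: zt)
  qed
  then show ?thesis using r3(1) r0 by (intro exI[of _ "min r3 (r0 / 2)"]) auto
qed

section \<open>Convexity and nonnegativity of the extension\<close>

definition u_ext :: "real^'n \<Rightarrow> real" where
  "u_ext x = (if x \<in> Om then 0 else u x)"

lemma u_ext_closure: "x \<in> closure Om \<Longrightarrow> u_ext x = 0"
  using u_zero in_frontier_iff by (auto simp: u_ext_def)

lemma u_ext_outside: "x \<notin> Om \<Longrightarrow> u_ext x = u x"
  by (simp add: u_ext_def)

lemma u_ext_continuous: "continuous_on UNIV u_ext"
proof -
  have "continuous_on (closure Om \<union> - Om) (\<lambda>x. if x \<in> Om then 0 else u x)"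
  proof (rule continuous_on_cases)
    show "continuous_on (- Om) u"
      using smooth_on_continuous[OF smooth] U_sub by (rule continuous_on_subset)
    show "\<forall>x. x \<in> closure Om \<and> x \<notin> Om \<or> x \<in> - Om \<and> x \<in> Om \<longrightarrow> 0 = u x"
      using u_zero in_frontier_iff by auto
  qed (use Om_open in auto)
  moreover have "closure Om \<union> - Om = UNIV" using closure_subset by blast
  ultimately show ?thesis by (simp add: u_ext_def[abs_def])
qed

lemma u_ext_locally_nonneg:
  assumes "y \<in> closure Om"
  shows "\<exists>r>0. \<forall>z. dist y z < r \<longrightarrow> u_ext z \<ge> 0"
proof (cases "y \<in> Om")
  case True
  then obtain r where "r > 0" "ball y r \<subseteq> Om" using Om_open open_contains_ball by blast
  then show ?thesis by (intro exI[of _ r]) (auto simp: u_ext_def)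
next
  case False
  with assms have "y \<in> frontier Om" by (simp add: in_frontier_iff)
  from locally_nonneg_at_frontier[OF this] show ?thesis by (auto simp: u_ext_def)
qed

lemma line_near:
  fixes p h :: "real^'n" and t0 r :: real
  assumes r: "r > 0" and t0: "0 < t0" "t0 < 1"
  obtains d where "d > 0" "\<And>s. \<bar>s - t0\<bar> < d \<Longrightarrow> dist (p + t0 *\<^sub>R h) (p + s *\<^sub>R h) < r \<and> 0 < s \<and> s < 1"
proof
  have np: "norm h + 1 > 0" by (smt (verit) norm_ge_zero)
  let ?d = "min (r / (norm h + 1)) (min t0 (1 - t0))"
  show "?d > 0" using r np t0 by simp
  fix s assume s: "\<bar>s - t0\<bar> < ?d"
  have "dist (p + t0 *\<^sub>R h) (p + s *\<^sub>R h) = norm ((t0 - s) *\<^sub>R h)" by (simp add: dist_norm scaleR_left_diff_distrib)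
  also have "\<dots> \<le> \<bar>s - t0\<bar> * (norm h + 1)" by (simp add: abs_minus_commute mult_left_mono)
  also have "\<dots> < r" using s np by (simp add: field_simps)
  finally show "dist (p + t0 *\<^sub>R h) (p + s *\<^sub>R h) < r \<and> 0 < s \<and> s < 1" using s by auto
qed

text \<open>If the extension exceeds a chord, consider the first maximum of the difference: outside the
  closure of the domain positivity of the Hessian excludes it, and on the closure the
  difference would be constant nearby because the extension is locally nonnegative.\<close>
lemma u_ext_convex:
  assumes t: "0 \<le> t" "t \<le> 1"
  shows "u_ext (p + t *\<^sub>R (q - p)) \<le> (1 - t) * u_ext p + t * u_ext q"
proof (rule ccontr)
  assume neg: "\<not> ?thesis"
  define h where "h = q - p"
  define A where "A s = (1 - s) * u_ext p + s * u_ext q" for s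
  define W where "W s = u_ext (p + s *\<^sub>R h) - A s" for s
  have Wt: "W t > 0" using neg by (simp add: W_def A_def h_def)
  have h0: "h \<noteq> 0"
  proof
    assume "h = 0"
    then have "q = p" by (simp add: h_def)
    then have "W t = 0" by (simp add: W_def A_def h_def algebra_simps)
    with Wt show False by simp
  qed
  have W01: "W 0 = 0" "W 1 = 0" by (simp_all add: W_def A_def h_def)
  have cW: "continuous_on {0..1} W"
    unfolding W_def A_def
    by (intro continuous_intros continuous_on_compose2[OF u_ext_continuous]) auto
  obtain t1 where t1: "t1 \<in> {0..1}" "\<And>s. s \<in> {0..1} \<Longrightarrow> W s \<le> W t1"
    using continuous_attains_sup[OF _ _ cW] by auto
  define K where "K = {0..1} \<inter> W -` {W t1}"
  have "closed K" unfolding K_def by (intro continuous_closed_preimage cW) auto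
  then have "compact K" unfolding K_def by (metis compact_Icc compact_Int_closed inf.idem inf_assoc K_def Int_commute)
  moreover have "K \<noteq> {}" using t1(1) by (auto simp: K_def)
  ultimately obtain t0 where t0K: "t0 \<in> K" and t0min: "\<And>s. s \<in> K \<Longrightarrow> t0 \<le> s"
    using compact_attains_inf[of K] by metis
  have W0: "W t0 = W t1" and t0I: "t0 \<in> {0..1}" using t0K by (auto simp: K_def)
  have "W t1 > 0" using Wt t1(2)[of t] t by auto
  then have "t0 \<noteq> 0" "t0 \<noteq> 1" using W0 W01 by auto
  then have t0: "0 < t0" "t0 < 1" using t0I by auto
  let ?y = "p + t0 *\<^sub>R h"
  show False
  proof (cases "?y \<in> closure Om")
    case False
    then obtain r where r: "r > 0" "ball ?y r \<subseteq> - closure Om"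
      using open_contains_ball[of "- closure Om"] by (auto simp: open_Compl)
    obtain d where d: "d > 0" "\<And>s. \<bar>s - t0\<bar> < d \<Longrightarrow> dist ?y (p + s *\<^sub>R h) < r \<and> 0 < s \<and> s < 1"
      using line_near[OF r(1) t0] by blast
    have out: "p + s *\<^sub>R h \<notin> Om" "p + s *\<^sub>R h \<in> U" if "\<bar>s - t0\<bar> < d" for s
      using near_outside[OF r(2)] d(2)[OF that] by blast+
    have "- (h \<bullet> (hess u ?y *v h)) \<ge> 0"
    proof (rule second_derivative_local_min(2)[OF d(1), where t = t0 and f = "\<lambda>s. A s - u (p + s *\<^sub>R h)"
          and f' = "\<lambda>s. (u_ext q - u_ext p) - grad u (p + s *\<^sub>R h) \<bullet> h"])
      fix s assume s: "\<bar>s - t0\<bar> < d"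
      have "(A has_real_derivative u_ext q - u_ext p) (at s)"
        unfolding A_def by (auto intro!: derivative_eq_intros)
      then show "((\<lambda>s. A s - u (p + s *\<^sub>R h)) has_real_derivative (u_ext q - u_ext p) - grad u (p + s *\<^sub>R h) \<bullet> h) (at s)"
        by (intro DERIV_diff has_derivative_along_line[OF smooth] out s)
      have "W s \<le> W t0" using t1(2)[of s] d(2)[OF s] W0 by auto
      then show "A t0 - u (p + t0 *\<^sub>R h) \<le> A s - u (p + s *\<^sub>R h)"
        using out[OF s] out(1)[of t0] d(1) by (simp add: W_def u_ext_outside)
    next
      have "((\<lambda>s. (u_ext q - u_ext p) - grad u (p + s *\<^sub>R h) \<bullet> h) has_real_derivative 0 - h \<bullet> (hess u ?y *v h)) (at t0)"
        by (intro DERIV_diff DERIV_const grad_has_derivative_along_line[OF smooth] out) (use d in auto)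
      then show "((\<lambda>s. (u_ext q - u_ext p) - grad u (p + s *\<^sub>R h) \<bullet> h) has_real_derivative - (h \<bullet> (hess u ?y *v h))) (at t0)"
        by simp
    qed
    moreover have "?y \<notin> Om" using False closure_subset by blast
    ultimately show False using hess_pos[OF _ h0, of ?y] by simp
  next
    case True
    then have y0: "u_ext ?y = 0" by (rule u_ext_closure)
    obtain r where r: "r > 0" "\<And>z. dist ?y z < r \<Longrightarrow> u_ext z \<ge> 0"
      using u_ext_locally_nonneg[OF True] by blast
    obtain d where d: "d > 0" "\<And>s. \<bar>s - t0\<bar> < d \<Longrightarrow> dist ?y (p + s *\<^sub>R h) < r \<and> 0 < s \<and> s < 1"
      using line_near[OF r(1) t0] by blast
    define m where "m = u_ext q - u_ext p"
    have As: "A s - A t0 = m * (s - t0)" for s by (simp add: A_def m_def algebra_simps)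
    have sand: "0 \<le> u_ext (p + s *\<^sub>R h)" "u_ext (p + s *\<^sub>R h) \<le> m * (s - t0)" if "\<bar>s - t0\<bar> < d" for s
    proof -
      show "0 \<le> u_ext (p + s *\<^sub>R h)" using r(2) d(2)[OF that] by blast
      have "W s \<le> W t0" using t1(2)[of s] d(2)[OF that] W0 by auto
      then show "u_ext (p + s *\<^sub>R h) \<le> m * (s - t0)" using As[of s] y0 by (simp add: W_def)
    qed
    have "0 \<le> m * (d / 2)" "0 \<le> m * (- d / 2)"
      using sand[of "t0 + d / 2"] sand[of "t0 - d / 2"] d(1) by auto
    then have "m = 0" using d(1) by (auto simp: mult_le_0_iff zero_le_mult_iff)
    then have "u_ext (p + (t0 - d / 2) *\<^sub>R h) = 0" using sand[of "t0 - d / 2"] d(1) by auto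
    then have "W (t0 - d / 2) = W t0" using As[of "t0 - d / 2"] y0 \<open>m = 0\<close> by (simp add: W_def)
    then have "t0 - d / 2 \<in> K" using W0 d(2)[of "t0 - d / 2"] d(1) by (auto simp: K_def)
    then show False using t0min[of "t0 - d / 2"] d(1) by auto
  qed
qed

text \<open>A convex function that vanishes near a point \<open>p\<close> is nonnegative: a point
  close to \<open>p\<close> on the segment to \<open>y\<close> has value 0, and convexity bounds
  this value by \<open>t * u_ext y\<close>.\<close>

lemma u_ext_nonneg: "u_ext y \<ge> 0"
proof -
  obtain p where p: "p \<in> Om" using Om_ne by auto
  have "p \<in> closure Om" using p closure_subset by blast
  obtain r where r: "r > 0" "ball p r \<subseteq> Om" using Om_open p open_contains_ball by blast
  define t where "t = min 1 (r / (2 * (norm (y - p) + 1)))"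
  have np: "norm (y - p) + 1 > 0" by (smt (verit) norm_ge_zero)
  have t: "0 < t" "t \<le> 1" using r np by (auto simp: t_def)
  have "t \<le> r / (2 * (norm (y - p) + 1))" by (simp add: t_def)
  then have "t * (norm (y - p) + 1) < r" using np r by (simp add: field_simps)
  then have "t * norm (y - p) < r" using t by (simp add: distrib_left)
  then have "norm (t *\<^sub>R (y - p)) < r" using t by (simp only: norm_scaleR)
  then have "p + t *\<^sub>R (y - p) \<in> ball p r" by (simp add: dist_norm)
  then have "u_ext (p + t *\<^sub>R (y - p)) = 0" using r(2) by (auto simp: u_ext_def)
  then have "0 \<le> t * u_ext y"
    using u_ext_convex[of t p y] t u_ext_closure[OF \<open>p \<in> closure Om\<close>] by simp
  then show ?thesis using t by (simp add: zero_le_mult_iff)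
qed

lemma u_nonneg: "y \<notin> Om \<Longrightarrow> u y \<ge> 0"
  using u_ext_nonneg u_ext_outside by metis

text \<open>\<open>u\<close> is 0 at \<open>x\<close> and nonnegative off \<open>Om\<close>, so
  along every ray that leaves \<open>Om\<close> at \<open>x\<close> it starts from a
  minimum.\<close>

lemma grad_at_touching:
  assumes x: "x \<in> frontier Om" and n: "n \<noteq> 0"
    and out: "\<And>e. e \<bullet> n > 0 \<Longrightarrow> \<exists>d>0. \<forall>t. 0 < t \<and> t < d \<longrightarrow> x + t *\<^sub>R e \<notin> Om"
  shows "\<exists>mu\<ge>0. grad u x = mu *\<^sub>R n"
proof (rule grad_halfspace[OF smooth_on_has_derivative[OF smooth] n])
  show "x \<in> U" using x frontier_not_in U_sub by auto
  fix e assume "e \<bullet> n > 0"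
  from out[OF this] show "\<exists>d>0. \<forall>t. 0 < t \<and> t < d \<longrightarrow> u x \<le> u (x + t *\<^sub>R e)"
    using u_zero[OF x] u_nonneg by metis
qed

lemma grad_at_frontier:
  assumes x: "x \<in> frontier Om"
  shows "\<exists>mu>0. grad u x = mu *\<^sub>R nrm x"
proof -
  obtain mu where mu: "mu \<ge> 0" "grad u x = mu *\<^sub>R nrm x"
    using grad_at_touching[OF x normal_nonzero[OF x]] crossing[OF x] by metis
  moreover have "mu \<noteq> 0" using u_normal[OF x] mu(2) by auto
  ultimately show ?thesis by (intro exI[of _ mu]) auto
qed

end

section \<open>Gradient bound and the circumscribed ball\<close>

locale exterior_solution_unit = exterior_solution Om U u nrm
  for Om :: "(real^'n::finite) set" and U u nrm +
  assumes normal_unit: "x \<in> frontier Om \<Longrightarrow> norm (nrm x) = 1"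
begin

lemma norm_grad_frontier: 
  assumes x: "x \<in> frontier Om"
  shows "norm (grad u x) = 1"
proof -
  obtain mu where mu: "mu > 0" "grad u x = mu *\<^sub>R nrm x" using grad_at_frontier[OF x] by blast
  then have "mu * (nrm x \<bullet> nrm x) = 1" using u_normal[OF x] by simp
  then have "mu = 1" using normal_unit[OF x] by (simp add: norm_eq_1)
  then show ?thesis using mu normal_unit[OF x] by simp
qed

lemma grad_at_touching_unit:
  assumes x: "x \<in> frontier Om" and n: "norm n = 1"
    and out: "\<And>e. e \<bullet> n > 0 \<Longrightarrow> \<exists>d>0. \<forall>t. 0 < t \<and> t < d \<longrightarrow> x + t *\<^sub>R e \<notin> Om"
  shows "grad u x = n"
proof -
  have "n \<noteq> 0" using n by auto
  then obtain mu where mu: "mu \<ge> 0" "grad u x = mu *\<^sub>R n" using grad_at_touching[OF x _ out] by blast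
  then have "mu = 1" using norm_grad_frontier[OF x] n by simp
  then show ?thesis using mu by simp
qed

lemma grad_increasing_along_ray:
  assumes L: "0 < L" and h: "h \<noteq> 0" and out: "\<And>s. 0 \<le> s \<Longrightarrow> s \<le> L \<Longrightarrow> x + s *\<^sub>R h \<notin> Om"
  shows "grad u x \<bullet> h < grad u (x + L *\<^sub>R h) \<bullet> h"
proof -
  have "grad u (x + 0 *\<^sub>R h) \<bullet> h < grad u (x + L *\<^sub>R h) \<bullet> h"
  proof (rule DERIV_pos_imp_increasing[where f = "\<lambda>s. grad u (x + s *\<^sub>R h) \<bullet> h"])
    fix s assume s: "0 \<le> s" "s \<le> L"
    have "x + s *\<^sub>R h \<in> U" using out[OF s] U_sub by auto
    then show "\<exists>l. ((\<lambda>s. grad u (x + s *\<^sub>R h) \<bullet> h) has_real_derivative l) (at s) \<and> 0 < l"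
      using grad_has_derivative_along_line[OF smooth] hess_pos[OF out[OF s] h] by blast
  qed (use L in auto)
  then show ?thesis by simp
qed

text \<open>Let \<open>x\<close> be the point of the closure nearest to \<open>y\<close>. The ball
  around \<open>y\<close> through \<open>x\<close> touches the domain from outside, so the gradient
  at \<open>x\<close> is the unit vector \<open>n\<close> towards \<open>y\<close>, and strict
  convexity increases the component along \<open>n\<close> on the way to \<open>y\<close>.\<close>

lemma norm_grad_gt_1:
  assumes y: "y \<notin> closure Om"
  shows "norm (grad u y) > 1"
proof -
  obtain x where x: "x \<in> closure Om" "\<And>z. z \<in> closure Om \<Longrightarrow> dist y x \<le> dist y z"
    using distance_attains_inf[of "closure Om" y] Om_ne by auto
  have "x \<noteq> y" using x(1) y by auto
  define L where "L = norm (y - x)"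
  define n where "n = (y - x) /\<^sub>R L"
  have L: "L > 0" using \<open>x \<noteq> y\<close> by (simp add: L_def)
  have n: "norm n = 1" using L by (simp add: n_def L_def)
  have yx: "y = x + L *\<^sub>R n" using L by (simp add: n_def)
  \<comment> \<open>The condition on \<open>e\<close> says exactly that \<open>x + e\<close> lies in
    the open ball around \<open>y\<close> through \<open>x\<close>.\<close>
  have close: "x + e \<notin> closure Om" if "e \<bullet> e < 2 * (e \<bullet> (y - x))" for e
  proof
    assume "x + e \<in> closure Om"
    then have "norm (y - x) \<le> norm (y - x - e)" using x(2)[of "x + e"] by (simp add: dist_norm algebra_simps)
    then have "(y - x) \<bullet> (y - x) \<le> (y - x - e) \<bullet> (y - x - e)" by (simp add: norm_le)
    then show False using that by (simp add: inner_simps inner_commute)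
  qed
  have out: "\<exists>d>0. \<forall>t. 0 < t \<and> t < d \<longrightarrow> x + t *\<^sub>R e \<notin> closure Om" if e: "e \<bullet> n > 0" for e
  proof (intro exI[of _ "2 * (e \<bullet> (y - x)) / (e \<bullet> e)"] conjI allI impI)
    have ee: "e \<bullet> e > 0" using e by (cases "e = 0") auto
    have ey: "e \<bullet> (y - x) > 0" using e L by (simp add: n_def zero_less_mult_iff)
    show "0 < 2 * (e \<bullet> (y - x)) / (e \<bullet> e)" using ee ey by simp
    fix t assume t: "0 < t \<and> t < 2 * (e \<bullet> (y - x)) / (e \<bullet> e)"
    then have "t * (e \<bullet> e) < 2 * (e \<bullet> (y - x))" using ee by (simp add: field_simps)
    then have "t * (t * (e \<bullet> e)) < t * (2 * (e \<bullet> (y - x)))" using t by (intro mult_strict_left_mono) auto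
    then show "x + t *\<^sub>R e \<notin> closure Om" by (intro close) (simp add: algebra_simps)
  qed
  have "x \<notin> Om"
  proof
    assume "x \<in> Om"
    then obtain r where r: "r > 0" "ball x r \<subseteq> Om" using Om_open open_contains_ball by blast
    obtain d where d: "d > 0" "\<forall>t. 0 < t \<and> t < d \<longrightarrow> x + t *\<^sub>R n \<notin> closure Om"
      using out[of n] n by (metis norm_eq_1 zero_less_one)
    define t where "t = min r d / 2"
    have t: "0 < t" "t < d" "t < r" using r d by (auto simp: t_def)
    then have "x + t *\<^sub>R n \<in> ball x r" using n by (simp add: dist_norm)
    then show False using d(2) t r(2) closure_subset by blast
  qed
  then have xf: "x \<in> frontier Om" using x(1) by (simp add: in_frontier_iff)
  have outO: "\<exists>d>0. \<forall>t. 0 < t \<and> t < d \<longrightarrow> x + t *\<^sub>R e \<notin> Om" if e: "e \<bullet> n > 0" for e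
    using out[OF e] closure_subset by blast
  have gx: "grad u x = n" by (rule grad_at_touching_unit[OF xf n outO])
  have "grad u x \<bullet> n < grad u (x + L *\<^sub>R n) \<bullet> n"
  proof (rule grad_increasing_along_ray[OF L])
    show "n \<noteq> 0" using n by auto
    fix s assume s: "0 \<le> s" "s \<le> L"
    show "x + s *\<^sub>R n \<notin> Om"
    proof (cases "s = 0")
      case False
      then have "s * s < 2 * (s * L)" using s by (simp add: mult.commute)
      then have "x + s *\<^sub>R n \<notin> closure Om"
        using n by (intro close) (simp add: yx norm_eq_1 mult_ac)
      then show ?thesis using closure_subset by blast
    qed (use \<open>x \<notin> Om\<close> in simp)
  qed
  then have "1 < grad u y \<bullet> n" using gx n by (simp add: yx[symmetric] norm_eq_1)
  also have "\<dots> \<le> norm (grad u y) * norm n" by (rule norm_cauchy_schwarz)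
  finally show ?thesis using n by simp
qed

lemma norm_grad_ge_1: "y \<notin> Om \<Longrightarrow> norm (grad u y) \<ge> 1"
  using norm_grad_gt_1[of y] norm_grad_frontier[of y] by (cases "y \<in> closure Om") (auto simp: in_frontier_iff)

text \<open>The contact point is a point of the closure farthest from \<open>z0\<close>. Rays into
  the outer half space never return to the domain, so both \<open>u\<close> and the squared length
  of its gradient have one-sided minima there; the first determines the gradient, the second the
  action of the Hessian on the normal.\<close>

lemma circumscribed_ball:
  obtains x0 r0 where "r0 > 0" "x0 \<in> frontier Om" "dist z0 x0 = r0" "Om \<subseteq> ball z0 r0"
    "grad u x0 = (x0 - z0) /\<^sub>R r0"
    "hess u x0 *v (x0 - z0) = ((x0 - z0) \<bullet> (hess u x0 *v (x0 - z0)) / r0\<^sup>2) *\<^sub>R (x0 - z0)"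
    "\<forall>e. e \<bullet> (x0 - z0) = 0 \<longrightarrow> e \<bullet> (hess u x0 *v e) \<ge> (e \<bullet> e) / r0"
proof -
  have "compact (closure Om)" using Om_bounded by (simp add: compact_closure)
  then obtain x0 where x0: "x0 \<in> closure Om" "\<And>y. y \<in> closure Om \<Longrightarrow> dist z0 y \<le> dist z0 x0"
    using distance_attains_sup[of "closure Om" z0] Om_ne by auto
  define r0 where "r0 = dist z0 x0"
  have far: "x0 + t *\<^sub>R e \<notin> closure Om" if "t > 0" "e \<bullet> (x0 - z0) \<ge> 0" "e \<noteq> 0" for t e
  proof
    assume "x0 + t *\<^sub>R e \<in> closure Om"
    then have "norm (x0 - z0 + t *\<^sub>R e) \<le> norm (x0 - z0)"
      using x0(2)[of "x0 + t *\<^sub>R e"] by (simp add: dist_norm norm_minus_commute algebra_simps)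
    then have "(x0 - z0 + t *\<^sub>R e) \<bullet> (x0 - z0 + t *\<^sub>R e) \<le> (x0 - z0) \<bullet> (x0 - z0)" by (simp add: norm_le)
    then have "2 * t * (e \<bullet> (x0 - z0)) + t\<^sup>2 * (e \<bullet> e) \<le> 0"
      by (simp add: inner_simps inner_commute power2_eq_square algebra_simps)
    moreover have "t\<^sup>2 * (e \<bullet> e) > 0" using that by simp
    moreover have "2 * t * (e \<bullet> (x0 - z0)) \<ge> 0" using that by simp
    ultimately show False by linarith
  qed
  have "x0 \<notin> Om"
  proof
    assume "x0 \<in> Om"
    then obtain r where r: "r > 0" "ball x0 r \<subseteq> Om" using Om_open open_contains_ball by blast
    obtain e :: "real^'n" where e: "norm e = 1" "e \<bullet> (x0 - z0) \<ge> 0"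
    proof (cases "x0 = z0")
      case True
      \<comment> \<open>In the degenerate case every direction leads away from \<open>z0\<close>, so
        any unit vector serves.\<close>
      then show thesis using that[of "axis undefined 1"] by simp
    next
      case False
      then show thesis using that[of "(x0 - z0) /\<^sub>R norm (x0 - z0)"] by simp
    qed
    have "x0 + (r/2) *\<^sub>R e \<in> ball x0 r" using r e by (simp add: dist_norm)
    moreover have "e \<noteq> 0" using e(1) by auto
    then have "x0 + (r/2) *\<^sub>R e \<notin> closure Om" using far[of "r/2" e] r e(2) by simp
    ultimately show False using r(2) closure_subset by blast
  qed
  then have xf: "x0 \<in> frontier Om" using x0(1) by (simp add: in_frontier_iff)
  obtain p where p: "p \<in> Om" using Om_ne by auto
  have Omc: "Om \<subseteq> cball z0 r0" using x0(2) closure_subset by (auto simp: r0_def subset_iff)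
  then have Omb: "Om \<subseteq> ball z0 r0" using Om_open interior_maximal by (metis interior_cball)
  then have r0: "r0 > 0" using p by (metis Om_ne ball_empty not_le subset_empty)
  define n where "n = (x0 - z0) /\<^sub>R r0"
  have n: "norm n = 1" using r0 by (simp add: n_def r0_def dist_norm norm_minus_commute)
  then have nn: "n \<bullet> n = 1" and n0: "n \<noteq> 0" by (auto simp: norm_eq_1)
  have xz: "x0 - z0 = r0 *\<^sub>R n" using r0 by (simp add: n_def)
  have outc: "x0 + t *\<^sub>R e \<notin> closure Om" if "e \<bullet> n > 0" "t > 0" for e t
    using that r0 by (intro far) (auto simp: xz)
  then have outO: "x0 + t *\<^sub>R e \<notin> Om" if "e \<bullet> n > 0" "t > 0" for e t
    using that closure_subset by blast
  have gx: "grad u x0 = n"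
    using outO by (intro grad_at_touching_unit[OF xf n]) (auto intro: exI[of _ 1])
  have xU: "x0 \<in> U" using \<open>x0 \<notin> Om\<close> U_sub by auto
  let ?H = "hess u x0"
  have sym: "transpose ?H = ?H" using hess_symmetric[OF smooth xU] .
  have gd: "(grad u has_derivative (\<lambda>h. ?H *v h)) (at x0)" by (rule grad_has_derivative[OF smooth xU])
  \<comment> \<open>As the gradient at \<open>x0\<close> is \<open>n\<close> and the Hessian is
    symmetric, the squared length of the gradient has gradient \<open>2 *\<^sub>R (?H *v n)\<close>,
    which \<open>grad_halfspace\<close> makes parallel to \<open>n\<close>.\<close>
  have "((\<lambda>y. grad u y \<bullet> grad u y) has_derivative (\<lambda>h. (2 *\<^sub>R (?H *v n)) \<bullet> h)) (at x0)"
  proof -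
    have "(\<lambda>h. (2 *\<^sub>R (?H *v n)) \<bullet> h) = (\<lambda>h. grad u x0 \<bullet> (?H *v h) + (?H *v h) \<bullet> grad u x0)"
      using sym_inner_commute[OF sym, of n] by (auto simp: gx inner_commute)
    then show ?thesis using has_derivative_inner[OF gd gd] by simp
  qed
  then have "\<exists>mu\<ge>0. 2 *\<^sub>R (?H *v n) = mu *\<^sub>R n"
  proof (rule grad_halfspace[OF _ n0])
    fix e assume e: "e \<bullet> n > 0"
    have "grad u x0 \<bullet> grad u x0 \<le> grad u (x0 + t *\<^sub>R e) \<bullet> grad u (x0 + t *\<^sub>R e)" if "t > 0" for t
    proof -
      have "norm (grad u (x0 + t *\<^sub>R e)) \<ge> 1" by (rule norm_grad_ge_1[OF outO[OF e that]])
      then have "(norm (grad u (x0 + t *\<^sub>R e)))\<^sup>2 \<ge> 1" by (simp add: one_le_power)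
      then show ?thesis by (simp add: gx nn power2_norm_eq_inner)
    qed
    then show "\<exists>d>0. \<forall>t. 0 < t \<and> t < d \<longrightarrow> grad u x0 \<bullet> grad u x0 \<le> grad u (x0 + t *\<^sub>R e) \<bullet> grad u (x0 + t *\<^sub>R e)"
      by (intro exI[of _ 1]) auto
  qed
  then obtain mu where "2 *\<^sub>R (?H *v n) = mu *\<^sub>R n" by blast
  then have "(1/2) *\<^sub>R (2 *\<^sub>R (?H *v n)) = (1/2) *\<^sub>R (mu *\<^sub>R n)" by simp
  then have Hn: "?H *v n = (mu / 2) *\<^sub>R n" by simp
  have "mu / 2 = (x0 - z0) \<bullet> (?H *v (x0 - z0)) / r0\<^sup>2"
    using r0 by (simp add: xz matrix_vector_mult_scaleR Hn nn power2_eq_square)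
  moreover have "?H *v (x0 - z0) = (mu / 2) *\<^sub>R (x0 - z0)"
    by (simp add: xz matrix_vector_mult_scaleR Hn)
  ultimately have Hx: "?H *v (x0 - z0) = ((x0 - z0) \<bullet> (?H *v (x0 - z0)) / r0\<^sup>2) *\<^sub>R (x0 - z0)"
    by metis
  have unit: "e \<bullet> (?H *v e) \<ge> 1 / r0" if e: "e \<bullet> n = 0" "norm e = 1" for e
  proof -
    \<comment> \<open>A great circle through \<open>x0\<close> in direction \<open>e\<close>. It
      avoids \<open>Om\<close>, hence \<open>u\<close> has a minimum along it at \<open>x0\<close>;
      its acceleration \<open>- r0 *\<^sub>R n\<close> at that point contributes the
      \<open>1 / r0\<close> in the bound.\<close>
    define ga where "ga t = z0 + r0 *\<^sub>R (cos t *\<^sub>R n + sin t *\<^sub>R e)" for t :: real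
    define ga' where "ga' t = r0 *\<^sub>R ((- sin t) *\<^sub>R n + cos t *\<^sub>R e)" for t :: real
    have ee: "e \<bullet> e = 1" using e(2) by (simp add: norm_eq_1)
    have ga0: "ga 0 = x0" using xz by (simp add: ga_def) (metis add.commute diff_add_cancel)
    have gd1: "(ga has_derivative (\<lambda>s. s *\<^sub>R ga' t)) (at t)" for t
      unfolding ga_def ga'_def
      by (auto intro!: derivative_eq_intros simp: fun_eq_iff algebra_simps)
    have gd2: "(ga' has_derivative (\<lambda>s. s *\<^sub>R (- r0 *\<^sub>R (cos t *\<^sub>R n + sin t *\<^sub>R e)))) (at t)" for t
      unfolding ga'_def
      by (auto intro!: derivative_eq_intros simp: fun_eq_iff algebra_simps)
    have gaO: "ga t \<notin> Om" for t
    proof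
      have "(cos t *\<^sub>R n + sin t *\<^sub>R e) \<bullet> (cos t *\<^sub>R n + sin t *\<^sub>R e) = (cos t)\<^sup>2 + (sin t)\<^sup>2"
        using e(1) by (simp add: inner_simps nn ee inner_commute power2_eq_square)
      then have "norm (cos t *\<^sub>R n + sin t *\<^sub>R e) = 1" by (simp add: norm_eq_1)
      then have "dist z0 (ga t) = r0" using r0 by (simp add: ga_def dist_norm)
      moreover assume "ga t \<in> Om"
      ultimately show False using Omb by auto
    qed
    then have gaU: "ga t \<in> U" for t using U_sub by auto
    have "(?H *v ga' 0) \<bullet> ga' 0 + grad u x0 \<bullet> (- r0 *\<^sub>R (cos 0 *\<^sub>R n + sin 0 *\<^sub>R e)) \<ge> 0"
    proof (rule second_derivative_local_min(2)[where d = 1 and t = 0 and f = "\<lambda>t. u (ga t)" and f' = "\<lambda>t. grad u (ga t) \<bullet> ga' t"])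
      fix s :: real
      from diff_chain_at[OF gd1 smooth_on_has_derivative[OF smooth gaU], of s]
      show "((\<lambda>t. u (ga t)) has_real_derivative grad u (ga s) \<bullet> ga' s) (at s)"
        by (simp add: o_def has_field_derivative_def mult_commute_abs)
      show "u (ga 0) \<le> u (ga s)" using u_zero[OF xf] u_nonneg[OF gaO[of s]] by (simp add: ga0)
    next
      have "(grad u has_derivative (\<lambda>h. ?H *v h)) (at (ga 0))" using gd by (simp add: ga0)
      from diff_chain_at[OF gd1 this]
      have "((\<lambda>t. grad u (ga t)) has_derivative (\<lambda>s. ?H *v (s *\<^sub>R ga' 0))) (at 0)" by (simp add: o_def)
      from has_derivative_inner[OF this gd2[of 0]]
      show "((\<lambda>t. grad u (ga t) \<bullet> ga' t) has_real_derivative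
         (?H *v ga' 0) \<bullet> ga' 0 + grad u x0 \<bullet> (- r0 *\<^sub>R (cos 0 *\<^sub>R n + sin 0 *\<^sub>R e))) (at 0)"
        unfolding has_field_derivative_def
        by (rule has_derivative_eq_rhs) (auto simp: fun_eq_iff ga0 matrix_vector_mult_scaleR algebra_simps)
    qed simp
    then have "r0 * r0 * (e \<bullet> (?H *v e)) \<ge> r0"
      by (simp add: ga'_def gx nn matrix_vector_mult_scaleR inner_commute)
    then have "r0 * (e \<bullet> (?H *v e)) \<ge> 1" using r0 by (simp add: mult.assoc)
    then show ?thesis using r0 by (simp add: field_simps)
  qed
  have tang: "e \<bullet> (?H *v e) \<ge> (e \<bullet> e) / r0" if e: "e \<bullet> (x0 - z0) = 0" for e
  proof (cases "e = 0")
    case False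
    have "(e /\<^sub>R norm e) \<bullet> (?H *v (e /\<^sub>R norm e)) \<ge> 1 / r0"
      using e False r0 by (intro unit) (auto simp: xz)
    then have "(e \<bullet> (?H *v e)) / (norm e)\<^sup>2 \<ge> 1 / r0"
      by (simp add: matrix_vector_mult_scaleR power2_eq_square field_simps)
    then show ?thesis using False r0 by (simp add: power2_norm_eq_inner field_simps)
  qed simp
  show thesis
    using that[OF r0 xf _ Omb _ Hx] tang gx by (simp add: r0_def[symmetric] n_def)
qed

end

subsection \<open>Radial profiles and their constants at infinity\<close>

text \<open>The slope of a radial solution at distance \<open>\<tau>\<close> minus the slope
  \<open>\<tau>\<close> of \<open>|x|^2 / 2\<close>. It decays like
  \<open>\<tau> powr (1 - d)\<close>, so for \<open>d \<ge> 3\<close> its integral, which determines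
  the constant at infinity, is finite.\<close>

definition slope_excess :: "nat \<Rightarrow> nat \<Rightarrow> real \<Rightarrow> real \<Rightarrow> real" where
  "slope_excess d k m \<tau> = \<tau> * ((1 + m * \<tau> powr (- real d)) powr (1 / real k) - 1)"

definition Phi :: "nat \<Rightarrow> nat \<Rightarrow> real \<Rightarrow> real" where
  "Phi d k m = integral {1..} (slope_excess d k m)"

text \<open>The constant c for which, when b = 0, the problem has a radial solution outside the ball of radius R.\<close>
definition radius_const :: "nat \<Rightarrow> nat \<Rightarrow> real \<Rightarrow> real" where
  "radius_const d k R = R\<^sup>2 * (- 1/2 + Phi d k (1 / R ^ k - 1))"

text \<open>For \<open>m \<ge> 0\<close> the base is at least 1, and for negative \<open>m\<close>
  it increases with \<open>\<tau>\<close>; so positivity has to be checked at the left end only.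
  Negative \<open>m\<close> does occur, namely for radii above 1.\<close>

lemma base_pos_mono:
  fixes e :: real
  assumes "0 < R" "R \<le> \<tau>" "1 + m * R powr (- e) > 0" "e \<ge> 0"
  shows "1 + m * \<tau> powr (- e) > 0"
proof (cases "m \<ge> 0")
  case True
  then show ?thesis by (smt (verit) mult_nonneg_nonneg powr_ge_zero)
next
  case False
  have "\<tau> powr (- e) \<le> R powr (- e)"
    using assms by (simp add: powr_mono2')
  then have "m * \<tau> powr (- e) \<ge> m * R powr (- e)" using False by (simp add: mult_left_mono_neg)
  then show ?thesis using assms(3) by linarith
qed

lemma powr_one_plus_bound:
  fixes x p :: real
  assumes "1 + x > 0" "0 \<le> p" "p \<le> 1"
  shows "\<bar>(1 + x) powr p - 1\<bar> \<le> \<bar>x\<bar>" "x \<ge> 0 \<Longrightarrow> (1 + x) powr p \<ge> 1" "x \<le> 0 \<Longrightarrow> (1 + x) powr p \<le> 1"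
proof -
  show g: "x \<ge> 0 \<Longrightarrow> (1 + x) powr p \<ge> 1" using assms(2) by (simp add: ge_one_powr_ge_zero)
  show l: "x \<le> 0 \<Longrightarrow> (1 + x) powr p \<le> 1" using assms by (intro powr_le1) auto
  show "\<bar>(1 + x) powr p - 1\<bar> \<le> \<bar>x\<bar>"
  proof (cases "x \<ge> 0")
    case True
    have "(1 + x) powr p \<le> (1 + x) powr 1" using True assms by (intro powr_mono) auto
    then show ?thesis using g True by auto
  next
    case False
    have "(1 + x) powr 1 \<le> (1 + x) powr p" using False assms by (intro powr_mono') auto
    then show ?thesis using l False assms by auto
  qed
qed

lemma slope_excess_altdef:
  assumes "x > 0"
  shows "slope_excess d k a x = x * (1 + a / x ^ d) powr (1 / real k) - x"
proof -
  have "x powr (- real d) = inverse (x ^ d)" using assms by (simp add: powr_minus powr_realpow)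
  then show ?thesis by (simp add: slope_excess_def divide_inverse right_diff_distrib)
qed

lemma slope_excess_bound:
  assumes "\<tau> > 0" "1 + m * \<tau> powr (- real d) > 0" "k \<ge> 1"
  shows "\<bar>slope_excess d k m \<tau>\<bar> \<le> \<bar>m\<bar> * \<tau> powr (1 - real d)"
proof -
  have p: "0 \<le> 1 / real k" "1 / real k \<le> 1" using assms(3) by auto
  have "\<bar>slope_excess d k m \<tau>\<bar> = \<tau> * \<bar>(1 + m * \<tau> powr (- real d)) powr (1 / real k) - 1\<bar>"
    using assms(1) by (simp add: slope_excess_def abs_mult)
  also have "\<dots> \<le> \<tau> * \<bar>m * \<tau> powr (- real d)\<bar>"
    using powr_one_plus_bound(1)[OF assms(2) p] assms(1) by (intro mult_left_mono) auto
  also have "\<dots> = \<bar>m\<bar> * \<tau> powr (1 - real d)"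
    using assms(1) powr_mult_base[of \<tau> "- real d"] by (simp add: abs_mult mult.left_commute)
  finally show ?thesis .
qed

lemma slope_excess_continuous:
  assumes "R > 0" "1 + m * R powr (- real d) > 0"
  shows "continuous_on {R..} (slope_excess d k m)"
proof -
  have "1 + m * x powr (- real d) > 0" if "x \<ge> R" for x
    using base_pos_mono[of R x m "real d"] that assms by simp
  then have "1 + m * x powr (- real d) \<noteq> 0" if "x \<ge> R" for x
    using that by (metis less_irrefl)
  moreover have "x \<noteq> 0" if "x \<ge> R" for x using that assms by auto
  ultimately show ?thesis unfolding slope_excess_def by (intro continuous_intros) auto
qed

text \<open>Domination by \<open>\<bar>m\<bar> * x powr (1 - d)\<close>. The explicit bound on the
  integral also shows that the tails vanish.\<close>

lemma slope_excess_integrable: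
  assumes d: "d \<ge> 3" and k: "k \<ge> 1" and R: "R > 0" and m: "1 + m * R powr (- real d) > 0"
  shows "slope_excess d k m integrable_on {R..}"
    and "\<bar>integral {R..} (slope_excess d k m)\<bar> \<le> \<bar>m\<bar> * (R powr (2 - real d) / (real d - 2))"
proof -
  have "((\<lambda>x. x powr (1 - real d)) has_integral - (R powr (1 - real d + 1)) / (1 - real d + 1)) {R..}"
    using d R by (intro has_integral_powr_to_inf) auto
  moreover have "- (R powr (1 - real d + 1)) / (1 - real d + 1) = R powr (2 - real d) / (real d - 2)"
    using minus_divide_divide[of "R powr (2 - real d)" "2 - real d"] by simp
  ultimately have "((\<lambda>x. x powr (1 - real d)) has_integral R powr (2 - real d) / (real d - 2)) {R..}" by simp
  then have I: "((\<lambda>x. \<bar>m\<bar> * x powr (1 - real d)) has_integral \<bar>m\<bar> * (R powr (2 - real d) / (real d - 2))) {R..}"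
    by (rule has_integral_mult_right)
  have b: "norm (slope_excess d k m x) \<le> \<bar>m\<bar> * x powr (1 - real d)" if "x \<in> {R..}" for x
  proof -
    have "x > 0" "1 + m * x powr (- real d) > 0" using that R base_pos_mono[OF R _ m, of x] by auto
    from slope_excess_bound[OF this k] show ?thesis by simp
  qed
  have meas: "slope_excess d k m \<in> borel_measurable (lebesgue_on {R..})"
    by (intro continuous_imp_measurable_on_sets_lebesgue slope_excess_continuous R m) auto
  show "slope_excess d k m integrable_on {R..}"
    by (rule measurable_bounded_by_integrable_imp_integrable[OF meas has_integral_integrable[OF I] b]) auto
  show "\<bar>integral {R..} (slope_excess d k m)\<bar> \<le> \<bar>m\<bar> * (R powr (2 - real d) / (real d - 2))"
    using integral_norm_bound_integral'[OF b meas _ I] by auto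
qed

lemma slope_excess_integral_split:
  assumes d: "d \<ge> 3" and k: "k \<ge> 1" and R: "R > 0" and m: "1 + m * R powr (- real d) > 0" and y: "R \<le> y"
  shows "integral {R..} (slope_excess d k m) = integral {R..y} (slope_excess d k m) + integral {y..} (slope_excess d k m)"
proof -
  have y0: "y > 0" using R y by simp
  have m': "1 + m * y powr (- real d) > 0" by (rule base_pos_mono[OF R y m]) simp
  have "slope_excess d k m integrable_on {R..y}"
    by (rule integrable_continuous_interval[OF continuous_on_subset[OF slope_excess_continuous[OF R m]]]) auto
  moreover have "{R..} = {R..y} \<union> {y..}" using y by auto
  moreover have "{R..y} \<inter> {y..} = {y}" using y by auto
  ultimately show ?thesis using slope_excess_integrable(1)[OF d k y0 m'] by simp
qed

lemma slope_excess_integral_limit: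
  assumes d: "d \<ge> 3" and k: "k \<ge> 1" and R: "R > 0" and m: "1 + m * R powr (- real d) > 0"
  shows "((\<lambda>y. integral {R..y} (slope_excess d k m)) \<longlongrightarrow> integral {R..} (slope_excess d k m)) at_top"
proof (rule Lim_transform2[where f = "\<lambda>_. integral {R..} (slope_excess d k m)"])
  have "((\<lambda>y. \<bar>m\<bar> * (y powr (2 - real d) / (real d - 2))) \<longlongrightarrow> \<bar>m\<bar> * (0 / (real d - 2))) at_top"
    using d by (intro tendsto_intros tendsto_neg_powr filterlim_ident) auto
  then have lim: "((\<lambda>y. \<bar>m\<bar> * (y powr (2 - real d) / (real d - 2))) \<longlongrightarrow> 0) at_top" by simp
  have "\<forall>\<^sub>F y in at_top. norm (integral {R..} (slope_excess d k m) - integral {R..y} (slope_excess d k m)) \<le> \<bar>m\<bar> * (y powr (2 - real d) / (real d - 2))"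
    using eventually_ge_at_top[of R]
  proof eventually_elim
    case (elim y)
    then have "y > 0" "1 + m * y powr (- real d) > 0" using R base_pos_mono[OF R elim m] by auto
    then show ?case using slope_excess_integral_split[OF d k R m elim] slope_excess_integrable(2)[OF d k, of y m] by simp
  qed
  then show "((\<lambda>y. integral {R..} (slope_excess d k m) - integral {R..y} (slope_excess d k m)) \<longlongrightarrow> 0) at_top"
    using lim by (rule Lim_null_comparison)
qed (rule tendsto_const)

lemma Phi_nonpos:
  assumes d: "d \<ge> 3" and k: "k \<ge> 1" and m: "-1 < m" "m \<le> 0"
  shows "Phi d k m \<le> 0"
proof -
  have m1: "1 + m * 1 powr (- real d) > 0" using m by simp
  have "slope_excess d k m x \<le> 0" if "x \<in> {1..}" for x
  proof -
    have "1 + m * x powr (- real d) > 0" using base_pos_mono[OF _ _ m1, of x] that by simp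
    moreover have "m * x powr (- real d) \<le> 0" using m(2) by (simp add: mult_nonpos_nonneg)
    ultimately have "(1 + m * x powr (- real d)) powr (1 / real k) \<le> 1"
      using k by (intro powr_one_plus_bound(3)) auto
    then show ?thesis using that by (simp add: slope_excess_def mult_nonneg_nonpos)
  qed
  then have "Phi d k m \<le> integral {1..} (\<lambda>x::real. 0)"
    unfolding Phi_def using slope_excess_integrable(1)[OF d k zero_less_one m1]
    by (intro integral_le) (auto intro: integrable_0)
  then show ?thesis by simp
qed

section \<open>Concavity and continuity in the parameter\<close>

lemma minus_powr_convex:
  fixes p :: real
  assumes "0 \<le> p" "p \<le> 1"
  shows "convex_on {0<..} (\<lambda>x. - (x powr p))"
proof (rule f''_ge0_imp_convex)
  fix x :: real assume x: "x \<in> {0<..}"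
  then show "((\<lambda>x. - (x powr p)) has_real_derivative - (p * x powr (p - 1))) (at x)"
    by (auto intro!: derivative_eq_intros)
  show "((\<lambda>x. - (p * x powr (p - 1))) has_real_derivative - (p * ((p - 1) * x powr (p - 1 - 1)))) (at x)"
    using x by (auto intro!: derivative_eq_intros)
  show "- (p * ((p - 1) * x powr (p - 1 - 1))) \<ge> 0"
    using assms by (simp add: mult_nonneg_nonpos mult_nonpos_nonneg)
qed simp

lemma slope_excess_concave:
  assumes k: "k \<ge> 1" and t: "0 \<le> t" "t \<le> 1" and x: "x > 0"
    and m: "1 + m1 * x powr (- real d) > 0" "1 + m2 * x powr (- real d) > 0"
  shows "(1 - t) * slope_excess d k m1 x + t * slope_excess d k m2 x \<le> slope_excess d k ((1 - t) * m1 + t * m2) x"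
proof -
  let ?y = "x powr (- real d)"
  have p: "0 \<le> 1 / real k" "1 / real k \<le> 1" using k by auto
  have "- (((1 - t) * (1 + m1 * ?y) + t * (1 + m2 * ?y)) powr (1 / real k))
      \<le> (1 - t) * - ((1 + m1 * ?y) powr (1 / real k)) + t * - ((1 + m2 * ?y) powr (1 / real k))"
    using convex_onD[OF minus_powr_convex[OF p], of t "1 + m1 * ?y" "1 + m2 * ?y"] t m by simp
  moreover have "(1 - t) * (1 + m1 * ?y) + t * (1 + m2 * ?y) = 1 + ((1 - t) * m1 + t * m2) * ?y"
    by (simp add: algebra_simps)
  ultimately have "(1 - t) * ((1 + m1 * ?y) powr (1 / real k) - 1) + t * ((1 + m2 * ?y) powr (1 / real k) - 1)
     \<le> (1 + ((1 - t) * m1 + t * m2) * ?y) powr (1 / real k) - 1" by (simp add: algebra_simps)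
  then have "x * ((1 - t) * ((1 + m1 * ?y) powr (1 / real k) - 1) + t * ((1 + m2 * ?y) powr (1 / real k) - 1))
     \<le> x * ((1 + ((1 - t) * m1 + t * m2) * ?y) powr (1 / real k) - 1)"
    using x by (intro mult_left_mono) auto
  then show ?thesis by (simp add: slope_excess_def algebra_simps)
qed

text \<open>The integrand is concave in \<open>m\<close> because the exponent \<open>1 / k\<close>
  is at most 1. Hence \<open>Phi\<close> is concave and finite on an open half-line, and therefore
  continuous.\<close>

lemma Phi_continuous:
  assumes d: "d \<ge> 3" and k: "k \<ge> 1"
  shows "continuous_on {-1<..} (Phi d k)"
proof -
  have "convex_on {-1<..} (\<lambda>m. - Phi d k m)"
  proof (rule convex_onI)
    fix t m1 m2 :: real assume t: "0 < t" "t < 1" and m: "m1 \<in> {-1<..}" "m2 \<in> {-1<..}"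
    let ?m = "(1 - t) * m1 + t * m2"
    have "?m > -1"
    proof -
      have "m1 + 1 > 0" "m2 + 1 > 0" "1 - t > 0" using m t by auto
      then have "(1 - t) * (m1 + 1) > 0" "t * (m2 + 1) > 0" using t(1) by (metis mult_pos_pos)+
      then have "(1 - t) * (m1 + 1) + t * (m2 + 1) > 0" by simp
      then show ?thesis by (simp add: algebra_simps)
    qed
    then have pos: "1 + m1 * 1 powr (- real d) > 0" "1 + m2 * 1 powr (- real d) > 0" "1 + ?m * 1 powr (- real d) > 0"
      using m by auto
    note int = slope_excess_integrable(1)[OF d k zero_less_one pos(1)] slope_excess_integrable(1)[OF d k zero_less_one pos(2)]
      slope_excess_integrable(1)[OF d k zero_less_one pos(3)]
    have "(1 - t) * Phi d k m1 + t * Phi d k m2 = integral {1..} (\<lambda>x. (1 - t) * slope_excess d k m1 x + t * slope_excess d k m2 x)"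
      unfolding Phi_def using int by (simp add: integral_add integrable_on_mult_right)
    also have "\<dots> \<le> Phi d k ?m"
      unfolding Phi_def
    proof (rule integral_le)
      fix x :: real assume "x \<in> {1..}"
      then show "(1 - t) * slope_excess d k m1 x + t * slope_excess d k m2 x \<le> slope_excess d k ?m x"
        using t base_pos_mono[OF _ _ pos(1), of x] base_pos_mono[OF _ _ pos(2), of x] by (intro slope_excess_concave k) auto
    qed (use int in \<open>auto intro!: integrable_add integrable_on_mult_right\<close>)
    finally show "- Phi d k ((1 - t) *\<^sub>R m1 + t *\<^sub>R m2) \<le> (1 - t) * - Phi d k m1 + t * - Phi d k m2" by simp
  qed simp
  then have "continuous_on {-1<..} (\<lambda>m. - Phi d k m)" by (intro convex_on_continuous) auto
  from continuous_on_minus[OF this] show ?thesis by simp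
qed

lemma radius_const_continuous:
  assumes d: "d \<ge> 3" and k: "k \<ge> 1"
  shows "continuous_on {0<..} (radius_const d k)"
  unfolding radius_const_def
  by (intro continuous_intros continuous_on_compose2[OF Phi_continuous[OF d k]]) (auto intro: continuous_intros)

text \<open>For \<open>R \<ge> 1\<close> the parameter \<open>1 / R ^ k - 1\<close> lies in the
  range where \<open>Phi\<close> is not positive. The bound shows that the constants are unbounded
  below, so that every sufficiently small \<open>c\<close> is reached.\<close>

lemma radius_const_upper:
  assumes d: "d \<ge> 3" and k: "k \<ge> 1" and R: "R \<ge> 1"
  shows "radius_const d k R \<le> - R\<^sup>2 / 2"
proof -
  have "R ^ k \<ge> 1" using R by simp
  then have "Phi d k (1 / R ^ k - 1) \<le> 0" by (intro Phi_nonpos d k) (auto simp: field_simps)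
  then have "R\<^sup>2 * Phi d k (1 / R ^ k - 1) \<le> 0" by (simp add: mult_nonneg_nonpos)
  then show ?thesis by (simp add: radius_const_def algebra_simps)
qed

section \<open>Profiles as functions of the squared distance\<close>

definition psi :: "nat \<Rightarrow> nat \<Rightarrow> real \<Rightarrow> real \<Rightarrow> real" where
  "psi d k m s = (1 + m * s powr (- (real d / 2))) powr (1 / real k)"

text \<open>The variable \<open>s\<close> is the squared distance from the centre divided by the
  squared radius, so the sphere is \<open>s = 1\<close> and the radial function is
  \<open>r\<^sup>2 * G s\<close>. The factor 1/2 makes its gradient \<open>psi\<close> times
  \<open>x + b\<close>; \<open>psi\<close> is thus the tangential eigenvalue of the Hessian. Taking
  \<open>s0 < 1\<close> gives smoothness across the sphere.\<close>

locale profile =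
  fixes d k :: nat and m s0 :: real and G :: "real \<Rightarrow> real"
  assumes d: "3 \<le> d" and k: "1 \<le> k" "k \<le> d" and s0: "0 < s0" "s0 < 1"
    and base_pos: "s \<ge> s0 \<Longrightarrow> 1 + m * s powr (- (real d / 2)) > 0"
    and G_1: "G 1 = 0" and G_deriv: "s > s0 \<Longrightarrow> (G has_real_derivative psi d k m s / 2) (at s)"

lemma profile_exists:
  assumes d: "3 \<le> d" and k: "1 \<le> k" "k \<le> d" and m: "m > -1"
  obtains s0 G where "profile d k m s0 G"
proof -
  have "\<exists>s0. 0 < s0 \<and> s0 < 1 \<and> 1 + m * s0 powr (- (real d / 2)) > 0"
  proof (cases "m \<ge> 0")
    case True
    then show ?thesis by (intro exI[of _ "1/2"]) (auto intro!: add_pos_nonneg)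
  next
    case False
    \<comment> \<open>Chosen so that \<open>?s powr (- (d / 2))\<close> is
      \<open>2 / (1 - m)\<close>, which turns the base into
      \<open>(1 + m) / (1 - m) > 0\<close>.\<close>
    let ?s = "((1 - m) / 2) powr (2 / real d)"
    have "?s powr (- (real d / 2)) = ((1 - m) / 2) powr (- 1)" using d by (simp add: powr_powr)
    also have "\<dots> = 2 / (1 - m)" using False by (simp add: powr_minus)
    finally have "1 + m * ?s powr (- (real d / 2)) = 1 + m * (2 / (1 - m))" by (simp only:)
    also have "\<dots> = (1 + m) / (1 - m)" using False by (simp add: field_simps)
    finally have "1 + m * ?s powr (- (real d / 2)) = (1 + m) / (1 - m)" .
    moreover have "(1 + m) / (1 - m) > 0" using False m by simp
    moreover have "?s < 1 powr (2 / real d)" using False m d by (intro powr_less_mono2) auto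
    ultimately show ?thesis using False by (intro exI[of _ ?s]) auto
  qed
  then obtain s0 where s0: "0 < s0" "s0 < 1" "1 + m * s0 powr (- (real d / 2)) > 0" by blast
  have bp: "1 + m * s powr (- (real d / 2)) > 0" if "s \<ge> s0" for s
    using base_pos_mono[OF s0(1) that s0(3)] by simp
  define F where "F s = integral {s0..s} (\<lambda>s. psi d k m s / 2)" for s
  have "1 + m * s powr (- (real d / 2)) \<noteq> 0" if "s \<ge> s0" for s
    using bp[OF that] by simp
  then have cont: "continuous_on {s0..b} (\<lambda>s. psi d k m s / 2)" for b
    unfolding psi_def using s0(1) by (intro continuous_intros) auto
  have "(F has_real_derivative psi d k m s / 2) (at s)" if "s > s0" for s
  proof -
    have "(F has_real_derivative psi d k m s / 2) (at s within {s0..s+1})"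
      unfolding F_def using cont that by (intro integral_has_real_derivative) auto
    moreover have "at s within {s0..s+1} = at s" using that by (intro at_within_interior) (auto simp: interior_atLeastAtMost_real)
    ultimately show ?thesis by simp
  qed
  then have "((\<lambda>s. F s - F 1) has_real_derivative psi d k m s / 2) (at s)" if "s > s0" for s
    using that by (auto intro!: derivative_eq_intros)
  then have "profile d k m s0 (\<lambda>s. F s - F 1)"
    using d k s0 bp by unfold_locales auto
  then show thesis by (rule that)
qed

text \<open>The origin of the parameter \<open>1 / R ^ k - 1\<close>: on the sphere the gradient is
  \<open>psi\<close> times a vector of length \<open>R\<close>, so the value \<open>1 / R\<close> is
  the Neumann condition.\<close>

lemma psi_at_1:
  assumes R: "R > 0" and k: "1 \<le> k"
  shows "psi d k (1 / R ^ k - 1) 1 = 1 / R"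
proof -
  have i0: "1 / R > 0" using R by simp
  have "psi d k (1 / R ^ k - 1) 1 = ((1 / R) ^ k) powr (1 / real k)"
    by (simp add: psi_def power_one_over)
  also have "(1 / R) ^ k = (1 / R) powr real k" by (rule powr_realpow[OF i0, symmetric])
  also have "((1 / R) powr real k) powr (1 / real k) = 1 / R" using i0 k by (simp add: powr_powr)
  finally show ?thesis .
qed

text \<open>Translates supercriticality into positivity of the radial eigenvalue of the Hessian on
  the sphere, the form in which strict convexity of the radial solution is used.\<close>

lemma supercritical_slope:
  fixes R :: real
  assumes R: "R > 0" and sup: "real d - real k < real d * R ^ k"
  shows "(real d - real k) * (1 / R ^ k - 1) < real k"
proof -
  have "(real d - real k) / R ^ k < real d" using sup R by (simp add: field_simps)
  moreover have "(real d - real k) * (1 / R ^ k - 1) = (real d - real k) / R ^ k - (real d - real k)"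
    by (simp add: right_diff_distrib)
  ultimately show ?thesis by linarith
qed

context profile
begin

lemma m_gt: "m > -1"
  using base_pos[of 1] s0 by simp

lemma psi_pos: "s \<ge> s0 \<Longrightarrow> psi d k m s > 0"
  using base_pos[of s] by (simp add: psi_def)

lemma psi_pow: "s \<ge> s0 \<Longrightarrow> psi d k m s ^ k = 1 + m * s powr (- (real d / 2))"
  using base_pos[of s] k by (simp add: psi_def powr_realpow[symmetric] powr_powr)

lemma profile_square_deriv:
  assumes R: "R > 0" and r: "r \<ge> R"
  shows "((\<lambda>r. R\<^sup>2 * G ((r / R)\<^sup>2)) has_real_derivative r * (1 + (m * R ^ d) / r ^ d) powr (1 / real k)) (at r)"
proof -
  have r0: "r > 0" using assms by simp
  have ge1: "r / R \<ge> 1" using assms by simp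
  then have "(r / R)\<^sup>2 \<ge> 1" by (simp add: one_le_power)
  then have s: "(r / R)\<^sup>2 > s0" using s0 by simp
  have "((\<lambda>r. (r / R)\<^sup>2) has_real_derivative 2 * r / R\<^sup>2) (at r)"
    using R by (auto intro!: derivative_eq_intros simp: power2_eq_square)
  from DERIV_chain2[OF G_deriv[OF s] this]
  have "((\<lambda>r. R\<^sup>2 * G ((r / R)\<^sup>2)) has_real_derivative R\<^sup>2 * (psi d k m ((r / R)\<^sup>2) / 2 * (2 * r / R\<^sup>2))) (at r)"
    by (rule DERIV_cmult)
  moreover have "R\<^sup>2 * (psi d k m ((r / R)\<^sup>2) / 2 * (2 * r / R\<^sup>2)) = r * psi d k m ((r / R)\<^sup>2)"
    using R by (simp add: field_simps)
  moreover have "((r / R)\<^sup>2) powr (- (real d / 2)) = R ^ d / r ^ d"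
  proof -
    have "((r / R)\<^sup>2) powr (- (real d / 2)) = ((r / R) powr 2) powr (- (real d / 2))"
      using r0 R by (simp add: powr_numeral)
    also have "\<dots> = (r / R) powr (- real d)" by (simp add: powr_powr)
    also have "\<dots> = R ^ d / r ^ d" using r0 R by (simp add: powr_minus powr_realpow power_divide)
    finally show ?thesis .
  qed
  ultimately show ?thesis by (simp add: psi_def)
qed

text \<open>For radius 1 the fundamental theorem of calculus expresses the difference as an integral
  of \<open>slope_excess\<close> starting at the sphere, where \<open>- 1/2\<close> is its initial
  value. The general case is the substitution \<open>r / R\<close>.\<close>

lemma profile_square_limit:
  assumes R: "R > 0"
  shows "((\<lambda>r. R\<^sup>2 * G ((r / R)\<^sup>2) - r\<^sup>2 / 2) \<longlongrightarrow> R\<^sup>2 * (- 1/2 + Phi d k m)) at_top"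
proof -
  have m1: "1 + m * 1 powr (- real d) > 0" using m_gt by simp
  have eq: "G (r\<^sup>2) - r\<^sup>2 / 2 = - 1/2 + integral {1..r} (slope_excess d k m)" if "r \<ge> 1" for r
  proof -
    have "(slope_excess d k m has_integral (G (r\<^sup>2) - r\<^sup>2 / 2) - (G (1\<^sup>2) - 1\<^sup>2 / 2)) {1..r}"
    proof (rule fundamental_theorem_of_calculus[OF that])
      fix x assume x: "x \<in> {1..r}"
      have "((\<lambda>r. 1\<^sup>2 * G ((r / 1)\<^sup>2) - r\<^sup>2 / 2) has_real_derivative x * (1 + (m * 1 ^ d) / x ^ d) powr (1 / real k) - 2 * x / 2) (at x)"
        using x by (intro DERIV_diff profile_square_deriv) (auto intro!: derivative_eq_intros)
      moreover have "x * (1 + (m * 1 ^ d) / x ^ d) powr (1 / real k) - 2 * x / 2 = slope_excess d k m x"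
        using x by (simp add: slope_excess_altdef)
      ultimately show "((\<lambda>r. G (r\<^sup>2) - r\<^sup>2 / 2) has_vector_derivative slope_excess d k m x) (at x within {1..r})"
        by (auto simp: has_real_derivative_iff_has_vector_derivative[symmetric] intro: has_field_derivative_at_within)
    qed
    then show ?thesis using G_1 by (simp add: integral_unique)
  qed
  have "((\<lambda>r. - 1/2 + integral {1..r} (slope_excess d k m)) \<longlongrightarrow> - 1/2 + Phi d k m) at_top"
    unfolding Phi_def using k d by (intro tendsto_intros slope_excess_integral_limit m1) auto
  then have "((\<lambda>r. G (r\<^sup>2) - r\<^sup>2 / 2) \<longlongrightarrow> - 1/2 + Phi d k m) at_top"
  proof (rule Lim_transform_eventually)
    show "\<forall>\<^sub>F r in at_top. - 1/2 + integral {1..r} (slope_excess d k m) = G (r\<^sup>2) - r\<^sup>2 / 2"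
      using eventually_ge_at_top[of 1] by eventually_elim (simp add: eq)
  qed
  moreover have "filterlim (\<lambda>r. r / R) at_top at_top"
    using R filterlim_tendsto_pos_mult_at_top[OF tendsto_const[of "1/R"] _ filterlim_ident] by simp
  ultimately have "((\<lambda>r. G ((r / R)\<^sup>2) - (r / R)\<^sup>2 / 2) \<longlongrightarrow> - 1/2 + Phi d k m) at_top"
    by (rule filterlim_compose)
  then have "((\<lambda>r. R\<^sup>2 * (G ((r / R)\<^sup>2) - (r / R)\<^sup>2 / 2)) \<longlongrightarrow> R\<^sup>2 * (- 1/2 + Phi d k m)) at_top"
    by (intro tendsto_intros)
  then show ?thesis using R by (simp add: right_diff_distrib power_divide)
qed

lemma profile_square_R: "R > 0 \<Longrightarrow> R\<^sup>2 * G ((R / R)\<^sup>2) = 0"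
  by (simp add: G_1)

end

text \<open>In unscaled form the slope of the radial solution is
  \<open>r * (1 + a / r ^ d) powr (1 / k)\<close> with \<open>a = R ^ (d - k) - R ^ d\<close>. The
  derivative of \<open>a\<close> in \<open>R\<close> changes sign exactly at the critical radius,
  beyond which a larger ball means a smaller slope.\<close>

lemma power_difference_antimono:
  fixes R1 R2 :: real
  assumes k: "1 \<le> k" "k \<le> d" and R: "0 < R1" "R1 \<le> R2" and c: "real d - real k \<le> real d * R1 ^ k"
  shows "R2 ^ (d - k) - R2 ^ d \<le> R1 ^ (d - k) - R1 ^ d"
proof (rule DERIV_nonpos_imp_nonincreasing[where f = "\<lambda>R. R ^ (d - k) - R ^ d", OF R(2)])
  fix x assume x: "R1 \<le> x" "x \<le> R2"
  have x0: "x > 0" using x R by simp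
  have "((\<lambda>R. R ^ (d - k) - R ^ d) has_real_derivative real (d - k) * x ^ (d - k - 1) - real d * x ^ (d - 1)) (at x)"
    by (auto intro!: derivative_eq_intros)
  moreover have "real (d - k) * x ^ (d - k - 1) - real d * x ^ (d - 1) \<le> 0"
  proof (cases "k = d")
    case False
    have "R1 ^ k \<le> x ^ k" using x R by (intro power_mono) auto
    then have "real d * R1 ^ k \<le> real d * x ^ k" by (intro mult_left_mono) auto
    moreover have "real (d - k) = real d - real k" using k by (simp add: of_nat_diff)
    ultimately have "real (d - k) \<le> real d * x ^ k" using c by linarith
    then have "real (d - k) * x ^ (d - k - 1) \<le> real d * x ^ k * x ^ (d - k - 1)"
      using x0 by (intro mult_right_mono) auto
    also have "\<dots> = real d * x ^ (d - 1)"
      using False k by (simp add: power_add[symmetric] mult.assoc)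
    finally show ?thesis by simp
  qed (use x0 in simp)
  ultimately show "\<exists>y. ((\<lambda>R. R ^ (d - k) - R ^ d) has_real_derivative y) (at x) \<and> y \<le> 0" by blast
qed

lemma scaled_slope_const:
  fixes R :: real
  assumes "R > 0" "k \<le> d"
  shows "(1 / R ^ k - 1) * R ^ d = R ^ (d - k) - R ^ d"
  using assms by (simp add: power_diff left_diff_distrib)

lemma scaled_base_pos:
  fixes R :: real
  assumes R: "R > 0" and k: "k \<le> d" and r: "r \<ge> R"
  shows "1 + (R ^ (d - k) - R ^ d) / r ^ d > 0"
proof -
  have r0: "r > 0" using r R by simp
  have "1 + (1 / R ^ k - 1) * (r / R) powr (- real d) > 0"
  proof (rule base_pos_mono[where R = 1])
    show "1 \<le> r / R" using r R by simp
    have "1 + (1 / R ^ k - 1) * 1 powr (- real d) = 1 / R ^ k" by simp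
    also have "\<dots> > 0" using R by simp
    finally show "1 + (1 / R ^ k - 1) * 1 powr (- real d) > 0" .
  qed simp_all
  moreover have "(r / R) powr (- real d) = R ^ d / r ^ d"
    using r0 R by (simp add: powr_minus powr_realpow power_divide)
  ultimately have "1 + ((1 / R ^ k - 1) * R ^ d) / r ^ d > 0" by simp
  then show ?thesis by (simp only: scaled_slope_const[OF R k])
qed

text \<open>At \<open>R2\<close> the solution of the smaller ball is already positive while the
  other is still 0, and from there on it has the larger slope. The gap therefore persists to
  infinity.\<close>

lemma radius_const_strict_antimono:
  assumes d: "3 \<le> d" and k: "1 \<le> k" "k \<le> d" and R: "0 < R1" "R1 < R2"
    and c: "real d - real k \<le> real d * R1 ^ k"
  shows "radius_const d k R2 < radius_const d k R1"
proof -
  have R2: "R2 > 0" using R by simp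
  have "1 / R1 ^ k - 1 > -1" "1 / R2 ^ k - 1 > -1" using R by auto
  then obtain s1 G1 s2 G2 where P: "profile d k (1 / R1 ^ k - 1) s1 G1" "profile d k (1 / R2 ^ k - 1) s2 G2"
    using profile_exists[OF d k] by metis
  interpret P1: profile d k "1 / R1 ^ k - 1" s1 G1 by (rule P(1))
  interpret P2: profile d k "1 / R2 ^ k - 1" s2 G2 by (rule P(2))
  let ?g1 = "\<lambda>r. R1\<^sup>2 * G1 ((r / R1)\<^sup>2)" and ?g2 = "\<lambda>r. R2\<^sup>2 * G2 ((r / R2)\<^sup>2)"
  let ?a1 = "R1 ^ (d - k) - R1 ^ d" and ?a2 = "R2 ^ (d - k) - R2 ^ d"
  have a: "?a2 \<le> ?a1" by (rule power_difference_antimono) (use assms in auto)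
  have D1: "(?g1 has_real_derivative r * (1 + ?a1 / r ^ d) powr (1 / real k)) (at r)" if "r \<ge> R1" for r
    using P1.profile_square_deriv[OF R(1) that] by (simp add: scaled_slope_const R(1) k)
  have D2: "(?g2 has_real_derivative r * (1 + ?a2 / r ^ d) powr (1 / real k)) (at r)" if "r \<ge> R2" for r
    using P2.profile_square_deriv[OF R2 that] by (simp add: scaled_slope_const R2 k)
  have pos1: "1 + ?a1 / r ^ d > 0" if "r \<ge> R1" for r by (rule scaled_base_pos[OF R(1) k(2) that])
  have pos2: "1 + ?a2 / r ^ d > 0" if "r \<ge> R2" for r by (rule scaled_base_pos[OF R2 k(2) that])
  have "?g1 R1 < ?g1 R2"
  proof (rule DERIV_pos_imp_increasing[OF R(2), where f = ?g1])
    fix r assume r: "R1 \<le> r" "r \<le> R2"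
    then have "r * (1 + ?a1 / r ^ d) powr (1 / real k) > 0" using pos1[of r] R by simp
    then show "\<exists>y. (?g1 has_real_derivative y) (at r) \<and> 0 < y" using D1[of r] r by blast
  qed
  then have g1: "?g1 R2 > 0" using P1.profile_square_R[OF R(1)] by linarith
  have ge: "?g1 R2 \<le> ?g1 r - ?g2 r" if r: "r \<ge> R2" for r
  proof -
    have "?g1 R2 - ?g2 R2 \<le> ?g1 r - ?g2 r"
    proof (rule DERIV_nonneg_imp_nondecreasing[OF r, where f = "\<lambda>r. ?g1 r - ?g2 r"])
      fix x assume x: "R2 \<le> x" "x \<le> r"
      have x0: "x > 0" using x R2 by simp
      have "1 + ?a2 / x ^ d \<le> 1 + ?a1 / x ^ d" using a x0 by (simp add: divide_right_mono)
      then have "(1 + ?a2 / x ^ d) powr (1 / real k) \<le> (1 + ?a1 / x ^ d) powr (1 / real k)"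
        using pos2[OF x(1)] by (intro powr_mono2) auto
      then have "x * (1 + ?a1 / x ^ d) powr (1 / real k) - x * (1 + ?a2 / x ^ d) powr (1 / real k) \<ge> 0"
        using x0 by (simp add: mult_left_mono)
      moreover have "((\<lambda>r. ?g1 r - ?g2 r) has_real_derivative x * (1 + ?a1 / x ^ d) powr (1 / real k) - x * (1 + ?a2 / x ^ d) powr (1 / real k)) (at x)"
        using x R by (intro DERIV_diff D1 D2) auto
      ultimately show "\<exists>y. ((\<lambda>r. ?g1 r - ?g2 r) has_real_derivative y) (at x) \<and> 0 \<le> y" by blast
    qed
    then show ?thesis using P2.profile_square_R[OF R2] by linarith
  qed
  have "((\<lambda>r. (?g1 r - r\<^sup>2 / 2) - (?g2 r - r\<^sup>2 / 2)) \<longlongrightarrow> radius_const d k R1 - radius_const d k R2) at_top"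
    unfolding radius_const_def by (intro tendsto_diff P1.profile_square_limit P2.profile_square_limit R(1) R2)
  moreover have "\<forall>\<^sub>F r in at_top. ?g1 R2 \<le> (?g1 r - r\<^sup>2 / 2) - (?g2 r - r\<^sup>2 / 2)"
    using eventually_ge_at_top[of R2] by eventually_elim (use ge in auto)
  ultimately have "?g1 R2 \<le> radius_const d k R1 - radius_const d k R2"
    by (intro tendsto_lowerbound) auto
  with g1 show ?thesis by linarith
qed

section \<open>The critical radius and \<open>c_star\<close>\<close>

lemma critical_radius:
  assumes k: "1 \<le> k" "k < d"
  defines "Rc \<equiv> ((real d - real k) / real d) powr (1 / real k)"
  shows "Rc > 0" "real d * Rc ^ k = real d - real k" "c_star d k b = radius_const d k Rc + (norm b)\<^sup>2 / 2"
proof -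
  let ?q = "(real d - real k) / real d"
  have q: "?q > 0" using k by simp
  show Rc: "Rc > 0" unfolding Rc_def using k by simp
  have pow: "Rc ^ n = ?q powr (real n / real k)" for n
    using Rc by (simp add: powr_realpow[symmetric] Rc_def powr_powr)
  have Rk: "Rc ^ k = ?q" using pow[of k] q k by simp
  then show "real d * Rc ^ k = real d - real k" using k by simp
  \<comment> \<open>This is the coefficient in the integrand of \<open>c_star\<close>, and
    \<open>Rc\<^sup>2\<close> is the factor in front of the bracket.\<close>
  have "1 / Rc ^ k - 1 = real k / (real d - real k)" unfolding Rk using k by (simp add: field_simps)
  moreover have "Rc\<^sup>2 = ?q powr (2 / real k)" using pow[of 2] by simp
  moreover have "k \<le> d - 1" using k by simp
  ultimately show "c_star d k b = radius_const d k Rc + (norm b)\<^sup>2 / 2"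
    by (simp add: c_star_def radius_const_def Phi_def slope_excess_def[abs_def])
qed

lemma base_pos_top:
  fixes R :: real
  assumes R: "R > 0"
  shows "1 + (1 - R ^ d) * R powr (- real d) > 0"
proof -
  have "1 + (1 - R ^ d) * R powr (- real d) = 1 / R ^ d"
    using R by (simp add: powr_minus powr_realpow divide_inverse left_diff_distrib)
  then show ?thesis using R by simp
qed

text \<open>For \<open>k = d\<close> the unscaled coefficient \<open>R ^ (d - k) - R ^ d\<close> is
  \<open>1 - R ^ d\<close>. Without rescaling, the integrand and its domain become those of
  \<open>c_star\<close> as \<open>R\<close> tends to 0.\<close>

lemma radius_const_top:
  assumes d: "3 \<le> d" and R: "0 < R"
  shows "radius_const d d R = - R\<^sup>2 / 2 + integral {R..} (slope_excess d d (1 - R ^ d))"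
proof -
  have k: "1 \<le> d" "d \<le> d" using d by auto
  have "1 / R ^ d - 1 > -1" using R by simp
  then obtain s1 G where "profile d d (1 / R ^ d - 1) s1 G" using profile_exists[OF d k] by metis
  then interpret profile d d "1 / R ^ d - 1" s1 G .
  let ?g = "\<lambda>r. R\<^sup>2 * G ((r / R)\<^sup>2)"
  have pos: "1 + (1 - R ^ d) * R powr (- real d) > 0"
    by (rule base_pos_top[OF R])
  have eq: "?g r - r\<^sup>2 / 2 = - R\<^sup>2 / 2 + integral {R..r} (slope_excess d d (1 - R ^ d))" if "r \<ge> R" for r
  proof -
    have "(slope_excess d d (1 - R ^ d) has_integral (?g r - r\<^sup>2 / 2) - (?g R - R\<^sup>2 / 2)) {R..r}"
    proof (rule fundamental_theorem_of_calculus[OF that])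
      fix x assume x: "x \<in> {R..r}"
      then have x0: "x > 0" using R by simp
      have "((\<lambda>r. ?g r - r\<^sup>2 / 2) has_real_derivative x * (1 + ((1 / R ^ d - 1) * R ^ d) / x ^ d) powr (1 / real d) - 2 * x / 2) (at x)"
        using x R by (intro DERIV_diff profile_square_deriv) (auto intro!: derivative_eq_intros)
      moreover have "x * (1 + ((1 / R ^ d - 1) * R ^ d) / x ^ d) powr (1 / real d) - 2 * x / 2 = slope_excess d d (1 - R ^ d) x"
        using scaled_slope_const[OF R k(2)] by (simp add: slope_excess_altdef[OF x0])
      ultimately show "((\<lambda>r. ?g r - r\<^sup>2 / 2) has_vector_derivative slope_excess d d (1 - R ^ d) x) (at x within {R..r})"
        by (auto simp: has_real_derivative_iff_has_vector_derivative[symmetric] intro: has_field_derivative_at_within)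
    qed
    then show ?thesis using profile_square_R[OF R] by (simp add: integral_unique)
  qed
  have "((\<lambda>r. - R\<^sup>2 / 2 + integral {R..r} (slope_excess d d (1 - R ^ d))) \<longlongrightarrow> - R\<^sup>2 / 2 + integral {R..} (slope_excess d d (1 - R ^ d))) at_top"
    using k d R by (intro tendsto_intros slope_excess_integral_limit pos) auto
  then have "((\<lambda>r. ?g r - r\<^sup>2 / 2) \<longlongrightarrow> - R\<^sup>2 / 2 + integral {R..} (slope_excess d d (1 - R ^ d))) at_top"
  proof (rule Lim_transform_eventually)
    show "\<forall>\<^sub>F r in at_top. - R\<^sup>2 / 2 + integral {R..r} (slope_excess d d (1 - R ^ d)) = ?g r - r\<^sup>2 / 2"
      using eventually_ge_at_top[of R] by eventually_elim (simp add: eq)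
  qed
  from tendsto_unique[OF _ profile_square_limit[OF R] this] show ?thesis by (simp add: radius_const_def)
qed

text \<open>For k = d the critical radius is 0, and c_star is the limit of the constants as R tends to 0.\<close>
lemma radius_const_top_bounds:
  fixes b :: "real^'n"
  assumes d: "3 \<le> d" and R: "0 < R"
  shows "radius_const d d R + (norm b)\<^sup>2 / 2 < c_star d d b"
    and "R \<le> 1 \<Longrightarrow> radius_const d d R + (norm b)\<^sup>2 / 2 \<ge> c_star d d b - (R ^ d * (c_star d d b - (norm b)\<^sup>2 / 2) + R + R\<^sup>2 / 2)"
proof -
  have k: "1 \<le> d" using d by simp
  let ?h = "slope_excess d d 1"
  let ?J = "integral {0<..} ?h"
  have cs: "c_star d d b = ?J + (norm b)\<^sup>2 / 2"
    using d by (simp add: c_star_def slope_excess_def[abs_def])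
  have pos1: "1 + 1 * r powr (- real d) > 0" for r by (smt (verit) powr_ge_zero)
  \<comment> \<open>Although the base blows up at 0,
    \<open>x * (1 + x powr (- d)) powr (1 / d)\<close> is the \<open>d\<close>-th root of
    \<open>x ^ d + 1\<close> and so at most \<open>x + 1\<close>. The part of the integral below
    \<open>R\<close> thus contributes at most \<open>R\<close>.\<close>
  have h0: "0 \<le> ?h x" "?h x \<le> 1" if x: "x > 0" for x
  proof -
    have "(1 + 1 * x powr (- real d)) powr (1 / real d) \<ge> 1"
      using k by (intro powr_one_plus_bound(2)) (auto simp: add_pos_nonneg)
    then show "0 \<le> ?h x" using x by (simp add: slope_excess_def)
    have "x ^ d + 1 ^ d \<le> (x + 1) ^ d"
    proof -
      have "x ^ n + 1 \<le> (x + 1) ^ n" if "n \<ge> 1" for n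
        using that
      proof (induction n rule: dec_induct)
        case (step n)
        have "x ^ Suc n + 1 \<le> (x + 1) * (x ^ n + 1)" using x by (simp add: algebra_simps)
        also have "\<dots> \<le> (x + 1) * (x + 1) ^ n" using step x by (intro mult_left_mono) auto
        finally show ?case by simp
      qed simp
      from this[OF k] show ?thesis by simp
    qed
    then have "(x ^ d + 1) powr (1 / real d) \<le> ((x + 1) ^ d) powr (1 / real d)"
      using x by (intro powr_mono2) auto
    also have "\<dots> = x + 1" using x k by (simp add: powr_realpow[symmetric] powr_powr)
    finally have 1: "(x ^ d + 1) powr (1 / real d) \<le> x + 1" .
    have "x * (1 + 1 * x powr (- real d)) powr (1 / real d) = (x ^ d) powr (1 / real d) * (1 + 1 * x powr (- real d)) powr (1 / real d)"
      using x k by (simp add: powr_realpow[symmetric] powr_powr)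
    also have "\<dots> = (x ^ d * (1 + 1 * x powr (- real d))) powr (1 / real d)"
      using x by (intro powr_mult[symmetric])
    also have "x ^ d * (1 + 1 * x powr (- real d)) = x ^ d + 1"
      using x by (simp add: powr_minus powr_realpow algebra_simps)
    finally show "?h x \<le> 1" using 1 by (simp add: slope_excess_def algebra_simps)
  qed
  have "?h integrable_on {0<..R} \<and> integral {0<..R} ?h \<le> R \<and> integral {0<..R} ?h \<ge> 0"
  proof (intro conjI)
    have cont: "continuous_on {0<..R} ?h"
    proof -
      have "1 + 1 * x powr (- real d) \<noteq> 0" for x using pos1[of x] by simp
      then show ?thesis unfolding slope_excess_def by (intro continuous_intros) auto
    qed
    have c1: "((\<lambda>x. 1) has_integral R) {0<..R}"
    proof -
      have "((\<lambda>x. 1::real) has_integral R) {0..R}" using has_integral_const_real[of "1::real" 0 R] R by simp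
      then show ?thesis
        by (subst has_integral_spike_set_eq[of "{0<..R}" "{0..R}"]) (auto intro: negligible_subset[of "{0::real}"])
    qed
    show int: "?h integrable_on {0<..R}"
    proof (rule measurable_bounded_by_integrable_imp_integrable[OF _ has_integral_integrable[OF c1]])
      show "?h \<in> borel_measurable (lebesgue_on {0<..R})"
        by (intro continuous_imp_measurable_on_sets_lebesgue cont) auto
    qed (use h0 in auto)
    have "integral {0<..R} ?h \<le> integral {0<..R} (\<lambda>x. 1)"
      using int c1 h0 by (intro integral_le) auto
    then show "integral {0<..R} ?h \<le> R" using c1 by (simp add: integral_unique)
    show "integral {0<..R} ?h \<ge> 0" using int h0 by (intro integral_nonneg) auto
  qed
  note I0 = this
  have I1: "?h integrable_on {R..}" by (rule slope_excess_integrable(1)[OF d k R pos1])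
  define Q where "Q = integral {R..} ?h"
  have J: "?J = integral {0<..R} ?h + Q"
  proof -
    have "{0<..} = {0<..R} \<union> {R..}" "{0<..R} \<inter> {R..} = {R}" using R by auto
    then show ?thesis using I0 I1 by (simp add: Q_def)
  qed
  have posR: "1 + (1 - R ^ d) * R powr (- real d) > 0"
    by (rule base_pos_top[OF R])
  have IR: "slope_excess d d (1 - R ^ d) integrable_on {R..}" by (rule slope_excess_integrable(1)[OF d k R posR])
  have "integral {R..} (slope_excess d d (1 - R ^ d)) \<le> Q"
    unfolding Q_def
  proof (rule integral_le[OF IR I1])
    fix x assume x: "x \<in> {R..}"
    then have x0: "x > 0" using R by simp
    have "1 + (1 - R ^ d) * x powr (- real d) > 0" using x by (intro base_pos_mono[OF R _ posR]) auto
    moreover have "(1 - R ^ d) * x powr (- real d) \<le> 1 * x powr (- real d)"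
      using R by (intro mult_right_mono) auto
    ultimately have "(1 + (1 - R ^ d) * x powr (- real d)) powr (1 / real d) \<le> (1 + 1 * x powr (- real d)) powr (1 / real d)"
      by (intro powr_mono2) auto
    then show "slope_excess d d (1 - R ^ d) x \<le> ?h x" using x0 unfolding slope_excess_def by (intro mult_left_mono) auto
  qed
  then have "radius_const d d R \<le> - R\<^sup>2 / 2 + ?J" using radius_const_top[OF d R] J I0 by linarith
  moreover have "R\<^sup>2 > 0" using R by simp
  ultimately show "radius_const d d R + (norm b)\<^sup>2 / 2 < c_star d d b" unfolding cs by linarith
  assume R1: "R \<le> 1"
  then have Rd: "0 \<le> R ^ d" "R ^ d \<le> 1" using R by (auto simp: power_le_one)
  \<comment> \<open>Lower bound by concavity in the parameter, between 0, where the excess vanishes,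
    and 1.\<close>
  have "(1 - R ^ d) * Q = integral {R..} (\<lambda>x. (1 - R ^ d) * ?h x)" by (simp add: Q_def)
  also have "\<dots> \<le> integral {R..} (slope_excess d d (1 - R ^ d))"
  proof (rule integral_le[OF _ IR])
    show "(\<lambda>x. (1 - R ^ d) * ?h x) integrable_on {R..}" using I1 by (rule integrable_on_mult_right)
    fix x assume x: "x \<in> {R..}"
    then have x0: "x > 0" using R by simp
    have "(1 - (1 - R ^ d)) * slope_excess d d 0 x + (1 - R ^ d) * slope_excess d d 1 x \<le> slope_excess d d ((1 - (1 - R ^ d)) * 0 + (1 - R ^ d) * 1) x"
      using Rd x0 pos1 by (intro slope_excess_concave k) auto
    then show "(1 - R ^ d) * ?h x \<le> slope_excess d d (1 - R ^ d) x" by (simp add: slope_excess_def[of d d 0])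
  qed
  finally have "radius_const d d R \<ge> - R\<^sup>2 / 2 + (1 - R ^ d) * Q" using radius_const_top[OF d R] by simp
  moreover have "(1 - R ^ d) * Q \<ge> (1 - R ^ d) * (?J - R)" using J I0 Rd by (intro mult_left_mono) auto
  moreover have "(1 - R ^ d) * (?J - R) = ?J - R ^ d * ?J - R + R ^ d * R" by (simp add: algebra_simps)
  moreover have "R ^ d * R \<ge> 0" using Rd R by simp
  ultimately show "radius_const d d R + (norm b)\<^sup>2 / 2 \<ge> c_star d d b - (R ^ d * (c_star d d b - (norm b)\<^sup>2 / 2) + R + R\<^sup>2 / 2)"
    unfolding cs by simp
qed

lemma radius_const_less_c_star:
  fixes b :: "real^'n"
  assumes d: "3 \<le> d" and k: "1 \<le> k" "k \<le> d" and R: "R > 0" and c: "real d - real k < real d * R ^ k"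
  shows "radius_const d k R + (norm b)\<^sup>2 / 2 < c_star d k b"
proof (cases "k = d")
  case True
  then show ?thesis using radius_const_top_bounds(1)[OF d R] by simp
next
  case False
  then have k': "k < d" using k by simp
  let ?Rc = "((real d - real k) / real d) powr (1 / real k)"
  note Rc = critical_radius(1,2)[OF k(1) k'] critical_radius(3)[OF k(1) k', where b = b]
  have "real d * ?Rc ^ k < real d * R ^ k" using Rc(2) c by simp
  then have "?Rc ^ k < R ^ k" using d by simp
  then have "?Rc < R" using R by (simp add: power_less_imp_less_base)
  then show ?thesis using radius_const_strict_antimono[OF d k Rc(1), of R] Rc(2,3) by simp
qed

text \<open>Intermediate values between a radius whose constant exceeds the target and a large one.
  The first is the critical radius if \<open>k < d\<close> and a radius close to 0 if
  \<open>k = d\<close>.\<close>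

lemma radius_const_surj:
  fixes b :: "real^'n"
  assumes d: "3 \<le> d" and k: "1 \<le> k" "k \<le> d" and c: "c < c_star d k b"
  obtains R where "R > 0" "real d - real k < real d * R ^ k" "radius_const d k R + (norm b)\<^sup>2 / 2 = c"
proof -
  let ?c = "c - (norm b)\<^sup>2 / 2"
  have "\<exists>R1>0. real d - real k \<le> real d * R1 ^ k \<and> ?c < radius_const d k R1"
  proof (cases "k = d")
    case False
    then have k': "k < d" using k by simp
    let ?Rc = "((real d - real k) / real d) powr (1 / real k)"
    note Rc = critical_radius(1,2)[OF k(1) k'] critical_radius(3)[OF k(1) k', where b = b]
    show ?thesis using Rc c by (intro exI[of _ ?Rc]) auto
  next
    case True
    let ?J = "c_star d d b - (norm b)\<^sup>2 / 2"
    have *: "((\<lambda>R::real. R ^ d * ?J + R + R\<^sup>2 / 2) \<longlongrightarrow> 0 ^ d * ?J + 0 + 0\<^sup>2 / 2) (at_right 0)"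
      by (intro tendsto_intros) auto
    then have "((\<lambda>R::real. R ^ d * ?J + R + R\<^sup>2 / 2) \<longlongrightarrow> 0) (at_right 0)"
    proof -
      have zd: "(0::real) ^ d = 0" using d by simp
      show ?thesis using * unfolding zd by simp
    qed
    moreover have "c_star d d b - c > 0" using c True by simp
    ultimately have "\<forall>\<^sub>F R in at_right 0. R ^ d * ?J + R + R\<^sup>2 / 2 < c_star d d b - c"
      by (rule order_tendstoD)
    moreover have "\<forall>\<^sub>F R::real in at_right 0. R \<in> {0<..<1}" by (rule eventually_at_right_real) simp
    ultimately have "\<forall>\<^sub>F R in at_right 0. R ^ d * ?J + R + R\<^sup>2 / 2 < c_star d d b - c \<and> R \<in> {0<..<1}"
      by (rule eventually_conj)
    then obtain R where R: "R ^ d * ?J + R + R\<^sup>2 / 2 < c_star d d b - c" "0 < R" "R < 1"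
      using eventually_happens'[of "at_right (0::real)"] by (auto simp: trivial_limit_at_right_real)
    then have "?c < radius_const d k R" using radius_const_top_bounds(2)[OF d R(2), of b] True by simp
    then show ?thesis using R(2) True by (intro exI[of _ R]) auto
  qed
  then obtain R1 where R1: "R1 > 0" "real d - real k \<le> real d * R1 ^ k" "?c < radius_const d k R1" by blast
  \<comment> \<open>Beyond 1 and beyond twice the modulus of the target, so that the upper bound
    \<open>- R2\<^sup>2 / 2\<close> for the constant falls below the target.\<close>
  define R2 where "R2 = max (R1 + 1) (max 1 (2 * \<bar>?c\<bar>)) + 1"
  have R2: "R2 > R1" "R2 \<ge> 1" "R2 > 2 * \<bar>?c\<bar>" by (auto simp: R2_def)
  have "R2 * R2 \<ge> 1 * R2" using R2 by (intro mult_right_mono) auto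
  then have "R2\<^sup>2 \<ge> R2" by (simp add: power2_eq_square)
  moreover have "- y / 2 < c" if "x \<le> y" "2 * \<bar>c\<bar> < x" for x y c :: real
    using that by (simp add: abs_if split: if_splits)
  ultimately have "- R2\<^sup>2 / 2 < ?c" using R2(3) by blast
  then have c2: "radius_const d k R2 \<le> ?c" using radius_const_upper[OF d k(1) R2(2)] by linarith
  have "continuous_on {R1..R2} (radius_const d k)"
    by (rule continuous_on_subset[OF radius_const_continuous[OF d k(1)]]) (use R1 in auto)
  then obtain R where R: "R1 \<le> R" "R \<le> R2" "radius_const d k R = ?c"
    using IVT2'[of "radius_const d k" R2 ?c R1] c2 R1(3) R2(1) by auto
  \<comment> \<open>\<open>R1\<close> may itself be critical; the strict inequality for its constant
    is what makes \<open>R\<close> strictly supercritical.\<close>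
  have "R \<noteq> R1" using R(3) R1(3) by auto
  then have RR: "R1 < R" using R(1) by simp
  then have "R1 ^ k < R ^ k" using R1(1) k by (intro power_strict_mono) auto
  then have "real d - real k < real d * R ^ k"
    using R1(2) d by (smt (verit) mult_strict_left_mono of_nat_0_less_iff zero_less_numeral less_le_trans)
  then show thesis using that[of R] R1(1) RR R(3) by simp
qed

subsection \<open>Radial solutions\<close>

text \<open>Smoothness by a self-reproducing class: if all partial derivatives of members agree on
  \<open>V\<close> with members, so do all iterated ones, by induction on the list of
  indices.\<close>

lemma smooth_on_class:
  fixes P :: "(real^'n::finite \<Rightarrow> real) \<Rightarrow> bool"
  assumes V: "open V" and f: "P f"
    and step: "\<And>f. P f \<Longrightarrow> \<exists>g. (\<forall>i. P (g i)) \<and> (\<forall>x\<in>V. (f has_derivative (\<lambda>h. (\<chi> i. g i x) \<bullet> h)) (at x))"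
  shows "smooth_on V f"
proof -
  have "\<exists>g. P g \<and> (\<forall>x\<in>V. pdl is f x = g x)" for "is"
  proof (induction "is")
    case Nil
    then show ?case using f by auto
  next
    case (Cons i js)
    then obtain g where g: "P g" "\<And>x. x \<in> V \<Longrightarrow> pdl js f x = g x" by auto
    obtain g' where g': "\<And>i. P (g' i)" "\<And>x. x \<in> V \<Longrightarrow> (g has_derivative (\<lambda>h. (\<chi> i. g' i x) \<bullet> h)) (at x)"
      using step[OF g(1)] by blast
    have "pdl (i # js) f x = g' i x" if x: "x \<in> V" for x
    proof -
      have "(pdl js f has_derivative (\<lambda>h. (\<chi> i. g' i x) \<bullet> h)) (at x)"
        using has_derivative_transform_within_open[OF g'(2)[OF x] V x] g(2) by auto
      from has_derivative_imp_grad[OF this] have "grad (pdl js f) x $ i = g' i x" by simp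
      then show ?thesis by (simp add: grad_def)
    qed
    then show ?case using g'(1) by blast
  qed
  then have "pdl is f differentiable_on V" for "is"
  proof -
    obtain g where g: "P g" "\<And>x. x \<in> V \<Longrightarrow> pdl is f x = g x"
      using \<open>\<And>is. \<exists>g. P g \<and> (\<forall>x\<in>V. pdl is f x = g x)\<close> by blast
    obtain g' where g': "\<And>x. x \<in> V \<Longrightarrow> (g has_derivative (\<lambda>h. (\<chi> i. g' i x) \<bullet> h)) (at x)"
      using step[OF g(1)] by blast
    have "pdl is f differentiable (at x within V)" if x: "x \<in> V" for x
    proof -
      have "(pdl is f has_derivative (\<lambda>h. (\<chi> i. g' i x) \<bullet> h)) (at x)"
        using has_derivative_transform_within_open[OF g'[OF x] V x] g(2) by auto
      then show ?thesis using differentiable_at_withinI differentiable_def by blast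
    qed
    then show ?thesis by (simp add: differentiable_on_def)
  qed
  with V show ?thesis by (simp add: smooth_on_def)
qed

lemma quadratic_has_derivative:
  fixes b c :: "real^'n::finite"
  shows "((\<lambda>x. a * ((x + b) \<bullet> (x + b)) + c \<bullet> x + D) has_derivative (\<lambda>h. ((2 * a) *\<^sub>R (x + b) + c) \<bullet> h)) (at x)"
  by (rule has_derivative_eq_rhs, rule derivative_intros, rule derivative_intros, (rule derivative_intros)+)
     (auto simp: fun_eq_iff inner_simps inner_commute algebra_simps)

lemma quadratic_smooth:
  fixes b c :: "real^'n::finite"
  shows "smooth_on UNIV (\<lambda>x. a * ((x + b) \<bullet> (x + b)) + c \<bullet> x + D)"
proof (rule smooth_on_class[where P = "\<lambda>f. \<exists>a c D. f = (\<lambda>x. a * ((x + b) \<bullet> (x + b)) + c \<bullet> x + D)"])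
  fix f :: "real^'n \<Rightarrow> real"
  assume "\<exists>a c D. f = (\<lambda>x. a * ((x + b) \<bullet> (x + b)) + c \<bullet> x + D)"
  then obtain a c D where f: "f = (\<lambda>x. a * ((x + b) \<bullet> (x + b)) + c \<bullet> x + D)" by blast
  let ?g = "\<lambda>i x. 0 * ((x + b) \<bullet> (x + b)) + ((2 * a) *\<^sub>R axis i 1) \<bullet> x + (2 * a * b $ i + c $ i)"
  have "(\<chi> i. ?g i x) = (2 * a) *\<^sub>R (x + b) + c" for x
    by (simp add: vec_eq_iff inner_axis' algebra_simps)
  then have "(f has_derivative (\<lambda>h. (\<chi> i. ?g i x) \<bullet> h)) (at x)" for x
    unfolding f using quadratic_has_derivative[of a b c D x] by simp
  then show "\<exists>g. (\<forall>i. \<exists>a c D. g i = (\<lambda>x. a * ((x + b) \<bullet> (x + b)) + c \<bullet> x + D)) \<and>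
      (\<forall>x\<in>UNIV. (f has_derivative (\<lambda>h. (\<chi> i. g i x) \<bullet> h)) (at x))"
    by (intro exI[of _ ?g] conjI) blast+
qed auto

text \<open>The trivial factor 1 and the term \<open>0 \<bullet> x\<close> give the function the
  shape of the quadratics above, whose smoothness and gradient then apply directly.\<close>

lemma ball_defining_fun:
  fixes b :: "real^'n::finite"
  assumes R: "R > 0"
  shows "defining_fun (ball (- b) R) (\<lambda>x. 1 * ((x + b) \<bullet> (x + b)) + 0 \<bullet> x + (- R\<^sup>2))"
  unfolding defining_fun_def
proof (intro conjI allI impI)
  show "smooth_on UNIV (\<lambda>x. 1 * ((x + b) \<bullet> (x + b)) + 0 \<bullet> x + (- R\<^sup>2))" by (rule quadratic_smooth)
  show "ball (- b) R = {x. 1 * ((x + b) \<bullet> (x + b)) + 0 \<bullet> x + - R\<^sup>2 < 0}"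
  proof -
    have "dist (- b) x < R \<longleftrightarrow> (x + b) \<bullet> (x + b) < R\<^sup>2" for x
    proof -
      have "dist (- b) x = norm (x + b)" by (metis add.commute dist_norm dist_commute diff_minus_eq_add)
      moreover have "norm (x + b) < R \<longleftrightarrow> (norm (x + b))\<^sup>2 < R\<^sup>2"
        using R by (auto intro: power_strict_mono power2_less_imp_less)
      ultimately show ?thesis by (simp add: power2_norm_eq_inner)
    qed
    then show ?thesis by (intro set_eqI) simp
  qed
  fix x assume "1 * ((x + b) \<bullet> (x + b)) + 0 \<bullet> x + - R\<^sup>2 = 0"
  then have "x + b \<noteq> 0" using R by auto
  moreover have "grad (\<lambda>x. 1 * ((x + b) \<bullet> (x + b)) + 0 \<bullet> x + - R\<^sup>2) x = (2 * 1) *\<^sub>R (x + b) + 0"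
    by (rule has_derivative_imp_grad[OF quadratic_has_derivative])
  ultimately show "grad (\<lambda>x. 1 * ((x + b) \<bullet> (x + b)) + 0 \<bullet> x + - R\<^sup>2) x \<noteq> 0" by simp
qed

lemma ball_smooth_bounded_domain:
  fixes b :: "real^'n::finite"
  assumes R: "R > 0"
  shows "smooth_bounded_domain (ball (- b) R)"
  unfolding smooth_bounded_domain_def using ball_defining_fun[OF R] R by (auto simp: convex_connected)

text \<open>The equation for a radial Hessian with \<open>T = m * s powr (- (d / 2))\<close>. The
  terms in \<open>T\<close> cancel because \<open>(d - 1) choose k\<close> is
  \<open>(d - k) / k\<close> times \<open>(d - 1) choose (k - 1)\<close>.\<close>

lemma power_choose_identity:
  fixes d k :: nat and T :: real
  assumes k: "1 \<le> k" "k \<le> d"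
  shows "real ((d - 1) choose k) * (1 + T) + real ((d - 1) choose (k - 1)) * (1 - (real d - real k) / real k * T) = real (d choose k)"
proof -
  obtain k' where k': "k = Suc k'" using k by (cases k) auto
  obtain d' where d': "d = Suc d'" using k by (cases d) auto
  have "real (Suc k') * real (d' choose Suc k') = (real d' - real k') * real (d' choose k')"
  proof (cases "k' \<le> d'")
    case True
    have "Suc k' * (d' choose Suc k') = (d' - k') * (d' choose k')"
      using binomial_absorb_comp[of d' k'] binomial_absorption[of k' "d'"] k' d' 
      by (metis Suc_times_binomial_add add_diff_cancel_left' binomial_symmetric choose_one diff_Suc_Suc mult.commute times_binomial_minus1_eq binomial_absorption)
    then have "real (Suc k' * (d' choose Suc k')) = real ((d' - k') * (d' choose k'))" by simp
    then show ?thesis using True by (simp only: of_nat_mult of_nat_diff)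
  qed (use k k' d' in simp)
  then have X: "real (d' choose Suc k') = (real d - real k) / real k * real (d' choose k')"
    using k' d' by (simp add: field_simps)
  have "a * x * (1 + T) + x * (1 - a * T) = x + a * x" for a x :: real by (simp add: algebra_simps)
  from this[of "(real d - real k) / real k" "real (d' choose k')"]
  have "real (d' choose Suc k') * (1 + T) + real (d' choose k') * (1 - (real d - real k) / real k * T)
      = real (d' choose k') + real (d' choose Suc k')"
    unfolding X .
  then show ?thesis by (simp add: k' d')
qed

section \<open>Eigenvalues of the radial Hessian\<close>

definition psi' :: "nat \<Rightarrow> nat \<Rightarrow> real \<Rightarrow> real \<Rightarrow> real" where
  "psi' d k m s = (1 / real k) * (1 + m * s powr (- (real d / 2))) powr (1 / real k - 1)
     * (m * (- (real d / 2) * s powr (- (real d / 2) - 1)))"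

context profile
begin

lemma power_term_deriv:
  assumes s: "s > s0"
  shows "((\<lambda>s. s powr p * (1 + m * s powr (- (real d / 2))) powr e) has_real_derivative
     (p * (s powr (p - 1) * (1 + m * s powr (- (real d / 2))) powr e)
      + e * m * (- (real d / 2)) * (s powr (p - real d / 2 - 1) * (1 + m * s powr (- (real d / 2))) powr (e - 1)))) (at s)"
proof -
  have s': "s > 0" using s s0 by simp
  have B: "1 + m * s powr (- (real d / 2)) > 0" using base_pos s by simp
  have "s powr (p - real d / 2 - 1) = s powr p * s powr (- (real d / 2) - 1)"
    by (simp add: powr_add[symmetric] algebra_simps)
  then show ?thesis
    by (auto intro!: derivative_eq_intros simp: s' B algebra_simps)
qed

lemma psi_deriv:
  assumes s: "s > s0"
  shows "(psi d k m has_real_derivative psi' d k m s) (at s)"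
proof -
  have s': "s > 0" using s s0 by simp
  have B: "1 + m * s powr (- (real d / 2)) > 0" using base_pos s by simp
  show ?thesis unfolding psi_def[abs_def] psi'_def
    by (auto intro!: derivative_eq_intros simp: s' B algebra_simps)
qed

text \<open>The first factor is the eigenvalue in the radial direction. Differentiating the power
  produces \<open>B powr (1 / k - 1)\<close>, which the factor \<open>psi ^ (k - 1)\<close> cancels,
  so the product is affine in \<open>s powr (- (d / 2))\<close>.\<close>

lemma psi_radial_eigenvalue:
  assumes s: "s > s0"
  shows "(psi d k m s + 2 * s * psi' d k m s) * psi d k m s ^ (k - 1)
     = 1 - (real d - real k) / real k * (m * s powr (- (real d / 2)))"
proof -
  have s': "s > 0" using s s0 by simp
  define B where "B = 1 + m * s powr (- (real d / 2))"
  define T where "T = m * s powr (- (real d / 2))"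
  have B: "B > 0" using base_pos s by (simp add: B_def)
  have k0: "real k > 0" using k by simp
  have psi: "psi d k m s = B powr (1 / real k)" by (simp add: psi_def B_def)
  have pk1: "psi d k m s ^ (k - 1) = B powr (1 - 1 / real k)"
    using B k by (simp add: psi powr_realpow[symmetric] powr_powr of_nat_diff field_simps)
  have sT: "s * s powr (- (real d / 2) - 1) = s powr (- (real d / 2))"
    using s' powr_mult_base[of s "- (real d / 2) - 1"] by simp
  have "2 * s * psi' d k m s = - (real d / real k) * B powr (1 / real k - 1) * (m * (s * s powr (- (real d / 2) - 1)))"
    by (simp add: psi'_def B_def)
  then have "2 * s * psi' d k m s = - (real d / real k) * B powr (1 / real k - 1) * T"
    by (simp only: sT T_def)
  moreover have "B powr (1 / real k - 1) * B powr (1 - 1 / real k) = 1"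
    using B by (simp add: powr_add[symmetric])
  moreover have "B powr (1 / real k) * B powr (1 - 1 / real k) = B"
    using B by (simp add: powr_add[symmetric])
  moreover have "(e1 + - c * e3 * T) * e2 = e1 * e2 - c * T" if "e3 * e2 = 1" for e1 e2 e3 c :: real
  proof -
    have "(e1 + - c * e3 * T) * e2 = e1 * e2 - c * T * (e3 * e2)" by (simp add: algebra_simps)
    then show ?thesis using that by simp
  qed
  ultimately have "(psi d k m s + 2 * s * psi' d k m s) * psi d k m s ^ (k - 1) = B - (real d / real k) * T"
    unfolding pk1 by (simp only: psi)
  also have "\<dots> = 1 - (real d - real k) / real k * T"
    using k0 by (simp add: B_def T_def field_simps)
  finally show ?thesis by (simp add: T_def)
qed

text \<open>\<open>conv\<close> is the condition at \<open>s = 1\<close>. It propagates outwards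
  since \<open>s powr (- (d / 2))\<close> is at most 1 there; for negative \<open>m\<close> the sign
  is immediate.\<close>

lemma psi_radial_eigenvalue_pos:
  assumes s: "s \<ge> 1" and conv: "(real d - real k) * m < real k"
  shows "psi d k m s + 2 * s * psi' d k m s > 0"
proof -
  have s': "s > s0" using s s0 by simp
  let ?T = "s powr (- (real d / 2))"
  have "?T \<le> s powr 0" using s by (intro powr_mono) auto
  then have T: "0 \<le> ?T" "?T \<le> 1" using s by auto
  have "(real d - real k) * m * ?T < real k"
  proof (cases "m \<ge> 0")
    case True
    then have "(real d - real k) * m * ?T \<le> (real d - real k) * m * 1"
      using T k by (intro mult_left_mono) auto
    then show ?thesis using conv by simp
  next
    case False
    then have "(real d - real k) * m * ?T \<le> 0" using T k by (simp add: mult_nonneg_nonpos mult_nonpos_nonneg)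
    moreover have "real k > 0" using k by simp
    ultimately show ?thesis by linarith
  qed
  then have "1 - (real d - real k) / real k * (m * ?T) > 0" using k by (simp add: field_simps)
  then have "(psi d k m s + 2 * s * psi' d k m s) * psi d k m s ^ (k - 1) > 0"
    using psi_radial_eigenvalue[OF s'] by simp
  moreover have "psi d k m s ^ (k - 1) > 0" using psi_pos[of s] s' by simp
  ultimately show ?thesis by (metis zero_less_mult_pos2)
qed

end

locale radial = profile "CARD('n::finite)" k m s0 G
  for b :: "real^'n::finite" and r :: real and k m s0 G +
  assumes r: "r > 0"
begin

definition q :: "real^'n \<Rightarrow> real" where "q x = ((x + b) \<bullet> (x + b)) / r\<^sup>2"

definition v :: "real^'n \<Rightarrow> real" where "v x = r\<^sup>2 * G (q x)"

definition V :: "(real^'n) set" where "V = {x. q x > s0}"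

lemma q_norm: "q x = (norm (x + b) / r)\<^sup>2"
  by (simp add: q_def power2_norm_eq_inner power_divide)

lemma v_norm: "v x = r\<^sup>2 * G ((norm (x + b) / r)\<^sup>2)"
  by (simp add: v_def q_norm)

lemma V_open: "open V"
proof -
  have "continuous_on UNIV q" unfolding q_def by (intro continuous_intros) (use r in auto)
  then show ?thesis unfolding V_def by (intro open_Collect_less) auto
qed

lemma q_ge_1: "norm (x + b) \<ge> r \<Longrightarrow> q x \<ge> 1"
  unfolding q_norm using r by (simp add: one_le_power)

lemma in_V: "norm (x + b) \<ge> r \<Longrightarrow> x \<in> V"
  using q_ge_1[of x] s0 by (simp add: V_def)

lemma q_has_derivative: "(q has_derivative (\<lambda>h. ((2 / r\<^sup>2) *\<^sub>R (x + b)) \<bullet> h)) (at x)"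
proof -
  have "q = (\<lambda>x. (1 / r\<^sup>2) * ((x + b) \<bullet> (x + b)) + 0 \<bullet> x + 0)" by (auto simp: q_def)
  then show ?thesis using quadratic_has_derivative[of "1 / r\<^sup>2" b 0 0 x] by simp
qed

lemma radial_has_derivative:
  assumes "(H has_real_derivative l) (at (q x))"
  shows "((\<lambda>x. H (q x)) has_derivative (\<lambda>h. ((2 * l / r\<^sup>2) *\<^sub>R (x + b)) \<bullet> h)) (at x)"
proof -
  have "(H has_derivative (*) l) (at (q x))" using assms by (simp add: has_field_derivative_def)
  from diff_chain_at[OF q_has_derivative this] show ?thesis by (simp add: o_def mult_ac)
qed

lemma v_has_derivative:
  assumes "x \<in> V"
  shows "(v has_derivative (\<lambda>h. (psi CARD('n) k m (q x) *\<^sub>R (x + b)) \<bullet> h)) (at x)"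
proof -
  have "(G has_real_derivative psi CARD('n) k m (q x) / 2) (at (q x))" using assms by (intro G_deriv) (simp add: V_def)
  from radial_has_derivative[OF DERIV_cmult[OF this, of "r\<^sup>2"]]
  show ?thesis using r by (simp add: v_def[abs_def])
qed

text \<open>The class for \<open>smooth_on_class\<close>. \<open>v\<close> is known only through the
  derivative of \<open>G\<close>, but its partial derivatives are power terms times shifted
  coordinates, and the two-exponent family \<open>powers\<close> reproduces itself under
  differentiation.\<close>

inductive radial_class :: "(real^'n \<Rightarrow> real) \<Rightarrow> bool" where
  const: "radial_class (\<lambda>x. c)"
| coord: "radial_class (\<lambda>x. x $ i + b $ i)"
| powers: "radial_class (\<lambda>x. q x powr p * (1 + m * q x powr (- (real CARD('n) / 2))) powr e)"
| sol: "radial_class v"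
| add: "radial_class f \<Longrightarrow> radial_class g \<Longrightarrow> radial_class (\<lambda>x. f x + g x)"
| mult: "radial_class f \<Longrightarrow> radial_class g \<Longrightarrow> radial_class (\<lambda>x. f x * g x)"

lemma radial_class_step:
  "radial_class f \<Longrightarrow> \<exists>g. (\<forall>i. radial_class (g i)) \<and> (\<forall>x\<in>V. (f has_derivative (\<lambda>h. (\<chi> i. g i x) \<bullet> h)) (at x))"
proof (induction rule: radial_class.induct)
  case (const c)
  have "((\<lambda>x. c) has_derivative (\<lambda>h. (\<chi> i::'n. 0) \<bullet> h)) (at x)" for x :: "real^'n"
    by (rule has_derivative_eq_rhs[OF has_derivative_const]) (simp add: fun_eq_iff inner_vec_def)
  then show ?case by (intro exI[of _ "\<lambda>i x. 0"]) (auto intro: radial_class.const)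
next
  case (coord j)
  have "((\<lambda>x. x $ j + b $ j) has_derivative (\<lambda>h. (\<chi> i. if i = j then 1 else 0) \<bullet> h)) (at x)" for x :: "real^'n"
  proof -
    have "((\<lambda>x. x $ j + b $ j) has_derivative (\<lambda>h. h $ j + 0)) (at x)"
      by (intro has_derivative_add has_derivative_const bounded_linear_imp_has_derivative bounded_linear_vec_nth)
    moreover have "(\<chi> i. if i = j then 1 else 0) \<bullet> h = h $ j" for h :: "real^'n"
      by (simp add: inner_vec_def if_distrib if_distribR cong: if_cong)
    ultimately show ?thesis by simp
  qed
  then show ?case by (intro exI[of _ "\<lambda>i x. if i = j then 1 else 0"]) (auto intro: radial_class.const)
next
  case (powers p e)
  let ?g = "\<lambda>i x. (2 / r\<^sup>2) * ((p * (q x powr (p - 1) * (1 + m * q x powr (- (real CARD('n) / 2))) powr e)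
      + (e * m * (- (real CARD('n) / 2))) * (q x powr (p - real CARD('n) / 2 - 1) * (1 + m * q x powr (- (real CARD('n) / 2))) powr (e - 1)))
      * (x $ i + b $ i))"
  have "radial_class (?g i)" for i
    by (intro radial_class.mult radial_class.add radial_class.const radial_class.coord radial_class.powers)
  moreover have "((\<lambda>x. q x powr p * (1 + m * q x powr (- (real CARD('n) / 2))) powr e) has_derivative (\<lambda>h. (\<chi> i. ?g i x) \<bullet> h)) (at x)"
    if "x \<in> V" for x
  proof -
    have s: "q x > s0" using that by (simp add: V_def)
    let ?l = "p * (q x powr (p - 1) * (1 + m * q x powr (- (real CARD('n) / 2))) powr e)
      + e * m * (- (real CARD('n) / 2)) * (q x powr (p - real CARD('n) / 2 - 1) * (1 + m * q x powr (- (real CARD('n) / 2))) powr (e - 1))"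
    have "(\<chi> i. ?g i x) = (2 * ?l / r\<^sup>2) *\<^sub>R (x + b)" by (simp add: vec_eq_iff)
    then show ?thesis using radial_has_derivative[OF power_term_deriv[OF s, of p e]] by simp
  qed
  ultimately show ?case by (intro exI[of _ ?g] conjI allI ballI)
next
  case sol
  let ?g = "\<lambda>i x. (q x powr 0 * (1 + m * q x powr (- (real CARD('n) / 2))) powr (1 / real k)) * (x $ i + b $ i)"
  have "radial_class (?g i)" for i by (intro radial_class.mult radial_class.coord radial_class.powers)
  moreover have "(v has_derivative (\<lambda>h. (\<chi> i. ?g i x) \<bullet> h)) (at x)" if x: "x \<in> V" for x
  proof -
    have "q x > 0" using x s0 by (simp add: V_def)
    then have "(\<chi> i. ?g i x) = psi CARD('n) k m (q x) *\<^sub>R (x + b)" by (simp add: vec_eq_iff psi_def)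
    then show ?thesis using v_has_derivative[OF x] by simp
  qed
  ultimately show ?case by (intro exI[of _ ?g] conjI allI ballI)
next
  case (add f1 f2)
  then obtain g1 g2 where g: "\<And>i. radial_class (g1 i)" "\<And>i. radial_class (g2 i)"
    "\<And>x. x \<in> V \<Longrightarrow> (f1 has_derivative (\<lambda>h. (\<chi> i. g1 i x) \<bullet> h)) (at x)"
    "\<And>x. x \<in> V \<Longrightarrow> (f2 has_derivative (\<lambda>h. (\<chi> i. g2 i x) \<bullet> h)) (at x)" by metis
  have "((\<lambda>x. f1 x + f2 x) has_derivative (\<lambda>h. (\<chi> i. g1 i x + g2 i x) \<bullet> h)) (at x)" if "x \<in> V" for x
    by (rule has_derivative_eq_rhs[OF has_derivative_add[OF g(3)[OF that] g(4)[OF that]]])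
       (simp add: fun_eq_iff inner_vec_def sum.distrib algebra_simps)
  then show ?case using g by (intro exI[of _ "\<lambda>i x. g1 i x + g2 i x"]) (auto intro: radial_class.add)
next
  case (mult f1 f2)
  then obtain g1 g2 where g: "\<And>i. radial_class (g1 i)" "\<And>i. radial_class (g2 i)"
    "\<And>x. x \<in> V \<Longrightarrow> (f1 has_derivative (\<lambda>h. (\<chi> i. g1 i x) \<bullet> h)) (at x)"
    "\<And>x. x \<in> V \<Longrightarrow> (f2 has_derivative (\<lambda>h. (\<chi> i. g2 i x) \<bullet> h)) (at x)" by metis
  have "((\<lambda>x. f1 x * f2 x) has_derivative (\<lambda>h. (\<chi> i. f1 x * g2 i x + g1 i x * f2 x) \<bullet> h)) (at x)" if "x \<in> V" for x
    by (rule has_derivative_eq_rhs[OF has_derivative_mult[OF g(3)[OF that] g(4)[OF that]]])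
       (simp add: fun_eq_iff inner_vec_def sum.distrib sum_distrib_left sum_distrib_right algebra_simps)
  moreover have "radial_class (\<lambda>x. f1 x * g2 i x + g1 i x * f2 x)" for i
    by (intro radial_class.add radial_class.mult g mult.hyps)
  ultimately show ?case
    by (intro exI[of _ "\<lambda>i x. f1 x * g2 i x + g1 i x * f2 x"] conjI allI ballI)
qed

lemma v_smooth: "smooth_on V v"
  by (rule smooth_on_class[OF V_open radial_class.sol radial_class_step])

lemma v_grad: "x \<in> V \<Longrightarrow> grad v x = psi CARD('n) k m (q x) *\<^sub>R (x + b)"
  by (rule has_derivative_imp_grad[OF v_has_derivative])

lemma v_hess:
  assumes x: "x \<in> V"
  shows "hess v x = psi CARD('n) k m (q x) *\<^sub>R mat 1 + (2 * psi' CARD('n) k m (q x) / r\<^sup>2) *\<^sub>R outer_prod (x + b)"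
proof -
  let ?c = "psi CARD('n) k m (q x)" and ?c' = "2 * psi' CARD('n) k m (q x) / r\<^sup>2"
  have s: "q x > s0" using x by (simp add: V_def)
  have "((\<lambda>y. psi CARD('n) k m (q y) *\<^sub>R (y + b)) has_derivative (\<lambda>h. ?c *\<^sub>R h + ((?c' *\<^sub>R (x + b)) \<bullet> h) *\<^sub>R (x + b))) (at x)"
    using has_derivative_scaleR[OF radial_has_derivative[OF psi_deriv[OF s]] has_derivative_add[OF has_derivative_ident has_derivative_const[of b]]]
    by simp
  moreover have "(grad v has_derivative (\<lambda>h. hess v x *v h)) (at x)" by (rule grad_has_derivative[OF v_smooth x])
  then have "((\<lambda>y. psi CARD('n) k m (q y) *\<^sub>R (y + b)) has_derivative (\<lambda>h. hess v x *v h)) (at x)"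
    by (rule has_derivative_transform_within_open[OF _ V_open x]) (simp add: v_grad)
  ultimately have "(\<lambda>h. hess v x *v h) = (\<lambda>h. ?c *\<^sub>R h + ((?c' *\<^sub>R (x + b)) \<bullet> h) *\<^sub>R (x + b))"
    by (rule has_derivative_unique[rotated])
  then have "hess v x *v h = (?c *\<^sub>R mat 1 + ?c' *\<^sub>R outer_prod (x + b)) *v h" for h
    by (simp add: fun_eq_iff matrix_vector_mult_add_rdistrib scaleR_matrix_vector_assoc[symmetric] outer_prod_mult)
  then show ?thesis by (simp add: matrix_eq)
qed

lemma v_sigma_k:
  assumes x: "x \<in> V"
  shows "sigma_k k (eigvals (hess v x)) = real (CARD('n) choose k)"
proof -
  have s: "q x > s0" using x by (simp add: V_def)
  let ?p = "psi CARD('n) k m (q x)"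
  have "?p + 2 * psi' CARD('n) k m (q x) / r\<^sup>2 * ((x + b) \<bullet> (x + b)) = ?p + 2 * q x * psi' CARD('n) k m (q x)"
    by (simp add: q_def)
  then have "sigma_k k (eigvals (hess v x))
    = real ((CARD('n) - 1) choose k) * ?p ^ k + real ((CARD('n) - 1) choose (k - 1)) * ((?p + 2 * q x * psi' CARD('n) k m (q x)) * ?p ^ (k - 1))"
    unfolding v_hess[OF x] sigma_k_scale_add_outer_prod[OF k] by simp
  also have "\<dots> = real (CARD('n) choose k)"
    unfolding psi_radial_eigenvalue[OF s] using psi_pow[of "q x"] s power_choose_identity[OF k] by simp
  finally show ?thesis .
qed

text \<open>The smallest eigenvalue is the tangential one if \<open>psi'\<close> is nonnegative and
  the radial one otherwise; Cauchy-Schwarz reduces the second case to it.\<close>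

lemma v_pos_def:
  assumes x: "norm (x + b) \<ge> r" and conv: "(real CARD('n) - real k) * m < real k"
  shows "pos_def (hess v x)"
  unfolding pos_def_def
proof (intro allI impI)
  fix h :: "real^'n" assume h: "h \<noteq> 0"
  let ?p = "psi CARD('n) k m (q x)" and ?p' = "psi' CARD('n) k m (q x)"
  have q1: "q x \<ge> 1" using q_ge_1[OF x] .
  have p: "?p > 0" using psi_pos[of "q x"] q1 s0 by simp
  have e: "?p + 2 * q x * ?p' > 0" by (rule psi_radial_eigenvalue_pos[OF q1 conv])
  have hv: "h \<bullet> (hess v x *v h) = ?p * (h \<bullet> h) + 2 * ?p' / r\<^sup>2 * ((x + b) \<bullet> h)\<^sup>2"
    unfolding v_hess[OF in_V[OF x]]
    by (simp add: matrix_vector_mult_add_rdistrib scaleR_matrix_vector_assoc[symmetric] outer_prod_mult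
        inner_simps power2_eq_square inner_commute)
  have hh: "h \<bullet> h > 0" using h by simp
  have cs: "((x + b) \<bullet> h)\<^sup>2 \<le> ((x + b) \<bullet> (x + b)) * (h \<bullet> h)" by (rule Cauchy_Schwarz_ineq)
  show "0 < h \<bullet> (hess v x *v h)"
  proof (cases "?p' \<ge> 0")
    case True
    then have "2 * ?p' / r\<^sup>2 * ((x + b) \<bullet> h)\<^sup>2 \<ge> 0" by simp
    then show ?thesis using hv mult_pos_pos[OF p hh] by linarith
  next
    case False
    then have "2 * ?p' / r\<^sup>2 * ((x + b) \<bullet> h)\<^sup>2 \<ge> 2 * ?p' / r\<^sup>2 * (((x + b) \<bullet> (x + b)) * (h \<bullet> h))"
      using cs r by (intro mult_left_mono_neg) (auto simp: divide_nonpos_pos)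
    also have "2 * ?p' / r\<^sup>2 * (((x + b) \<bullet> (x + b)) * (h \<bullet> h)) = 2 * q x * ?p' * (h \<bullet> h)"
      by (simp add: q_def)
    finally have "h \<bullet> (hess v x *v h) \<ge> (?p + 2 * q x * ?p') * (h \<bullet> h)" unfolding hv by (simp add: algebra_simps)
    then show ?thesis using mult_pos_pos[OF e hh] by linarith
  qed
qed

lemma v_sphere: "norm (x + b) = r \<Longrightarrow> v x = 0"
  using r by (simp add: v_norm G_1)

lemma v_limit: "((\<lambda>x. v x - ((1/2) * (x \<bullet> x) + b \<bullet> x + (r\<^sup>2 * (- 1/2 + Phi CARD('n) k m) + (norm b)\<^sup>2 / 2))) \<longlongrightarrow> 0) at_infinity"
proof -
  have "filterlim (\<lambda>x. norm (x + b)) at_top at_infinity"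
  proof -
    have "filterlim (\<lambda>x. norm x + (- norm b)) at_top (at_infinity :: (real^'n) filter)"
      using filterlim_tendsto_add_at_top[OF tendsto_const[of "- norm b"] filterlim_norm_at_top] by (simp add: add.commute)
    then show ?thesis
      by (rule filterlim_at_top_mono) (use norm_diff_ineq[of _ b] in \<open>auto simp: algebra_simps\<close>)
  qed
  from filterlim_compose[OF profile_square_limit[OF r] this]
  have "((\<lambda>x. v x - (norm (x + b))\<^sup>2 / 2 - r\<^sup>2 * (- 1/2 + Phi CARD('n) k m)) \<longlongrightarrow> r\<^sup>2 * (- 1/2 + Phi CARD('n) k m) - r\<^sup>2 * (- 1/2 + Phi CARD('n) k m)) at_infinity"
    unfolding v_norm by (intro tendsto_diff tendsto_const) auto
  moreover have "(norm (x + b))\<^sup>2 / 2 = (1/2) * (x \<bullet> x) + b \<bullet> x + (norm b)\<^sup>2 / 2" for x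
    by (simp add: power2_norm_eq_inner inner_simps inner_commute field_simps)
  ultimately show ?thesis by (simp add: algebra_simps)
qed

end

subsection \<open>Comparison with radial solutions\<close>

lemma norm_matrix_vector_mult_le:
  fixes A :: "real^'n::finite^'m::finite"
  shows "norm (A *v x) \<le> norm A * norm x"
proof -
  have "(A *v x) $ i = A $ i \<bullet> x" for i by (simp add: matrix_vector_mult_def inner_vec_def)
  note comp = this
  have "(norm (A *v x))\<^sup>2 = (A *v x) \<bullet> (A *v x)" by (rule power2_norm_eq_inner)
  also have "\<dots> = (\<Sum>i\<in>UNIV. (A $ i \<bullet> x)\<^sup>2)"
    by (simp add: inner_vec_def[of "A *v x"] comp power2_eq_square)
  also have "\<dots> \<le> (\<Sum>i\<in>UNIV. (A $ i \<bullet> A $ i) * (x \<bullet> x))"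
    by (intro sum_mono Cauchy_Schwarz_ineq)
  also have "\<dots> = (norm A * norm x)\<^sup>2"
    by (simp add: power_mult_distrib power2_norm_eq_inner inner_vec_def[of A A] sum_distrib_right)
  finally show ?thesis by (rule power2_le_imp_le) simp
qed

lemma hess_continuous: "smooth_on U f \<Longrightarrow> continuous_on U (hess f)"
  unfolding hess_def by (intro continuous_on_vec_lambda smooth_on_continuous smooth_on_pd)

section \<open>Outer normals from defining functions\<close>

lemma frontier_defining_fun:
  assumes "defining_fun Om phi" "open Om" "x \<in> frontier Om"
  shows "phi x = 0"
proof -
  have c: "continuous_on UNIV phi" and Om: "Om = {x. phi x < 0}"
    using assms(1) by (auto simp: defining_fun_def intro: smooth_on_continuous)
  have "closed {x. phi x \<le> 0}" using c by (intro closed_Collect_le) auto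
  then have "closure Om \<subseteq> {x. phi x \<le> 0}" unfolding Om by (intro closure_minimal) auto
  moreover have "x \<in> closure Om" "x \<notin> Om" using assms(2,3) by (auto simp: frontier_def interior_open)
  ultimately show ?thesis unfolding Om by fastforce
qed

text \<open>The normal is built from a chosen defining function of which nothing more is known. Its
  direction is recovered later from the signs of that function on the two sides of the
  boundary.\<close>

lemma outer_normal_defining_fun:
  assumes "smooth_bounded_domain Om"
  obtains phi where "defining_fun Om phi" "\<And>x. outer_normal Om x = grad phi x /\<^sub>R norm (grad phi x)"
proof -
  have "defining_fun Om (SOME phi. defining_fun Om phi)"
    using assms unfolding smooth_bounded_domain_def by (metis someI_ex)
  then show thesis using that by (simp add: outer_normal_def Let_def)
qed

lemma norm_outer_normal:
  assumes "smooth_bounded_domain Om" "x \<in> frontier Om"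
  shows "norm (outer_normal Om x) = 1"
proof -
  obtain phi where phi: "defining_fun Om phi" "\<And>x. outer_normal Om x = grad phi x /\<^sub>R norm (grad phi x)"
    using outer_normal_defining_fun[OF assms(1)] by blast
  have "open Om" using assms(1) by (simp add: smooth_bounded_domain_def)
  then have "phi x = 0" using frontier_defining_fun[OF phi(1) _ assms(2)] by simp
  then have "grad phi x \<noteq> 0" using phi(1) by (simp add: defining_fun_def)
  then show ?thesis by (simp add: phi(2))
qed

lemma outer_normal_crossing:
  fixes Om :: "(real^'n::finite) set"
  assumes D: "smooth_bounded_domain Om" and x: "x \<in> frontier Om" and e: "e \<bullet> outer_normal Om x > 0"
  shows "\<exists>d>0. \<forall>t. 0 < t \<and> t < d \<longrightarrow> x + t *\<^sub>R e \<notin> Om \<and> x - t *\<^sub>R e \<in> Om"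
proof -
  obtain phi where phi: "defining_fun Om phi" "\<And>x. outer_normal Om x = grad phi x /\<^sub>R norm (grad phi x)"
    using outer_normal_defining_fun[OF D] by blast
  have "open Om" using D by (simp add: smooth_bounded_domain_def)
  then have p0: "phi x = 0" using frontier_defining_fun[OF phi(1) _ x] by simp
  have sm: "smooth_on UNIV phi" and Om: "Om = {x. phi x < 0}" using phi(1) by (auto simp: defining_fun_def)
  have "grad phi x \<bullet> e > 0" using e by (simp add: phi(2) inner_commute zero_less_mult_iff)
  moreover have "((\<lambda>t. phi (x + t *\<^sub>R e)) has_real_derivative grad phi (x + 0 *\<^sub>R e) \<bullet> e) (at 0)"
    by (rule has_derivative_along_line[OF sm]) simp
  ultimately have d: "((\<lambda>t. phi (x + t *\<^sub>R e)) has_real_derivative grad phi x \<bullet> e) (at 0)" "grad phi x \<bullet> e > 0" by simp_all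
  obtain d1 where d1: "d1 > 0" "\<And>h. 0 < h \<Longrightarrow> h < d1 \<Longrightarrow> phi (x + h *\<^sub>R e) > 0"
    using DERIV_pos_inc_right[OF d] p0 by auto
  obtain d2 where d2: "d2 > 0" "\<And>h. 0 < h \<Longrightarrow> h < d2 \<Longrightarrow> phi (x - h *\<^sub>R e) < 0"
    using DERIV_pos_inc_left[OF d] p0 by auto
  show ?thesis
    using d1 d2 by (intro exI[of _ "min d1 d2"]) (auto simp: Om not_less intro: less_imp_le)
qed

locale P_solution = exterior_solution_unit Om U u nrm
  for Om :: "(real^'n::finite) set" and U u nrm +
  fixes k :: nat and b :: "real^'n" and c :: real
  assumes d3: "3 \<le> CARD('n)" and k1: "1 \<le> k" and kd: "k \<le> CARD('n)"
    and equation: "x \<notin> closure Om \<Longrightarrow> sigma_k k (eigvals (hess u x)) = real (CARD('n) choose k)"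
    and asymptotics: "((\<lambda>x. u x - ((1/2) * (x \<bullet> x) + b \<bullet> x + c)) \<longlongrightarrow> 0) at_infinity"

lemma P_solutionI:
  fixes Om :: "(real^'n::finite) set"
  assumes "3 \<le> CARD('n)" "1 \<le> k" "k \<le> CARD('n)"
    and D: "smooth_bounded_domain Om" and sol: "solves_P k Om b c u" and conv: "strictly_convex_on (- Om) u"
  obtains U where "P_solution Om U u (outer_normal Om) k b c"
proof -
  obtain U where U: "- Om \<subseteq> U" "smooth_on U u" using sol unfolding solves_P_def by blast
  have "P_solution Om U u (outer_normal Om) k b c"
  proof unfold_locales
    show "Om \<noteq> {}" "open Om" "bounded Om" using D by (auto simp: smooth_bounded_domain_def)
    show "pos_def (hess u x)" if "x \<notin> Om" for x using conv that by (simp add: strictly_convex_on_def)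
    show "u x = 0" "grad u x \<bullet> outer_normal Om x = 1" if "x \<in> frontier Om" for x
      using sol that by (auto simp: solves_P_def)
    show "\<exists>d>0. \<forall>t. 0 < t \<and> t < d \<longrightarrow> x + t *\<^sub>R e \<notin> Om \<and> x - t *\<^sub>R e \<in> Om"
      if "x \<in> frontier Om" "0 < e \<bullet> outer_normal Om x" for x e by (rule outer_normal_crossing[OF D that])
    show "norm (outer_normal Om x) = 1" if "x \<in> frontier Om" for x by (rule norm_outer_normal[OF D that])
    show "sigma_k k (eigvals (hess u x)) = real (CARD('n) choose k)" if "x \<notin> closure Om" for x
      using sol that by (auto simp: solves_P_def)
    show "((\<lambda>x. u x - ((1/2) * (x \<bullet> x) + b \<bullet> x + c)) \<longlongrightarrow> 0) at_infinity"
      using sol by (auto simp: solves_P_def)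
  qed (use U assms in auto)
  then show thesis by (rule that)
qed

lemma radial_exists:
  assumes "3 \<le> CARD('n::finite)" "1 \<le> k" "k \<le> CARD('n)" "r > 0" "m > -1"
  obtains s0 G where "radial TYPE('n) r k m s0 G"
proof -
  obtain s0 G where "profile CARD('n) k m s0 G" using profile_exists[OF assms(1-3,5)] .
  then have "radial TYPE('n) r k m s0 G" using assms(4) by (simp add: radial_def radial_axioms_def)
  then show thesis by (rule that)
qed

lemma dist_minus_center: "dist (- b) x = norm (x + b)" for b x :: "'a::real_normed_vector"
  by (metis add.commute dist_norm dist_commute diff_minus_eq_add)

context P_solution
begin

text \<open>Curvature at the point of contact with the circumscribed sphere, passed to the limit from the exterior.\<close>
lemma circumscribed_radius_supercritical:
  assumes r0: "r0 > 0" and xf: "x0 \<in> frontier Om" and Omb: "Om \<subseteq> ball z0 r0" and dist: "dist z0 x0 = r0"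
    and Hx: "hess u x0 *v (x0 - z0) = ((x0 - z0) \<bullet> (hess u x0 *v (x0 - z0)) / r0\<^sup>2) *\<^sub>R (x0 - z0)"
    and tang: "\<And>e. e \<bullet> (x0 - z0) = 0 \<Longrightarrow> e \<bullet> (hess u x0 *v e) \<ge> (e \<bullet> e) / r0"
  shows "real CARD('n) - real k < real CARD('n) * r0 ^ k"
proof (rule ccontr)
  let ?d = "CARD('n)"
  assume "\<not> ?thesis"
  then have sub: "real ?d * r0 ^ k \<le> real ?d - real k" by simp
  have "real ?d * r0 ^ k > 0" using r0 d3 by simp
  then have kd': "k < ?d" using sub kd by simp
  let ?H = "hess u x0"
  define n where "n = x0 - z0"
  define mu where "mu = n \<bullet> (?H *v n) / r0\<^sup>2"
  have xO: "x0 \<notin> Om" by (rule frontier_not_in[OF xf])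
  then have xU: "x0 \<in> U" using U_sub by auto
  have nn: "n \<bullet> n = r0\<^sup>2" using dist by (simp add: n_def dist_norm power2_norm_eq_inner[symmetric] norm_minus_commute)
  then have n0: "n \<noteq> 0" using r0 by auto
  have mu: "mu > 0" using hess_pos[OF xO n0] r0 by (simp add: mu_def)
  have Hn: "?H *v n = mu *\<^sub>R n" using Hx by (simp add: n_def mu_def)
  have symH: "transpose ?H = ?H" by (rule hess_symmetric[OF smooth xU])
  \<comment> \<open>Since \<open>n\<close> has length \<open>r0\<close>, the matrix
    \<open>(1 / r0) *\<^sub>R mat 1 + g *\<^sub>R outer_prod n\<close> has eigenvalue
    \<open>mu\<close> along \<open>n\<close> and \<open>1 / r0\<close> on the tangent space; it
    bounds the Hessian at \<open>x0\<close> from below.\<close>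
  define g where "g = (mu - 1 / r0) / r0\<^sup>2"
  have Nh: "h \<bullet> (((1 / r0 - ep) *\<^sub>R mat 1 + g *\<^sub>R outer_prod n) *v h) = (1 / r0 - ep) * (h \<bullet> h) + g * (n \<bullet> h)\<^sup>2" for h ep
    by (simp add: matrix_vector_mult_add_rdistrib scaleR_matrix_vector_assoc[symmetric] outer_prod_mult
        inner_add_right power2_eq_square inner_commute)
  have low: "h \<bullet> (?H *v h) \<ge> (1 / r0) * (h \<bullet> h) + g * (n \<bullet> h)\<^sup>2"
    and dec: "(1 / r0) * (h \<bullet> h) + g * (n \<bullet> h)\<^sup>2 \<ge> min mu (1 / r0) * (h \<bullet> h)" for h
  proof -
    define t where "t = (n \<bullet> h) / r0\<^sup>2"
    define e where "e = h - t *\<^sub>R n"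
    have en: "e \<bullet> n = 0" using nn r0 by (simp add: e_def t_def inner_simps inner_commute)
    have h: "h = t *\<^sub>R n + e" by (simp add: e_def)
    have eH: "e \<bullet> (?H *v e) \<ge> (e \<bullet> e) / r0" using tang en by (simp add: n_def)
    have nHe: "n \<bullet> (?H *v e) = 0" using sym_inner_commute[OF symH, of n e] en by (simp add: Hn)
    have hHh: "h \<bullet> (?H *v h) = t\<^sup>2 * mu * r0\<^sup>2 + e \<bullet> (?H *v e)"
      unfolding h using en nHe nn
      by (simp add: matrix_vector_right_distrib matrix_vector_mult_scaleR Hn inner_simps power2_eq_square inner_commute)
    have hh: "h \<bullet> h = t\<^sup>2 * r0\<^sup>2 + e \<bullet> e"
      unfolding h using en nn by (simp add: inner_simps power2_eq_square inner_commute)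
    have nh: "n \<bullet> h = t * r0\<^sup>2" unfolding h using en nn by (simp add: inner_simps inner_commute)
    have "g * (n \<bullet> h)\<^sup>2 = (mu - 1 / r0) * (t\<^sup>2 * r0\<^sup>2)"
      using r0 by (simp add: g_def nh power2_eq_square)
    then have N: "(1 / r0) * (h \<bullet> h) + g * (n \<bullet> h)\<^sup>2 = mu * (t\<^sup>2 * r0\<^sup>2) + (1 / r0) * (e \<bullet> e)"
      unfolding hh by (simp add: algebra_simps)
    show "h \<bullet> (?H *v h) \<ge> (1 / r0) * (h \<bullet> h) + g * (n \<bullet> h)\<^sup>2"
      unfolding N hHh using eH by (simp add: mult_ac)
    have "min mu (1 / r0) * (t\<^sup>2 * r0\<^sup>2) \<le> mu * (t\<^sup>2 * r0\<^sup>2)" "min mu (1 / r0) * (e \<bullet> e) \<le> (1 / r0) * (e \<bullet> e)"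
      by (intro mult_right_mono; simp)+
    then have "min mu (1 / r0) * (t\<^sup>2 * r0\<^sup>2 + e \<bullet> e) \<le> mu * (t\<^sup>2 * r0\<^sup>2) + (1 / r0) * (e \<bullet> e)"
      by (simp only: distrib_left)
    then show "(1 / r0) * (h \<bullet> h) + g * (n \<bullet> h)\<^sup>2 \<ge> min mu (1 / r0) * (h \<bullet> h)"
      unfolding N unfolding hh .
  qed
  \<comment> \<open>\<open>sigma_k\<close> of that comparison matrix lowered by \<open>ep\<close>.
    The loss \<open>ep\<close> absorbs the change of the Hessian from \<open>x0\<close> to a nearby
    point outside the closure, where the equation holds.\<close>
  define f where "f ep = real ((?d - 1) choose k) * (1 / r0 - ep) ^ k
      + real ((?d - 1) choose (k - 1)) * (1 / r0 - ep + g * (n \<bullet> n)) * (1 / r0 - ep) ^ (k - 1)" for ep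
  have fle: "f ep \<le> real (?d choose k)" if ep: "0 < ep" "ep < min mu (1 / r0)" for ep
  proof -
    have "isCont (hess u) x0"
      using hess_continuous[OF smooth] smooth_on_open[OF smooth] xU by (simp add: continuous_on_eq_continuous_at)
    from isCont_distD[OF this ep(1)]
    obtain dl where dl: "dl > 0" "\<And>y. dist x0 y < dl \<Longrightarrow> dist (hess u y) ?H < ep" by blast
    define t where "t = dl / (2 * r0)"
    define y where "y = x0 + t *\<^sub>R n"
    have t: "t > 0" using dl r0 by (simp add: t_def)
    have nn': "norm n = r0" using dist by (simp add: n_def dist_norm norm_minus_commute)
    have "dist x0 y < dl" using t dl r0 by (simp add: y_def dist_norm nn') (simp add: t_def)
    then have near: "dist (hess u y) ?H < ep" by (rule dl(2))
    have "y - z0 = (1 + t) *\<^sub>R n" by (simp add: y_def n_def algebra_simps)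
    then have "norm (y - z0) = (1 + t) * r0" using t by (simp add: nn')
    then have "dist z0 y = (1 + t) * r0" by (metis dist_commute dist_norm)
    then have "dist z0 y > r0" using t r0 by simp
    moreover have "closure Om \<subseteq> cball z0 r0" using Omb by (intro closure_minimal) (auto intro: less_imp_le)
    ultimately have yc: "y \<notin> closure Om" by auto
    then have yO: "y \<notin> Om" using closure_subset by blast
    let ?N = "(1 / r0 - ep) *\<^sub>R mat 1 + g *\<^sub>R outer_prod n"
    have symN: "transpose ?N = ?N" by (simp add: vec_eq_iff transpose_def mat_def outer_prod_def mult.commute)
    have symY: "transpose (hess u y) = hess u y" using yO U_sub by (intro hess_symmetric[OF smooth]) auto
    have "sigma_k k (eigvals ?N) \<le> sigma_k k (eigvals (hess u y))"
    proof (rule sigma_k_mono[OF kd symN symY])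
      fix h :: "real^'n"
      have "min mu (1 / r0) * (h \<bullet> h) \<ge> ep * (h \<bullet> h)" using ep by (intro mult_right_mono) auto
      then show "0 \<le> h \<bullet> (?N *v h)" unfolding Nh using dec[of h] by (simp add: algebra_simps)
      have "\<bar>h \<bullet> ((hess u y - ?H) *v h)\<bar> \<le> norm h * norm ((hess u y - ?H) *v h)" by (rule Cauchy_Schwarz_ineq2)
      also have "\<dots> \<le> norm h * (norm (hess u y - ?H) * norm h)"
        by (intro mult_left_mono norm_matrix_vector_mult_le) auto
      also have "\<dots> \<le> norm h * (ep * norm h)" using near by (intro mult_left_mono mult_right_mono) (auto simp: dist_norm)
      also have "\<dots> = ep * (h \<bullet> h)" by (simp add: power2_norm_eq_inner[symmetric] power2_eq_square)
      finally have "h \<bullet> (hess u y *v h) \<ge> h \<bullet> (?H *v h) - ep * (h \<bullet> h)"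
        by (simp add: matrix_vector_mult_diff_rdistrib inner_diff_right)
      then show "h \<bullet> (?N *v h) \<le> h \<bullet> (hess u y *v h)" unfolding Nh using low[of h] by (simp add: algebra_simps)
    qed
    then show ?thesis unfolding equation[OF yc] sigma_k_scale_add_outer_prod[OF k1 kd] by (simp add: f_def)
  qed
  have "(f \<longlongrightarrow> f 0) (at_right 0)"
    unfolding f_def by (intro tendsto_intros) 
  moreover have "\<forall>\<^sub>F ep in at_right 0. f ep \<le> real (?d choose k)"
  proof -
    have "\<forall>\<^sub>F ep in at_right 0. ep \<in> {0<..<min mu (1 / r0)}"
      using mu r0 by (intro eventually_at_right_real) simp
    then show ?thesis by eventually_elim (use fle in auto)
  qed
  ultimately have "f 0 \<le> real (?d choose k)"
    by (intro tendsto_upperbound) (auto simp: trivial_limit_at_right_real)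
  moreover have "f 0 = real ((?d - 1) choose k) * (1 / r0) ^ k + real ((?d - 1) choose (k - 1)) * mu * (1 / r0) ^ (k - 1)"
    using r0 by (simp add: f_def g_def nn)
  moreover have "real ((?d - 1) choose (k - 1)) * mu * (1 / r0) ^ (k - 1) > 0"
    using mu r0 kd k1 by (intro mult_pos_pos) auto
  \<comment> \<open>For a subcritical \<open>r0\<close> the tangential eigenvalues alone account for
    the whole right-hand side, leaving no room for the positive contribution of the normal
    one.\<close>
  moreover have "real ((?d - 1) choose k) * (1 / r0) ^ k \<ge> real (?d choose k)"
  proof -
    have kpos: "real k / (real ?d - real k) > 0" using kd' k1 by simp
    have "real ?d / (real ?d - real k) \<le> (1 / r0) ^ k"
      using sub r0 kd' by (simp add: power_one_over field_simps)
    then have "real ((?d - 1) choose k) * (real ?d / (real ?d - real k)) \<le> real ((?d - 1) choose k) * (1 / r0) ^ k"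
      by (intro mult_left_mono) auto
    moreover have "real ((?d - 1) choose k) * (real ?d / (real ?d - real k)) = real (?d choose k)"
    proof -
      have "1 + real k / (real ?d - real k) = real ?d / (real ?d - real k)" using kd' by (simp add: field_simps)
      moreover have "1 - (real ?d - real k) / real k * (real k / (real ?d - real k)) = 0" using kd' k1 by simp
      ultimately show ?thesis using power_choose_identity[OF k1 kd, of "real k / (real ?d - real k)"] by simp
    qed
    ultimately show ?thesis by simp
  qed
  ultimately show False by linarith
qed

lemma difference_limit:
  assumes "radial TYPE('n) r k m s0 G"
  shows "((\<lambda>x. u x - radial.v b r G x) \<longlongrightarrow> c - (r\<^sup>2 * (- 1/2 + Phi CARD('n) k m) + (norm b)\<^sup>2 / 2)) at_infinity"
proof -
  interpret rad: radial b r k m s0 G by (rule assms)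
  let ?C = "r\<^sup>2 * (- 1/2 + Phi CARD('n) k m) + (norm b)\<^sup>2 / 2"
  have "((\<lambda>x. (u x - ((1/2) * (x \<bullet> x) + b \<bullet> x + c)) - (rad.v x - ((1/2) * (x \<bullet> x) + b \<bullet> x + ?C)) + (c - ?C)) \<longlongrightarrow> 0 - 0 + (c - ?C)) at_infinity"
    by (intro tendsto_intros asymptotics rad.v_limit)
  then show ?thesis by (simp add: algebra_simps)
qed

lemma far_region:
  assumes lim: "((\<lambda>x. f x) \<longlongrightarrow> L) at_infinity" and L: "L < f x1"
  shows "\<exists>R1. norm (x1 :: real^'n) < R1 \<and> (\<forall>y. norm y \<ge> R1 \<longrightarrow> f y < (f x1 :: real))"
proof -
  have "\<forall>\<^sub>F y in at_infinity. f y < f x1" using order_tendstoD(2)[OF lim L] .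
  then obtain B where "\<And>y. norm y \<ge> B \<Longrightarrow> f y < f x1" by (auto simp: eventually_at_infinity)
  then show ?thesis by (intro exI[of _ "max B (norm x1 + 1)"]) auto
qed

lemma annulus_frontier:
  assumes "y \<in> frontier ({y. r < norm (y + b)} \<inter> ball 0 R1)"
  shows "norm (y + b) \<ge> r" "norm (y + b) = r \<or> norm y \<ge> R1"
proof -
  let ?S = "{y. r < norm (y + b)} \<inter> ball 0 R1"
  have o: "open ?S" by (intro open_Int open_Collect_less continuous_intros) auto
  have "closed {y. r \<le> norm (y + b)}" by (intro closed_Collect_le continuous_intros)
  then have "closure ?S \<subseteq> {y. r \<le> norm (y + b)}" by (intro closure_minimal) auto
  moreover have "frontier ?S = closure ?S - ?S" using o by (metis frontier_def interior_open)
  then have "y \<in> closure ?S" "y \<notin> ?S" using assms by blast+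
  ultimately show "norm (y + b) \<ge> r" "norm (y + b) = r \<or> norm y \<ge> R1" by auto
qed

lemma annulus_closure: "y \<in> closure ({y. r < norm (y + b)} \<inter> ball 0 R1) \<Longrightarrow> norm (y + b) \<ge> r"
proof -
  have "closed {y. r \<le> norm (y + b)}" by (intro closed_Collect_le continuous_intros)
  then have "closure ({y. r < norm (y + b)} \<inter> ball 0 R1) \<subseteq> {y. r \<le> norm (y + b)}" by (intro closure_minimal) auto
  then show "y \<in> closure ({y. r < norm (y + b)} \<inter> ball 0 R1) \<Longrightarrow> norm (y + b) \<ge> r" by auto
qed

lemma outside_ball:
  assumes "Om \<subseteq> ball (- b) r"
  shows "norm (y + b) \<ge> r \<Longrightarrow> y \<notin> Om" "norm (y + b) > r \<Longrightarrow> y \<notin> closure Om"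
proof -
  show "norm (y + b) \<ge> r \<Longrightarrow> y \<notin> Om" using assms by (auto simp: dist_minus_center subset_iff)
  have "closure Om \<subseteq> cball (- b) r" using assms by (intro closure_minimal) (auto intro: less_imp_le)
  then show "norm (y + b) > r \<Longrightarrow> y \<notin> closure Om" by (auto simp: dist_minus_center subset_iff)
qed

text \<open>On the sphere \<open>v = 0 \<le> u\<close>, and at infinity the limit of
  \<open>v - u\<close> is not positive, so a positive value would give an interior maximum in a
  truncated annulus. The parameter \<open>m\<close> is free, so that radial functions with boundary
  slope different from 1 can be used.\<close>

lemma lower_comparison:
  assumes rad: "radial TYPE('n) r k m s0 G" and conv: "(real CARD('n) - real k) * m < real k"
    and Omb: "Om \<subseteq> ball (- b) r"
    and c: "c \<ge> r\<^sup>2 * (- 1/2 + Phi CARD('n) k m) + (norm b)\<^sup>2 / 2"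
    and x: "norm (x + b) \<ge> r"
  shows "radial.v b r G x \<le> u x"
proof (rule ccontr)
  interpret rad: radial b r k m s0 G by (rule rad)
  assume "\<not> ?thesis"
  then have W: "rad.v x - u x > 0" by simp
  have "((\<lambda>x. - (u x - rad.v x)) \<longlongrightarrow> - (c - (r\<^sup>2 * (- 1/2 + Phi CARD('n) k m) + (norm b)\<^sup>2 / 2))) at_infinity"
    by (intro tendsto_minus difference_limit[OF rad])
  then have "((\<lambda>x. rad.v x - u x) \<longlongrightarrow> - (c - (r\<^sup>2 * (- 1/2 + Phi CARD('n) k m) + (norm b)\<^sup>2 / 2))) at_infinity" by simp
  from far_region[OF this, of x] W c
  obtain R1 where R1: "norm x < R1" "\<And>y. norm y \<ge> R1 \<Longrightarrow> rad.v y - u y < rad.v x - u x" by auto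
  have sph: "rad.v y - u y \<le> 0" if "norm (y + b) = r" for y
    using rad.v_sphere[OF that] u_nonneg[OF outside_ball(1)[OF Omb]] that by simp
  let ?S = "{y. r < norm (y + b)} \<inter> ball 0 R1"
  have oS: "open ?S" by (intro open_Int open_Collect_less continuous_intros) auto
  show False
  proof (rule comparison_no_interior_max[OF k1 kd, of ?S rad.v u x])
    show "bounded ?S" by (rule bounded_subset[OF bounded_ball[of 0 R1]]) auto
    show "smooth_on ?S rad.v"
      using rad.in_V by (intro smooth_on_subset[OF rad.v_smooth oS]) auto
    have SU: "?S \<subseteq> U" using outside_ball(1)[OF Omb] U_sub by auto
    then show "smooth_on ?S u" by (intro smooth_on_subset[OF smooth oS])
    have "closure ?S \<subseteq> rad.V" "closure ?S \<subseteq> U"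
      using rad.in_V annulus_closure outside_ball(1)[OF Omb] U_sub by auto
    then show "continuous_on (closure ?S) (\<lambda>x. rad.v x - u x)"
      by (intro continuous_on_diff continuous_on_subset[OF smooth_on_continuous[OF rad.v_smooth]]
          continuous_on_subset[OF smooth_on_continuous[OF smooth]])
    show "pos_def (hess rad.v y)" if "y \<in> ?S" for y using that by (intro rad.v_pos_def conv) auto
    show "sigma_k k (eigvals (hess rad.v y)) = sigma_k k (eigvals (hess u y))" if "y \<in> ?S" for y
      using that rad.v_sigma_k[OF rad.in_V] equation[OF outside_ball(2)[OF Omb]] by simp
    have "norm (x + b) \<noteq> r" using W sph by fastforce
    then show "x \<in> ?S" using x R1(1) by auto
    show "rad.v y - u y < rad.v x - u x" if "y \<in> frontier ?S" for y
      using annulus_frontier[OF that] sph R1(2) W by fastforce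
  qed (rule oS)
qed

text \<open>If \<open>c\<close> were larger, \<open>m\<close> could be raised a little above
  \<open>1 / r0 ^ k - 1\<close> with the radial function still strictly convex and its constant
  still below \<open>c\<close>. Its boundary slope then exceeds 1, the slope of \<open>u\<close> at
  the contact point, so it rises above \<open>u\<close> there, against
  \<open>lower_comparison\<close>.\<close>

lemma circumscribed_constant:
  obtains r0 where "r0 > 0" "Om \<subseteq> ball (- b) r0" "real CARD('n) - real k < real CARD('n) * r0 ^ k"
    "c \<le> radius_const CARD('n) k r0 + (norm b)\<^sup>2 / 2"
proof -
  let ?d = "CARD('n)"
  obtain x0 r0 where r0: "r0 > 0" and xf: "x0 \<in> frontier Om" and dist: "dist (- b) x0 = r0" and Omb: "Om \<subseteq> ball (- b) r0"
    and gx: "grad u x0 = (x0 - (- b)) /\<^sub>R r0"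
    and Hx: "hess u x0 *v (x0 - (- b)) = ((x0 - (- b)) \<bullet> (hess u x0 *v (x0 - (- b))) / r0\<^sup>2) *\<^sub>R (x0 - (- b))"
    and tang: "\<forall>e. e \<bullet> (x0 - (- b)) = 0 \<longrightarrow> e \<bullet> (hess u x0 *v e) \<ge> (e \<bullet> e) / r0"
    by (rule circumscribed_ball[of "- b"])
  have sup: "real ?d - real k < real ?d * r0 ^ k"
    by (rule circumscribed_radius_supercritical[OF r0 xf Omb dist Hx tang[rule_format]])
  have "c \<le> radius_const ?d k r0 + (norm b)\<^sup>2 / 2"
  proof (rule ccontr)
    assume "\<not> ?thesis"
    then have c: "r0\<^sup>2 * (- 1/2 + Phi ?d k (1 / r0 ^ k - 1)) + (norm b)\<^sup>2 / 2 < c" by (simp add: radius_const_def)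
    let ?m0 = "1 / r0 ^ k - 1"
    have m0: "?m0 > -1" using r0 by simp
    have conv0: "(real ?d - real k) * ?m0 < real k"
      by (rule supercritical_slope[OF r0 sup])
    have "isCont (Phi ?d k) ?m0"
      using Phi_continuous[OF d3 k1] m0 by (simp add: continuous_on_eq_continuous_at)
    then have "(Phi ?d k \<longlongrightarrow> Phi ?d k ?m0) (at_right ?m0)"
      unfolding isCont_def by (rule tendsto_within_subset) simp
    then have "((\<lambda>m. r0\<^sup>2 * (- 1/2 + Phi ?d k m) + (norm b)\<^sup>2 / 2) \<longlongrightarrow> r0\<^sup>2 * (- 1/2 + Phi ?d k ?m0) + (norm b)\<^sup>2 / 2) (at_right ?m0)"
      by (intro tendsto_intros)
    from order_tendstoD(2)[OF this c]
    have e1: "\<forall>\<^sub>F m in at_right ?m0. r0\<^sup>2 * (- 1/2 + Phi ?d k m) + (norm b)\<^sup>2 / 2 < c" .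
    have "((\<lambda>m. (real ?d - real k) * m) \<longlongrightarrow> (real ?d - real k) * ?m0) (at_right ?m0)"
      by (intro tendsto_intros)
    from order_tendstoD(2)[OF this conv0]
    have e2: "\<forall>\<^sub>F m in at_right ?m0. (real ?d - real k) * m < real k" .
    have "\<forall>\<^sub>F m in at_right ?m0. r0\<^sup>2 * (- 1/2 + Phi ?d k m) + (norm b)\<^sup>2 / 2 < c
        \<and> (real ?d - real k) * m < real k \<and> ?m0 < m"
      by (intro eventually_conj e1 e2 eventually_at_right_less)
    then obtain m where m: "r0\<^sup>2 * (- 1/2 + Phi ?d k m) + (norm b)\<^sup>2 / 2 < c" "(real ?d - real k) * m < real k" "?m0 < m"
      using eventually_happens'[OF trivial_limit_at_right_real] by blast
    have m1: "m > -1" using m(3) m0 by linarith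
    obtain s0 G where rad: "radial TYPE('n) r0 k m s0 G" using radial_exists[OF d3 k1 kd r0 m1] .
    interpret rad: radial b r0 k m s0 G by (rule rad)
    define n where "n = (x0 + b) /\<^sub>R r0"
    have xb: "norm (x0 + b) = r0" using dist by (simp add: dist_minus_center)
    have x0n: "x0 + b = r0 *\<^sub>R n" using r0 by (simp add: n_def)
    have nn: "n \<bullet> n = 1" using xb r0 by (simp add: n_def power2_norm_eq_inner[symmetric] power2_eq_square)
    have xU: "x0 + 0 *\<^sub>R n \<in> U" using frontier_not_in[OF xf] U_sub by auto
    have xV: "x0 + 0 *\<^sub>R n \<in> rad.V" using xb by (intro rad.in_V) simp
    have D: "((\<lambda>t. u (x0 + t *\<^sub>R n) - rad.v (x0 + t *\<^sub>R n)) has_real_derivative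
        grad u (x0 + 0 *\<^sub>R n) \<bullet> n - grad rad.v (x0 + 0 *\<^sub>R n) \<bullet> n) (at 0)"
      by (intro DERIV_diff has_derivative_along_line[OF smooth xU] has_derivative_along_line[OF rad.v_smooth xV])
    have gu: "grad u (x0 + 0 *\<^sub>R n) \<bullet> n = 1" using gx nn by (simp add: n_def)
    have "rad.q x0 = 1" using xb r0 by (simp add: rad.q_norm)
    then have "grad rad.v (x0 + 0 *\<^sub>R n) \<bullet> n = (1 + m) powr (1 / real k) * r0"
      using rad.v_grad[OF xV] nn by (simp add: x0n psi_def)
    moreover have "(1 + m) powr (1 / real k) * r0 > 1"
    proof -
      have "1 / r0 = (1 / r0 ^ k) powr (1 / real k)"
        using psi_at_1[OF r0 k1, of "CARD('n)"] by (simp add: psi_def)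
      also have "\<dots> < (1 + m) powr (1 / real k)"
        using m(3) r0 k1 by (intro powr_less_mono2) auto
      finally show ?thesis using r0 by (simp add: field_simps)
    qed
    ultimately have "grad u (x0 + 0 *\<^sub>R n) \<bullet> n - grad rad.v (x0 + 0 *\<^sub>R n) \<bullet> n < 0" using gu by simp
    from DERIV_neg_dec_right[OF D this]
    obtain dl where dl: "dl > 0" "\<And>h. 0 < h \<Longrightarrow> h < dl \<Longrightarrow>
        u (x0 + h *\<^sub>R n) - rad.v (x0 + h *\<^sub>R n) < u x0 - rad.v x0" by auto
    have "u x0 - rad.v x0 = 0" using u_zero[OF xf] rad.v_sphere[OF xb] by simp
    then have "u (x0 + (dl/2) *\<^sub>R n) < rad.v (x0 + (dl/2) *\<^sub>R n)" using dl(2)[of "dl/2"] dl(1) by simp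
    moreover have "rad.v (x0 + (dl/2) *\<^sub>R n) \<le> u (x0 + (dl/2) *\<^sub>R n)"
    proof (rule lower_comparison[OF rad m(2) Omb])
      have "x0 + (dl/2) *\<^sub>R n + b = (r0 + dl/2) *\<^sub>R n" using x0n by (simp add: algebra_simps)
      moreover have "norm n = 1" using nn by (simp add: norm_eq_1)
      ultimately show "r0 \<le> norm (x0 + (dl/2) *\<^sub>R n + b)" using dl r0 by simp
    qed (use m(1) in simp)
    ultimately show False by simp
  qed
  then show thesis using that[OF r0 Omb sup] by blast
qed

end

section \<open>Upper comparison and identification of the solution\<close>

context P_solution
begin

text \<open>From any point of the closed ball outside \<open>Om\<close>, moving along the gradient
  of \<open>u\<close> raises \<open>u\<close> faster than the barrier. A positive maximum of the
  difference would thus lie strictly outside the ball, where both functions solve the equation and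
  the maximum principle applies.\<close>

lemma upper_comparison:
  assumes R: "R > 0" and sup: "real CARD('n) - real k < real CARD('n) * R ^ k"
    and Omb: "Om \<subseteq> ball (- b) R"
    and rad: "radial TYPE('n) R k (1 / R ^ k - 1) s0 G"
    and c: "c = radius_const CARD('n) k R + (norm b)\<^sup>2 / 2"
    and x: "x \<notin> Om"
  shows "u x \<le> (if norm (x + b) \<ge> R then radial.v b R G x else norm (x + b) - R)"
proof (rule ccontr)
  interpret rad: radial b R k "1 / R ^ k - 1" s0 G by (rule rad)
  define B where "B x = (if norm (x + b) \<ge> R then rad.v x else norm (x + b) - R)" for x
  define W where "W x = u x - B x" for x
  assume "\<not> ?thesis"
  then have Wx: "W x > 0" by (simp add: W_def B_def)
  have B0: "B y = 0" if "norm (y + b) = R" for y using rad.v_sphere[OF that] that by (simp add: B_def)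
  have Bin: "B y = norm (y + b) - R" if "norm (y + b) \<le> R" for y
    using B0[of y] that by (cases "norm (y + b) = R") (auto simp: B_def)
  have Bout: "B y = rad.v y" if "norm (y + b) \<ge> R" for y using that by (simp add: B_def)
  have cB: "continuous_on UNIV B"
  proof -
    have "continuous_on ({y. R \<le> norm (y + b)} \<union> {y. norm (y + b) \<le> R}) (\<lambda>y. if norm (y + b) \<ge> R then rad.v y else norm (y + b) - R)"
    proof (rule continuous_on_cases)
      show "closed {y. R \<le> norm (y + b)}" "closed {y. norm (y + b) \<le> R}"
        by (intro closed_Collect_le continuous_intros)+
      show "continuous_on {y. R \<le> norm (y + b)} rad.v"
        using rad.in_V by (intro continuous_on_subset[OF smooth_on_continuous[OF rad.v_smooth]]) auto
      show "continuous_on {y. norm (y + b) \<le> R} (\<lambda>y. norm (y + b) - R)" by (intro continuous_intros)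
      show "\<forall>y. y \<in> {y. R \<le> norm (y + b)} \<and> \<not> R \<le> norm (y + b) \<or> y \<in> {y. norm (y + b) \<le> R} \<and> R \<le> norm (y + b)
          \<longrightarrow> rad.v y = norm (y + b) - R"
        using rad.v_sphere by auto
    qed
    moreover have "{y. R \<le> norm (y + b)} \<union> {y. norm (y + b) \<le> R} = UNIV" by auto
    ultimately show ?thesis by (simp add: B_def[abs_def])
  qed
  have cu: "continuous_on (- Om) u" using smooth_on_continuous[OF smooth] U_sub by (rule continuous_on_subset)
  have cW: "continuous_on (- Om) W"
    unfolding W_def by (intro continuous_on_diff cu continuous_on_subset[OF cB]) auto
  have "((\<lambda>y. u y - rad.v y) \<longlongrightarrow> 0) at_infinity"
    using difference_limit[OF rad] c by (simp add: radius_const_def)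
  moreover have "\<forall>\<^sub>F y in at_infinity. u y - rad.v y = W y"
    unfolding eventually_at_infinity
  proof (intro exI[of _ "R + norm b"] allI impI)
    fix y :: "real^'n" assume "R + norm b \<le> norm y"
    then have "norm (y + b) \<ge> R" using norm_diff_ineq[of y b] by linarith
    then show "u y - rad.v y = W y" by (simp add: W_def Bout)
  qed
  ultimately have "(W \<longlongrightarrow> 0) at_infinity" by (rule Lim_transform_eventually)
  from far_region[OF this Wx]
  obtain R1 where R1: "norm x < R1" "\<And>y. norm y \<ge> R1 \<Longrightarrow> W y < W x" by blast
  let ?K = "- Om \<inter> cball 0 R1"
  have "compact ?K" using Om_open by (intro closed_Int_compact) auto
  moreover have xK: "x \<in> ?K" using x R1(1) by simp
  moreover have "continuous_on ?K W" by (rule continuous_on_subset[OF cW]) auto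
  ultimately obtain z where z: "z \<in> ?K" "\<And>y. y \<in> ?K \<Longrightarrow> W y \<le> W z"
    using continuous_attains_sup[of ?K W] by blast
  have Wz: "W z > 0" using z(2)[OF xK] Wx by simp
  have zO: "z \<notin> Om" using z(1) by simp
  have zmax: "W y \<le> W z" if "y \<notin> Om" for y
  proof (cases "norm y \<le> R1")
    case False
    then have "W y < W x" using R1(2)[of y] by simp
    then show ?thesis using z(2)[OF xK] by simp
  qed (use z(2) that in auto)
  \<comment> \<open>Stated for every maximiser rather than for \<open>z\<close> alone, because the
    final comparison needs strict inequality on the sphere.\<close>
  have inner_no_max: "norm (y + b) > R" if y: "y \<notin> Om" "W y = W z" for y
  proof (rule ccontr)
    assume "\<not> norm (y + b) > R"
    then have a: "norm (y + b) \<le> R" by simp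
    have ymax: "W w \<le> W y" if "w \<notin> Om" for w using zmax[OF that] y(2) by simp
    have yU: "y + 0 *\<^sub>R e \<in> U" for e using y(1) U_sub by auto
    show False
    proof (cases "y \<in> closure Om")
      case True
      then have yf: "y \<in> frontier Om" using y(1) by (simp add: in_frontier_iff)
      then have uy: "u y = 0" by (rule u_zero)
      \<comment> \<open>On the boundary of \<open>Om\<close> a positive difference forces the
        barrier to be negative, so \<open>y\<close> is strictly inside the ball and there is room to
        move.\<close>
      then have "B y < 0" using Wz y(2) by (simp add: W_def)
      then have aR: "norm (y + b) < R" using Bin[OF a] by simp
      let ?n = "grad u y"
      have n1: "norm ?n = 1" by (rule norm_grad_frontier[OF yf])
      then have n0: "?n \<noteq> 0" by auto
      obtain mu where mu: "mu > 0" "?n = mu *\<^sub>R nrm y" using grad_at_frontier[OF yf] by blast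
      have "?n \<bullet> nrm y > 0" using u_normal[OF yf] by simp
      from crossing[OF yf this]
      obtain d where d: "d > 0" "\<And>t. 0 < t \<Longrightarrow> t < d \<Longrightarrow> y + t *\<^sub>R ?n \<notin> Om" by blast
      define t where "t = min d (R - norm (y + b)) / 2"
      have t: "0 < t" "t < d" "t < R - norm (y + b)" using d aR by (auto simp: t_def)
      have out: "y + s *\<^sub>R ?n \<notin> Om" if "0 \<le> s" "s \<le> t" for s
        using d(2)[of s] that t y(1) by (cases "s = 0") auto
      have outU: "y + s *\<^sub>R ?n \<in> U" if "0 \<le> s" "s \<le> t" for s using out[OF that] U_sub by auto
      \<comment> \<open>Here the slope of \<open>u\<close> at the start is only equal to 1; the
        strict gain comes from strict convexity along the normal.\<close>
      have "u (y + 0 *\<^sub>R ?n) - 0 < u (y + t *\<^sub>R ?n) - t"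
      proof (rule DERIV_pos_imp_increasing_open[OF t(1), where f = "\<lambda>s. u (y + s *\<^sub>R ?n) - s"])
        fix s assume s: "0 < s" "s < t"
        have "((\<lambda>s. u (y + s *\<^sub>R ?n) - s) has_real_derivative grad u (y + s *\<^sub>R ?n) \<bullet> ?n - 1) (at s)"
          using s by (intro DERIV_diff has_derivative_along_line[OF smooth outU] DERIV_ident) auto
        moreover have "grad u y \<bullet> ?n < grad u (y + s *\<^sub>R ?n) \<bullet> ?n"
          using s out by (intro grad_increasing_along_ray n0) auto
        ultimately show "\<exists>l. ((\<lambda>s. u (y + s *\<^sub>R ?n) - s) has_real_derivative l) (at s) \<and> 0 < l"
          using n1 by (intro exI[of _ "grad u (y + s *\<^sub>R ?n) \<bullet> ?n - 1"]) (simp add: norm_eq_1)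
      next
        show "continuous_on {0..t} (\<lambda>s. u (y + s *\<^sub>R ?n) - s)"
          by (intro continuous_intros continuous_on_compose2[OF smooth_on_continuous[OF smooth]]) (use outU in auto)
      qed
      then have "u (y + t *\<^sub>R ?n) > t" using uy by simp
      moreover have "norm (y + t *\<^sub>R ?n + b) \<le> norm (y + b) + t"
        using norm_triangle_ineq[of "y + b" "t *\<^sub>R ?n"] n1 t(1) by (simp add: algebra_simps)
      then have "B (y + t *\<^sub>R ?n) \<le> B y + t" using t(3) Bin[OF a] Bin[of "y + t *\<^sub>R ?n"] by simp
      ultimately have "W (y + t *\<^sub>R ?n) > W y" using uy by (simp add: W_def)
      then show False using ymax[OF out[of t]] t by simp
    next
      case False
      let ?g = "grad u y"
      have g1: "norm ?g > 1" by (rule norm_grad_gt_1[OF False])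
      define e where "e = ?g /\<^sub>R norm ?g"
      have ge0: "?g \<noteq> 0" using g1 by auto
      have e1: "norm e = 1" using ge0 by (simp add: e_def)
      have ge: "?g \<bullet> e = norm ?g" using ge0 by (simp add: e_def power2_norm_eq_inner[symmetric] power2_eq_square)
      have "((\<lambda>t. u (y + t *\<^sub>R e) - t) has_real_derivative grad u (y + 0 *\<^sub>R e) \<bullet> e - 1) (at 0)"
        by (intro DERIV_diff has_derivative_along_line[OF smooth yU] DERIV_ident)
      from DERIV_pos_inc_right[OF this] g1 ge
      obtain d1 where d1: "d1 > 0" "\<And>h. 0 < h \<Longrightarrow> h < d1 \<Longrightarrow> u y < u (y + h *\<^sub>R e) - h" by auto
      obtain d2 where d2: "d2 > 0" "ball y d2 \<subseteq> - closure Om"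
        using False open_contains_ball[of "- closure Om"] by (auto simp: open_Compl)
      have out: "y + h *\<^sub>R e \<notin> Om" if "0 < h" "h < d2" for h
        using near_outside[OF d2(2), of "y + h *\<^sub>R e"] that e1 by (simp add: dist_norm)
      have inc: "norm (y + h *\<^sub>R e + b) \<le> norm (y + b) + h" if "0 < h" for h
        using norm_triangle_ineq[of "y + b" "h *\<^sub>R e"] e1 that by (simp add: algebra_simps)
      show False
      proof (cases "norm (y + b) = R")
        case aR: False
        define h where "h = min (min d1 d2) (R - norm (y + b)) / 2"
        have h: "0 < h" "h < d1" "h < d2" "h < R - norm (y + b)" using d1 d2 a aR by (auto simp: h_def)
        have "B (y + h *\<^sub>R e) \<le> B y + h" using inc[OF h(1)] h(4) Bin[OF a] Bin[of "y + h *\<^sub>R e"] by simp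
        then have "W (y + h *\<^sub>R e) > W y" using d1(2)[OF h(1,2)] by (simp add: W_def)
        then show False using ymax[OF out[OF h(1,3)]] by simp
      next
        case aR: True
        have yV: "y + 0 *\<^sub>R e \<in> rad.V" using aR by (intro rad.in_V) simp
        have "rad.q y = 1" using aR R by (simp add: rad.q_norm)
        then have gv: "grad rad.v y = (1 / R) *\<^sub>R (y + b)"
          using rad.v_grad[of y] yV psi_at_1[OF R k1] by simp
        then have "norm (grad rad.v y) = 1" using aR R by simp
        then have "grad rad.v y \<bullet> e \<le> 1" using norm_cauchy_schwarz[of "grad rad.v y" e] e1 by simp
        then have gp: "grad u (y + 0 *\<^sub>R e) \<bullet> e - grad rad.v (y + 0 *\<^sub>R e) \<bullet> e > 0" using g1 ge by simp
        have "((\<lambda>t. u (y + t *\<^sub>R e) - rad.v (y + t *\<^sub>R e)) has_real_derivative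
            grad u (y + 0 *\<^sub>R e) \<bullet> e - grad rad.v (y + 0 *\<^sub>R e) \<bullet> e) (at 0)"
          by (intro DERIV_diff has_derivative_along_line[OF smooth yU] has_derivative_along_line[OF rad.v_smooth yV])
        from DERIV_pos_inc_right[OF this gp]
        obtain d3 where d3: "d3 > 0" "\<And>h. 0 < h \<Longrightarrow> h < d3 \<Longrightarrow> u y - rad.v y < u (y + h *\<^sub>R e) - rad.v (y + h *\<^sub>R e)"
          by auto
        define h where "h = min (min d1 d2) d3 / 2"
        have h: "0 < h" "h < d1" "h < d2" "h < d3" using d1 d2 d3 by (auto simp: h_def)
        \<comment> \<open>The step from the sphere may end on either side. Outside, the radial
          solution takes over, whose gradient on the sphere also has length 1; inside, the cone
          grows by at most \<open>h\<close>.\<close>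
        have "W (y + h *\<^sub>R e) > W y"
        proof (cases "norm (y + h *\<^sub>R e + b) \<ge> R")
          case True
          then show ?thesis using d3(2)[OF h(1,4)] aR by (simp add: W_def Bout)
        next
          case f: False
          then have "B (y + h *\<^sub>R e) \<le> B y + h" using inc[OF h(1)] Bin[OF a] Bin[of "y + h *\<^sub>R e"] by simp
          then show ?thesis using d1(2)[OF h(1,2)] by (simp add: W_def)
        qed
        then show False using ymax[OF out[OF h(1,3)]] by simp
      qed
    qed
  qed
  let ?S = "{y. R < norm (y + b)} \<inter> ball 0 R1"
  have oS: "open ?S" by (intro open_Int open_Collect_less continuous_intros) auto
  have zb: "norm (z + b) > R" by (rule inner_no_max[OF zO refl])
  have Wx_le: "W x \<le> W z" by (rule zmax[OF x])
  show False
  proof (rule comparison_no_interior_max[OF k1 kd, of ?S u rad.v z])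
    show "bounded ?S" by (rule bounded_subset[OF bounded_ball[of 0 R1]]) auto
    show "smooth_on ?S rad.v"
      using rad.in_V by (intro smooth_on_subset[OF rad.v_smooth oS]) auto
    have SU: "?S \<subseteq> U" using outside_ball(1)[OF Omb] U_sub by auto
    then show "smooth_on ?S u" by (intro smooth_on_subset[OF smooth oS])
    have "closure ?S \<subseteq> rad.V" "closure ?S \<subseteq> U"
      using rad.in_V annulus_closure outside_ball(1)[OF Omb] U_sub by auto
    then show "continuous_on (closure ?S) (\<lambda>x. u x - rad.v x)"
      by (intro continuous_on_diff continuous_on_subset[OF smooth_on_continuous[OF rad.v_smooth]]
          continuous_on_subset[OF smooth_on_continuous[OF smooth]])
    show "pos_def (hess u y)" if "y \<in> ?S" for y using that by (intro pos outside_ball(1)[OF Omb]) auto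
    show "sigma_k k (eigvals (hess u y)) = sigma_k k (eigvals (hess rad.v y))" if "y \<in> ?S" for y
      using that rad.v_sigma_k[OF rad.in_V] equation[OF outside_ball(2)[OF Omb]] by simp
    have "norm z < R1" using R1(2)[of z] Wx_le by (meson not_le)
    then show "z \<in> ?S" using zb by auto
    show "u y - rad.v y < u z - rad.v z" if "y \<in> frontier ?S" for y
    proof -
      have yR: "norm (y + b) \<ge> R" "norm (y + b) = R \<or> norm y \<ge> R1" using annulus_frontier[OF that] by auto
      have yO: "y \<notin> Om" by (rule outside_ball(1)[OF Omb yR(1)])
      have "W y < W z"
        using yR(2)
      proof
        assume "norm (y + b) = R"
        then have "W y \<noteq> W z" using inner_no_max[OF yO] by auto
        then show ?thesis using zmax[OF yO] by simp
      next
        assume "norm y \<ge> R1"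
        then show ?thesis using R1(2)[of y] Wx_le by simp
      qed
      then show ?thesis using yR(1) zb by (simp add: W_def Bout)
    qed
  qed (rule oS)
qed

text \<open>The circumscribed radius has a constant at least \<open>c\<close>, so antimonotonicity
  bounds it by \<open>R\<close>. Conversely, at a point of the ball outside \<open>Om\<close> the
  barrier would make \<open>u\<close> negative. On the complement of the ball the two comparisons
  meet.\<close>

lemma solution_is_radial:
  assumes R: "R > 0" and sup: "real CARD('n) - real k < real CARD('n) * R ^ k"
    and rad: "radial TYPE('n) R k (1 / R ^ k - 1) s0 G"
    and c: "c = radius_const CARD('n) k R + (norm b)\<^sup>2 / 2"
  shows "Om = ball (- b) R" "x \<notin> Om \<Longrightarrow> u x = radial.v b R G x"
proof -
  obtain r0 where r0: "r0 > 0" and Om0: "Om \<subseteq> ball (- b) r0"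
    and c0: "c \<le> radius_const CARD('n) k r0 + (norm b)\<^sup>2 / 2"
    using circumscribed_constant by metis
  have "r0 \<le> R"
  proof (rule ccontr)
    assume "\<not> r0 \<le> R"
    then have "radius_const CARD('n) k r0 < radius_const CARD('n) k R"
      using sup by (intro radius_const_strict_antimono d3 k1 kd R) auto
    then show False using c c0 by simp
  qed
  then have "ball (- b) r0 \<subseteq> ball (- b) R" by (rule subset_ball)
  with Om0 have Omb: "Om \<subseteq> ball (- b) R" by blast
  note up = upper_comparison[OF R sup Omb rad c]
  have "y \<in> Om" if "y \<in> ball (- b) R" for y
  proof (rule ccontr)
    assume y: "y \<notin> Om"
    then have "u y \<le> norm (y + b) - R" using up[OF y] that by (simp add: dist_minus_center)
    then show False using u_nonneg[OF y] that by (simp add: dist_minus_center)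
  qed
  with Omb show Om: "Om = ball (- b) R" by blast
  assume x: "x \<notin> Om"
  then have xR: "norm (x + b) \<ge> R" using Om by (simp add: dist_minus_center)
  have conv: "(real CARD('n) - real k) * (1 / R ^ k - 1) < real k"
    by (rule supercritical_slope[OF R sup])
  have "radial.v b R G x \<le> u x"
    using c by (intro lower_comparison[OF rad conv Omb _ xR]) (simp add: radius_const_def)
  moreover have "u x \<le> radial.v b R G x" using up[OF x] xR by simp
  ultimately show "u x = radial.v b R G x" by simp
qed

end

text \<open>The chosen defining function need not be the quadratic one. It vanishes at
  \<open>x\<close> and is nonnegative outside the ball, so \<open>grad_halfspace\<close> fixes the
  direction of its gradient.\<close>

lemma outer_normal_ball:
  fixes b :: "real^'n::finite"
  assumes R: "R > 0" and x: "norm (x + b) = R"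
  shows "outer_normal (ball (- b) R) x = (x + b) /\<^sub>R R"
proof -
  let ?Om = "ball (- b) R"
  have D: "smooth_bounded_domain ?Om" by (rule ball_smooth_bounded_domain[OF R])
  obtain phi where phi: "defining_fun ?Om phi" "\<And>x. outer_normal ?Om x = grad phi x /\<^sub>R norm (grad phi x)"
    using outer_normal_defining_fun[OF D] by blast
  have xf: "x \<in> frontier ?Om" using R x by (simp add: dist_minus_center)
  have p0: "phi x = 0" using frontier_defining_fun[OF phi(1) _ xf] by simp
  have sm: "smooth_on UNIV phi" and Om: "?Om = {x. phi x < 0}" and g0: "grad phi x \<noteq> 0"
    using phi(1) p0 by (auto simp: defining_fun_def)
  have xb0: "x + b \<noteq> 0" using x R by auto
  have "\<exists>mu\<ge>0. grad phi x = mu *\<^sub>R (x + b)"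
  proof (rule grad_halfspace[OF smooth_on_has_derivative[OF sm] xb0])
    fix e assume e: "e \<bullet> (x + b) > 0"
    have "phi x \<le> phi (x + t *\<^sub>R e)" if "t > 0" for t
    proof -
      have "(w + t *\<^sub>R e) \<bullet> (w + t *\<^sub>R e) = w \<bullet> w + 2 * t * (e \<bullet> w) + t\<^sup>2 * (e \<bullet> e)" for w
        by (simp add: inner_simps inner_commute power2_eq_square algebra_simps)
      from this[of "x + b"]
      have "(x + b + t *\<^sub>R e) \<bullet> (x + b + t *\<^sub>R e) = R\<^sup>2 + 2 * t * (e \<bullet> (x + b)) + t\<^sup>2 * (e \<bullet> e)"
        by (simp only: power2_norm_eq_inner[of "x + b", symmetric] x)
      moreover have "2 * t * (e \<bullet> (x + b)) \<ge> 0" "t\<^sup>2 * (e \<bullet> e) \<ge> 0" using that e by auto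
      ultimately have "R\<^sup>2 \<le> (norm (x + b + t *\<^sub>R e))\<^sup>2" by (simp add: power2_norm_eq_inner)
      then have "R \<le> norm (x + b + t *\<^sub>R e)" by (rule power2_le_imp_le) simp
      moreover have "x + b + t *\<^sub>R e = x + t *\<^sub>R e + b" by simp
      ultimately have "x + t *\<^sub>R e \<notin> ?Om" by (simp add: dist_minus_center)
      then show ?thesis unfolding Om using p0 by simp
    qed
    then show "\<exists>d>0. \<forall>t. 0 < t \<and> t < d \<longrightarrow> phi x \<le> phi (x + t *\<^sub>R e)" by (intro exI[of _ 1]) auto
  qed simp
  then obtain mu where mu: "mu \<ge> 0" "grad phi x = mu *\<^sub>R (x + b)" by blast
  then have "mu > 0" using g0 by (cases "mu = 0") auto
  then show ?thesis using x R by (simp add: phi(2) mu(2))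
qed

lemma radial_solves_P:
  fixes b :: "real^'n::finite"
  assumes d: "3 \<le> CARD('n)" and k: "1 \<le> k" "k \<le> CARD('n)" and R: "R > 0"
    and sup: "real CARD('n) - real k < real CARD('n) * R ^ k"
    and rad: "radial TYPE('n) R k (1 / R ^ k - 1) s0 G"
    and c: "c = radius_const CARD('n) k R + (norm b)\<^sup>2 / 2"
  shows "solves_P k (ball (- b) R) b c (radial.v b R G)"
    and "strictly_convex_on (- ball (- b) R) (radial.v b R G)"
proof -
  interpret rad: radial b R k "1 / R ^ k - 1" s0 G by (rule rad)
  have conv: "(real CARD('n) - real k) * (1 / R ^ k - 1) < real k"
    by (rule supercritical_slope[OF R sup])
  have out: "norm (x + b) \<ge> R" if "x \<notin> ball (- b) R" for x using that by (simp add: dist_minus_center)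
  show "strictly_convex_on (- ball (- b) R) rad.v"
    unfolding strictly_convex_on_def by (intro ballI rad.v_pos_def[OF out conv]) simp
  show "solves_P k (ball (- b) R) b c rad.v"
    unfolding solves_P_def
  proof (intro conjI ballI allI impI)
    show "\<exists>U. - ball (- b) R \<subseteq> U \<and> smooth_on U rad.v"
      using out rad.in_V rad.v_smooth by (intro exI[of _ rad.V]) auto
    show "sigma_k k (eigvals (hess rad.v x)) = real (CARD('n) choose k)" if "x \<notin> closure (ball (- b) R)" for x
    proof -
      have "x \<notin> ball (- b) R" using that closure_subset by blast
      then show ?thesis by (intro rad.v_sigma_k rad.in_V out)
    qed
    show "((\<lambda>x. rad.v x - ((1/2) * (x \<bullet> x) + b \<bullet> x + c)) \<longlongrightarrow> 0) at_infinity"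
      using rad.v_limit by (simp add: c radius_const_def)
    fix x assume "x \<in> frontier (ball (- b) R)"
    then have x: "norm (x + b) = R" using R by (simp add: dist_minus_center)
    show "rad.v x = 0" by (rule rad.v_sphere[OF x])
    have "rad.q x = 1" using x R by (simp add: rad.q_norm)
    moreover have "psi CARD('n) k (1 / R ^ k - 1) 1 = 1 / R"
      by (rule psi_at_1[OF R k(1)])
    moreover have "x \<in> rad.V" using x by (intro rad.in_V) simp
    ultimately have "grad rad.v x = (1 / R) *\<^sub>R (x + b)" using rad.v_grad[of x] by simp
    moreover have "(x + b) \<bullet> (x + b) = R\<^sup>2" using x by (simp add: power2_norm_eq_inner[symmetric])
    ultimately show "grad rad.v x \<bullet> outer_normal (ball (- b) R) x = 1"
      using R by (simp add: outer_normal_ball[OF R x] power2_eq_square)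
  qed
qed

theorem theorem1p2:
  fixes b :: "real^'n::finite" and k :: nat
  assumes "CARD('n) \<ge> 3" and "1 \<le> k" and "k \<le> CARD('n)"
  shows "(\<forall>c. c < c_star CARD('n) k b \<longrightarrow>
            (\<exists>!\<Omega>. smooth_bounded_domain \<Omega> \<and> (\<exists>u. solves_P k \<Omega> b c u \<and> strictly_convex_on (- \<Omega>) u))
          \<and> (\<forall>\<Omega>. smooth_bounded_domain \<Omega> \<and> (\<exists>u. solves_P k \<Omega> b c u \<and> strictly_convex_on (- \<Omega>) u) \<longrightarrow>
               (\<forall>u v. solves_P k \<Omega> b c u \<and> strictly_convex_on (- \<Omega>) u
                    \<and> solves_P k \<Omega> b c v \<and> strictly_convex_on (- \<Omega>) v \<longrightarrow> (\<forall>x\<in>- \<Omega>. u x = v x))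
             \<and> (\<exists>r0>0. \<Omega> = ball (- b) r0)
             \<and> (\<forall>u. solves_P k \<Omega> b c u \<and> strictly_convex_on (- \<Omega>) u \<longrightarrow>
                  (\<forall>x\<in>- \<Omega>. \<forall>y\<in>- \<Omega>. norm (x + b) = norm (y + b) \<longrightarrow> u x = u y))))
       \<and> (\<forall>c. c \<ge> c_star CARD('n) k b \<longrightarrow>
            (\<forall>\<Omega>. smooth_bounded_domain \<Omega> \<longrightarrow>
               \<not> (\<exists>u. solves_P k \<Omega> b c u \<and> strictly_convex_on (- \<Omega>) u)))"
proof (rule conjI; intro allI impI)
  fix c assume "c < c_star CARD('n) k b"
  then obtain R where R: "R > 0" "real CARD('n) - real k < real CARD('n) * R ^ k"
    "radius_const CARD('n) k R + (norm b)\<^sup>2 / 2 = c"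
    by (rule radius_const_surj[OF assms])
  have "1 / R ^ k - 1 > -1" using R(1) by simp
  then obtain s0 G where rad: "radial TYPE('n) R k (1 / R ^ k - 1) s0 G"
    by (rule radial_exists[OF assms R(1)])
  interpret rad: radial b R k "1 / R ^ k - 1" s0 G by (rule rad)
  let ?B = "ball (- b) R"
  have ex: "smooth_bounded_domain ?B" "solves_P k ?B b c rad.v" "strictly_convex_on (- ?B) rad.v"
    using ball_smooth_bounded_domain[OF R(1)] radial_solves_P[OF assms R(1,2) rad R(3)[symmetric]] by auto
  \<comment> \<open>Identifying every solution pair with the ball and the radial function gives both
    uniqueness claims, the shape of the domain and the symmetry of \<open>u\<close> at once.\<close>
  have uniq: "Om = ?B \<and> (\<forall>x\<in>- Om. u x = rad.v x)"
    if sol: "smooth_bounded_domain Om" "solves_P k Om b c u" "strictly_convex_on (- Om) u" for Om u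
  proof -
    obtain U where "P_solution Om U u (outer_normal Om) k b c"
      by (rule P_solutionI[OF assms sol])
    then interpret P_solution Om U u "outer_normal Om" k b c .
    show ?thesis using solution_is_radial[OF R(1,2) rad R(3)[symmetric]] by auto
  qed
  show "(\<exists>!\<Omega>. smooth_bounded_domain \<Omega> \<and> (\<exists>u. solves_P k \<Omega> b c u \<and> strictly_convex_on (- \<Omega>) u))
          \<and> (\<forall>\<Omega>. smooth_bounded_domain \<Omega> \<and> (\<exists>u. solves_P k \<Omega> b c u \<and> strictly_convex_on (- \<Omega>) u) \<longrightarrow>
               (\<forall>u v. solves_P k \<Omega> b c u \<and> strictly_convex_on (- \<Omega>) u
                    \<and> solves_P k \<Omega> b c v \<and> strictly_convex_on (- \<Omega>) v \<longrightarrow> (\<forall>x\<in>- \<Omega>. u x = v x))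
             \<and> (\<exists>r0>0. \<Omega> = ball (- b) r0)
             \<and> (\<forall>u. solves_P k \<Omega> b c u \<and> strictly_convex_on (- \<Omega>) u \<longrightarrow>
                  (\<forall>x\<in>- \<Omega>. \<forall>y\<in>- \<Omega>. norm (x + b) = norm (y + b) \<longrightarrow> u x = u y)))"
  proof (intro conjI allI impI)
    show "\<exists>!\<Omega>. smooth_bounded_domain \<Omega> \<and> (\<exists>u. solves_P k \<Omega> b c u \<and> strictly_convex_on (- \<Omega>) u)"
      using ex uniq by (intro ex1I[of _ ?B]) blast+
  next
    fix Om :: "(real^'n) set" and u v
    assume D: "smooth_bounded_domain Om \<and> (\<exists>u. solves_P k Om b c u \<and> strictly_convex_on (- Om) u)"
      and uv: "solves_P k Om b c u \<and> strictly_convex_on (- Om) u \<and> solves_P k Om b c v \<and> strictly_convex_on (- Om) v"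
    then show "\<forall>x\<in>- Om. u x = v x" using uniq[of Om u] uniq[of Om v] by simp
  next
    fix Om :: "(real^'n) set"
    assume "smooth_bounded_domain Om \<and> (\<exists>u. solves_P k Om b c u \<and> strictly_convex_on (- Om) u)"
    then have "Om = ?B" using uniq by blast
    then show "\<exists>r0>0. Om = ball (- b) r0" using R(1) by blast
  next
    fix Om :: "(real^'n) set" and u
    assume D: "smooth_bounded_domain Om \<and> (\<exists>u. solves_P k Om b c u \<and> strictly_convex_on (- Om) u)"
      and u: "solves_P k Om b c u \<and> strictly_convex_on (- Om) u"
    then have "\<forall>x\<in>- Om. u x = rad.v x" using uniq[of Om u] by simp
    then show "\<forall>x\<in>- Om. \<forall>y\<in>- Om. norm (x + b) = norm (y + b) \<longrightarrow> u x = u y"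
      by (simp add: rad.v_norm)
  qed
next
  fix c and Om :: "(real^'n) set"
  assume c: "c \<ge> c_star CARD('n) k b" and D: "smooth_bounded_domain Om"
  show "\<not> (\<exists>u. solves_P k Om b c u \<and> strictly_convex_on (- Om) u)"
  proof
    assume "\<exists>u. solves_P k Om b c u \<and> strictly_convex_on (- Om) u"
    then obtain u where u: "solves_P k Om b c u" "strictly_convex_on (- Om) u" by blast
    obtain U where "P_solution Om U u (outer_normal Om) k b c"
      by (rule P_solutionI[OF assms D u])
    then interpret P_solution Om U u "outer_normal Om" k b c .
    obtain r0 where "r0 > 0" "real CARD('n) - real k < real CARD('n) * r0 ^ k"
      "c \<le> radius_const CARD('n) k r0 + (norm b)\<^sup>2 / 2"
      using circumscribed_constant by metis
    then show False using radius_const_less_c_star[OF assms, of r0 b] c by simp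
  qed
qed

end
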